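(* If $(W_-,W_+)=(-\infty,+\infty)$, then the space $(\mathbb{R}\times S,\bar G)$ is metrically complete and geodesically complete. The subspace $(\mathbb{R}\times (S\cap C^\infty),\bar G)$ is geodesically complete.
   Context: $M$ is a smooth compact manifold (possibly with boundary or corners) of dimension at least $1$, and $\mu_0$ is a fixed smooth positive density on $M$ with $\int_M\mu_0=1$. $\langle f,h\rangle=\int_M fh\,\mu_0$ is the $L^2(\mu_0)$ inner product, $S=\{\varphi\in L^2(M,\mathbb{R}):\int_M\varphi^2\mu_0=1\}$ is the $L^2$-sphere with its standard metric $\langle d\varphi,d\varphi\rangle$, and $S\cap C^\infty=S\cap C^\infty(M,\mathbb{R})$. $C_1,C_2:(0,\infty)\to\mathbb{R}$ are smooth with $C_1(m)>0$ and $C_2(m)>-\frac1mC_1(m)$ for all $m>0$. Put $g_2(r)=4(C_1(r^2)+C_2(r^2)r^2)$, $W(r)=\int_1^r\sqrt{g_2(\rho)}\,d\rho$, $W_-=\lim_{r\to0+}W(r)$, $W_+=\lim_{r\to\infty}W(r)$; let $s\mapsto r(s)$, $(W_-,W_+)\to\mathbb{R}_{>0}$, be the inverse of $W$ and $a(s)=4C_1(r(s)^2)r(s)^2$. The metric is $\bar G_{(s,\varphi)}=a(s)\langle d\varphi,d\varphi\rangle+ds^2$ on $(W_-,W_+)\times S$, and its restriction to $(W_-,W_+)\times(S\cap C^\infty)$. Metrically complete means complete for the geodesic distance (infimum of lengths of paths); geodesically complete means that every geodesic extends to all times in $\mathbb{R}$ within the given space. *)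

theory Defs
  imports "HOL-Analysis.Analysis"
begin

section \<open>Smooth maps\<close>

text \<open>
  Maps of class \<open>C\<^sup>k\<close>, characterised by iterated directional derivatives; used only for open
  domains in a finite-dimensional space (where this is the usual notion, also for Banach-valued
  maps).
\<close>

primrec Ck_on :: "nat \<Rightarrow> 'a::euclidean_space set \<Rightarrow> ('a \<Rightarrow> 'b::real_normed_vector) \<Rightarrow> bool" where
  "Ck_on 0 U f \<longleftrightarrow> continuous_on U f"
| "Ck_on (Suc k) U f \<longleftrightarrow>
     (\<forall>x\<in>U. f differentiable (at x)) \<and> (\<forall>v. Ck_on k U (\<lambda>x. frechet_derivative f (at x) v))"

definition smooth_on :: "'a::euclidean_space set \<Rightarrow> ('a \<Rightarrow> 'b::real_normed_vector) \<Rightarrow> bool" where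
  "smooth_on U f \<longleftrightarrow> (\<forall>k. Ck_on k U f)"

text \<open>Smoothness on a set that need not be open: local extendability to a smooth map.\<close>

definition smooth_ext :: "'a::euclidean_space set \<Rightarrow> ('a \<Rightarrow> 'b::real_normed_vector) \<Rightarrow> bool" where
  "smooth_ext X f \<longleftrightarrow>
     (\<forall>x\<in>X. \<exists>U g. open U \<and> x \<in> U \<and> smooth_on U g \<and> (\<forall>y\<in>X \<inter> U. g y = f y))"

section \<open>Manifolds with corners and smooth densities\<close>

text \<open>
  Charts take values in the quadrant \<open>[0,\<infinity>)\<^sup>n\<close>, where \<open>n = CARD('n) \<ge> 1\<close>. Chart images contained in
  the open quadrant give manifolds without boundary.
\<close>

type_synonym ('m, 'n) chart = "'m set \<times> ('m \<Rightarrow> real ^ 'n)"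

definition quadrant :: "(real ^ 'n) set" where
  "quadrant = {v. \<forall>i. 0 \<le> v $ i}"

definition smooth_atlas ::
    "('m::topological_space, 'n::finite) chart set \<Rightarrow> bool" where
  "smooth_atlas \<A> \<longleftrightarrow>
     \<Union> (fst ` \<A>) = UNIV \<and>
     (\<forall>(U, x)\<in>\<A>. open U \<and> openin (top_of_set quadrant) (x ` U) \<and>
        (\<exists>y. homeomorphism U (x ` U) x y)) \<and>
     (\<forall>(U, x)\<in>\<A>. \<forall>(V, y)\<in>\<A>. smooth_ext (x ` (U \<inter> V)) (y \<circ> inv_into U x))"

definition smooth_function ::
    "('m, 'n::finite) chart set \<Rightarrow> ('m \<Rightarrow> real) \<Rightarrow> bool" where
  "smooth_function \<A> f \<longleftrightarrow> (\<forall>(U, x)\<in>\<A>. smooth_ext (x ` U) (f \<circ> inv_into U x))"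

text \<open>
  Smooth functions on \<open>D \<times> M\<close>, for \<open>D\<close> open in a Euclidean space. As \<open>M\<close> is compact, the exponential
  law identifies them with the smooth maps from \<open>D\<close> into the Frechet space \<open>C\<^sup>\<infinity>(M)\<close>.
\<close>

definition smooth_family ::
    "('m, 'n::finite) chart set \<Rightarrow> 'p::euclidean_space set \<Rightarrow> ('p \<Rightarrow> 'm \<Rightarrow> real) \<Rightarrow> bool" where
  "smooth_family \<A> D f \<longleftrightarrow>
     (\<forall>(U, x)\<in>\<A>. smooth_ext (D \<times> x ` U) (\<lambda>(p, v). f p (inv_into U x v)))"

text \<open>In each chart the density is \<open>\<rho> |dx\<^sub>1 \<dots> dx\<^sub>n|\<close> with \<open>\<rho>\<close> smooth and positive.\<close>

definition smooth_positive_density ::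
    "('m::topological_space, 'n::finite) chart set \<Rightarrow> 'm measure \<Rightarrow> bool" where
  "smooth_positive_density \<A> \<mu> \<longleftrightarrow>
     sets \<mu> = sets borel \<and>
     (\<forall>(U, x)\<in>\<A>. \<exists>\<rho>. smooth_ext (x ` U) \<rho> \<and> (\<forall>v\<in>x ` U. 0 < \<rho> v) \<and>
        (\<forall>B\<in>sets borel. B \<subseteq> U \<longrightarrow>
           emeasure \<mu> B = (\<integral>\<^sup>+ v. ennreal (\<rho> v) * indicator (x ` B) v \<partial>lborel)))"

section \<open>The space \<open>L\<^sup>2\<close>\<close>

text \<open>
  A type cannot depend on a measure, so the reference measure is attached to the type of points by
  a class without axioms.
\<close>

class reference_measure =
  fixes \<mu>\<^sub>0 :: "'a measure"

definition square_integrable :: "('m::reference_measure \<Rightarrow> real) \<Rightarrow> bool" where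
  "square_integrable f \<longleftrightarrow> f \<in> borel_measurable \<mu>\<^sub>0 \<and> integrable \<mu>\<^sub>0 (\<lambda>x. (f x)\<^sup>2)"

definition L2_eq :: "('m::reference_measure \<Rightarrow> real) \<Rightarrow> ('m \<Rightarrow> real) \<Rightarrow> bool" where
  "L2_eq f g \<longleftrightarrow> square_integrable f \<and> square_integrable g \<and> (AE x in \<mu>\<^sub>0. f x = g x)"

quotient_type (overloaded) 'm L2 = "'m::reference_measure \<Rightarrow> real" / partial: L2_eq
proof (rule part_equivpI)
  have "square_integrable (\<lambda>_::'m. 0::real)"
    by (simp add: square_integrable_def)
  then show "\<exists>f :: 'm \<Rightarrow> real. L2_eq f f"
    by (intro exI[of _ "\<lambda>_. 0"]) (simp add: L2_eq_def)
  show "symp (L2_eq :: ('m \<Rightarrow> real) \<Rightarrow> _)"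
    by (intro sympI) (auto simp: L2_eq_def elim: eventually_mono)
  show "transp (L2_eq :: ('m \<Rightarrow> real) \<Rightarrow> _)"
    by (intro transpI) (auto simp: L2_eq_def elim: eventually_elim2)
qed

lemma square_integrable_mult:
  assumes "square_integrable f" "square_integrable g"
  shows "integrable \<mu>\<^sub>0 (\<lambda>x. f x * g x)"
proof (rule Bochner_Integration.integrable_bound)
  show "integrable \<mu>\<^sub>0 (\<lambda>x. (f x)\<^sup>2 + (g x)\<^sup>2)"
    using assms by (auto simp: square_integrable_def)
  show "(\<lambda>x. f x * g x) \<in> borel_measurable \<mu>\<^sub>0"
    using assms by (auto simp: square_integrable_def)
  have "\<bar>a * b\<bar> \<le> a\<^sup>2 + b\<^sup>2" for a b :: real
  proof -
    have "2 * \<bar>a\<bar> * \<bar>b\<bar> \<le> \<bar>a\<bar>\<^sup>2 + \<bar>b\<bar>\<^sup>2"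
      by (rule sum_squares_bound)
    then show ?thesis
      using mult_nonneg_nonneg[of "\<bar>a\<bar>" "\<bar>b\<bar>"] unfolding abs_mult power2_abs by linarith
  qed
  then show "AE x in \<mu>\<^sub>0. norm (f x * g x) \<le> norm ((f x)\<^sup>2 + (g x)\<^sup>2)"
    by simp
qed

lemma square_integrable_add:
  assumes "square_integrable f" "square_integrable g"
  shows "square_integrable (\<lambda>x. f x + g x)"
proof -
  have "integrable \<mu>\<^sub>0 (\<lambda>x. (f x)\<^sup>2 + (g x)\<^sup>2 + 2 * (f x * g x))"
    using assms square_integrable_mult[OF assms] by (auto simp: square_integrable_def)
  then have "integrable \<mu>\<^sub>0 (\<lambda>x. (f x + g x)\<^sup>2)"
    by (simp add: power2_sum mult.assoc)
  then show ?thesis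
    using assms by (auto simp: square_integrable_def)
qed

lemma square_integrable_scale:
  assumes "square_integrable f"
  shows "square_integrable (\<lambda>x. c * f x)"
  using assms by (auto simp: square_integrable_def power_mult_distrib)

lemma square_integrable_uminus:
  assumes "square_integrable f"
  shows "square_integrable (\<lambda>x. - f x)"
  using square_integrable_scale[OF assms, of "-1"] by simp

lemma square_integrable_diff:
  assumes "square_integrable f" "square_integrable g"
  shows "square_integrable (\<lambda>x. f x - g x)"
  using square_integrable_add[OF assms(1) square_integrable_uminus[OF assms(2)]] by simp

instantiation L2 :: (reference_measure) real_inner
begin

lift_definition zero_L2 :: "'a L2" is "\<lambda>_. 0"
  by (simp add: L2_eq_def square_integrable_def)

lift_definition plus_L2 :: "'a L2 \<Rightarrow> 'a L2 \<Rightarrow> 'a L2" is "\<lambda>f g x. f x + g x"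
  by (auto simp: L2_eq_def square_integrable_add)

lift_definition minus_L2 :: "'a L2 \<Rightarrow> 'a L2 \<Rightarrow> 'a L2" is "\<lambda>f g x. f x - g x"
  by (auto simp: L2_eq_def square_integrable_diff)

lift_definition uminus_L2 :: "'a L2 \<Rightarrow> 'a L2" is "\<lambda>f x. - f x"
  by (auto simp: L2_eq_def square_integrable_uminus)

lift_definition scaleR_L2 :: "real \<Rightarrow> 'a L2 \<Rightarrow> 'a L2" is "\<lambda>c f x. c * f x"
  by (auto simp: L2_eq_def square_integrable_scale)

lift_definition inner_L2 :: "'a L2 \<Rightarrow> 'a L2 \<Rightarrow> real" is "\<lambda>f g. \<integral>x. f x * g x \<partial>\<mu>\<^sub>0"
  by (rule integral_cong_AE) (auto simp: L2_eq_def square_integrable_def elim: eventually_elim2)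

definition norm_L2 :: "'a L2 \<Rightarrow> real" where
  "norm_L2 f = sqrt (inner f f)"

definition sgn_L2 :: "'a L2 \<Rightarrow> 'a L2" where
  "sgn_L2 f = scaleR (inverse (norm f)) f"

definition dist_L2 :: "'a L2 \<Rightarrow> 'a L2 \<Rightarrow> real" where
  "dist_L2 f g = norm (f - g)"

definition uniformity_L2 :: "('a L2 \<times> 'a L2) filter" where
  "uniformity_L2 = (INF e\<in>{0<..}. principal {(f, g). dist f g < e})"

definition open_L2 :: "'a L2 set \<Rightarrow> bool" where
  "open_L2 X = (\<forall>f\<in>X. \<forall>\<^sub>F (f', g) in uniformity. f' = f \<longrightarrow> g \<in> X)"

instance
proof
  fix f g h :: "'a L2" and b c :: real
  note si = square_integrable_add square_integrable_diff square_integrable_uminus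
    square_integrable_scale
  show "f + g + h = f + (g + h)"
    by transfer (auto simp: L2_eq_def si algebra_simps)
  show "f + g = g + f"
    by transfer (auto simp: L2_eq_def si algebra_simps)
  show "0 + f = f"
    by transfer (auto simp: L2_eq_def)
  show "- f + f = 0"
    by transfer (auto simp: L2_eq_def square_integrable_def)
  show "f - g = f + - g"
    by transfer (auto simp: L2_eq_def si square_integrable_diff)
  show "c *\<^sub>R (f + g) = c *\<^sub>R f + c *\<^sub>R g"
    by transfer (auto simp: L2_eq_def distrib_left
        intro!: si(1)[OF si(4) si(4)] si(4)[OF si(1), unfolded distrib_left])
  show "(b + c) *\<^sub>R f = b *\<^sub>R f + c *\<^sub>R f"
    by transfer (auto simp: L2_eq_def distrib_right intro!: si(1)[OF si(4) si(4)])
  show "b *\<^sub>R c *\<^sub>R f = (b * c) *\<^sub>R f"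
    by transfer (auto simp: L2_eq_def si mult.assoc[symmetric])
  show "1 *\<^sub>R f = f"
    by transfer (auto simp: L2_eq_def)
  show "inner f g = inner g f"
    by transfer (simp add: mult.commute)
  show "inner (f + g) h = inner f h + inner g h"
    by transfer (auto simp: L2_eq_def distrib_right
        intro!: Bochner_Integration.integral_add square_integrable_mult)
  show "inner (c *\<^sub>R f) g = c * inner f g"
    by transfer (simp add: mult.assoc)
  show "0 \<le> inner f f"
    by transfer simp
  show "inner f f = 0 \<longleftrightarrow> f = 0"
  proof transfer
    fix f :: "'a \<Rightarrow> real"
    assume "L2_eq f f"
    then have f: "square_integrable f"
      by (simp add: L2_eq_def)
    have "(\<integral>x. f x * f x \<partial>\<mu>\<^sub>0) = 0 \<longleftrightarrow> (AE x in \<mu>\<^sub>0. f x * f x = 0)"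
      using square_integrable_mult[OF f f] by (intro integral_nonneg_eq_0_iff_AE) auto
    then show "(\<integral>x. f x * f x \<partial>\<mu>\<^sub>0) = 0 \<longleftrightarrow> L2_eq f (\<lambda>_. 0)"
      using f by (simp add: L2_eq_def square_integrable_def)
  qed
  show "norm f = sqrt (inner f f)"
    by (rule norm_L2_def)
  show "sgn f = inverse (norm f) *\<^sub>R f"
    by (rule sgn_L2_def)
  show "dist f g = norm (f - g)"
    by (rule dist_L2_def)
  show "(uniformity :: ('a L2 \<times> 'a L2) filter) = (INF e\<in>{0<..}. principal {(f, g). dist f g < e})"
    by (rule uniformity_L2_def)
  fix X :: "'a L2 set"
  show "open X = (\<forall>f\<in>X. \<forall>\<^sub>F (f', g) in uniformity. f' = f \<longrightarrow> g \<in> X)"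
    by (rule open_L2_def)
qed

end

definition L2_sphere :: "'m::reference_measure L2 set" where
  "L2_sphere = {\<phi>. inner \<phi> \<phi> = 1}"

definition smooth_L2 :: "('m::reference_measure, 'n::finite) chart set \<Rightarrow> 'm L2 set" where
  "smooth_L2 \<A> = {abs_L2 f | f. smooth_function \<A> f}"

section \<open>Smooth maps into the two spaces\<close>

text \<open>
  The sphere is a closed submanifold of the Hilbert space \<open>L\<^sup>2\<close>, so smooth maps into \<open>\<real> \<times> S\<close> are the
  smooth maps into \<open>\<real> \<times> L\<^sup>2\<close> that take values in \<open>\<real> \<times> S\<close>. Smooth maps into \<open>\<real> \<times> (S \<inter> C\<^sup>\<infinity>)\<close> are
  moreover smooth into the Frechet space \<open>C\<^sup>\<infinity>(M)\<close>; their \<open>L\<^sup>2\<close>-derivatives are the classes of the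
  pointwise derivatives of the representing family.
\<close>

definition smooth_into_S ::
    "'p::euclidean_space set \<Rightarrow> ('p \<Rightarrow> real \<times> 'm::reference_measure L2) \<Rightarrow> bool" where
  "smooth_into_S D \<Phi> \<longleftrightarrow> smooth_on D \<Phi> \<and> \<Phi> ` D \<subseteq> UNIV \<times> L2_sphere"

definition smooth_into_S_Cinf ::
    "('m::reference_measure, 'n::finite) chart set \<Rightarrow>
     'p::euclidean_space set \<Rightarrow> ('p \<Rightarrow> real \<times> 'm L2) \<Rightarrow> bool" where
  "smooth_into_S_Cinf \<A> D \<Phi> \<longleftrightarrow>
     smooth_on D \<Phi> \<and> \<Phi> ` D \<subseteq> UNIV \<times> (L2_sphere \<inter> smooth_L2 \<A>) \<and>
     (\<exists>f. smooth_family \<A> D f \<and> (\<forall>p\<in>D. snd (\<Phi> p) = abs_L2 (f p)))"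

section \<open>Geodesic distance and geodesics of a (weak) Riemannian metric\<close>

type_synonym 'v metric_tensor = "'v \<Rightarrow> 'v \<Rightarrow> 'v \<Rightarrow> real"

text \<open>The Lebesgue integral makes non-rectifiable paths have length \<open>\<infinity>\<close>.\<close>

definition path_length :: "'v::real_normed_vector metric_tensor \<Rightarrow> (real \<Rightarrow> 'v) \<Rightarrow> ennreal" where
  "path_length G \<gamma> =
     (\<integral>\<^sup>+ t\<in>{0..1}. ennreal (sqrt (G (\<gamma> t) (vector_derivative \<gamma> (at t)) (vector_derivative \<gamma> (at t))))
        \<partial>lborel)"

definition geodesic_dist ::
    "'v::real_normed_vector set \<Rightarrow> 'v metric_tensor \<Rightarrow> 'v \<Rightarrow> 'v \<Rightarrow> real" where
  "geodesic_dist X G p q =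
     enn2real (INF \<gamma>\<in>{\<gamma>. valid_path \<gamma> \<and> path_image \<gamma> \<subseteq> X \<and> pathstart \<gamma> = p \<and> pathfinish \<gamma> = q}.
       path_length G \<gamma>)"

definition energy ::
    "'v::real_normed_vector metric_tensor \<Rightarrow> real \<Rightarrow> real \<Rightarrow> (real \<Rightarrow> 'v) \<Rightarrow> real" where
  "energy G t\<^sub>0 t\<^sub>1 \<gamma> =
     integral {t\<^sub>0..t\<^sub>1} (\<lambda>t. G (\<gamma> t) (vector_derivative \<gamma> (at t)) (vector_derivative \<gamma> (at t))) / 2"

text \<open>
  A geodesic on the open interval \<open>I\<close> is a smooth curve whose restriction to any compact subinterval
  is a critical point of the energy under smooth variations with fixed endpoints. The predicates
  \<open>P\<^sub>1\<close> and \<open>P\<^sub>2\<close> express smoothness, into the space considered, of maps in one and in two real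
  variables.
\<close>

definition geodesic ::
    "(real set \<Rightarrow> (real \<Rightarrow> 'v) \<Rightarrow> bool) \<Rightarrow> ((real \<times> real) set \<Rightarrow> (real \<times> real \<Rightarrow> 'v) \<Rightarrow> bool) \<Rightarrow>
     'v::real_normed_vector metric_tensor \<Rightarrow> real set \<Rightarrow> (real \<Rightarrow> 'v) \<Rightarrow> bool" where
  "geodesic P\<^sub>1 P\<^sub>2 G I \<gamma> \<longleftrightarrow>
     P\<^sub>1 I \<gamma> \<and>
     (\<forall>t\<^sub>0 t\<^sub>1 J \<delta> \<Gamma>.
        t\<^sub>0 < t\<^sub>1 \<and> {t\<^sub>0..t\<^sub>1} \<subseteq> I \<and> {t\<^sub>0..t\<^sub>1} \<subseteq> J \<and> open J \<and> 0 < \<delta> \<and>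
        P\<^sub>2 ({-\<delta><..<\<delta>} \<times> J) \<Gamma> \<and>
        (\<forall>t\<in>{t\<^sub>0..t\<^sub>1}. \<Gamma> (0, t) = \<gamma> t) \<and>
        (\<forall>\<epsilon>\<in>{-\<delta><..<\<delta>}. \<Gamma> (\<epsilon>, t\<^sub>0) = \<gamma> t\<^sub>0 \<and> \<Gamma> (\<epsilon>, t\<^sub>1) = \<gamma> t\<^sub>1) \<longrightarrow>
        ((\<lambda>\<epsilon>. energy G t\<^sub>0 t\<^sub>1 (\<lambda>t. \<Gamma> (\<epsilon>, t))) has_real_derivative 0) (at 0))"

definition geodesically_complete ::
    "(real set \<Rightarrow> (real \<Rightarrow> 'v) \<Rightarrow> bool) \<Rightarrow> ((real \<times> real) set \<Rightarrow> (real \<times> real \<Rightarrow> 'v) \<Rightarrow> bool) \<Rightarrow>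
     'v::real_normed_vector metric_tensor \<Rightarrow> bool" where
  "geodesically_complete P\<^sub>1 P\<^sub>2 G \<longleftrightarrow>
     (\<forall>I \<gamma>. open I \<and> is_interval I \<and> I \<noteq> {} \<and> geodesic P\<^sub>1 P\<^sub>2 G I \<gamma> \<longrightarrow>
        (\<exists>\<eta>. geodesic P\<^sub>1 P\<^sub>2 G UNIV \<eta> \<and> (\<forall>t\<in>I. \<eta> t = \<gamma> t)))"

section \<open>The metric\<close>

definition g2 :: "(real \<Rightarrow> real) \<Rightarrow> (real \<Rightarrow> real) \<Rightarrow> real \<Rightarrow> real" where
  "g2 C\<^sub>1 C\<^sub>2 r = 4 * (C\<^sub>1 (r\<^sup>2) + C\<^sub>2 (r\<^sup>2) * r\<^sup>2)"

definition W :: "(real \<Rightarrow> real) \<Rightarrow> (real \<Rightarrow> real) \<Rightarrow> real \<Rightarrow> real" where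
  "W C\<^sub>1 C\<^sub>2 r = (LBINT \<rho>=1..r. sqrt (g2 C\<^sub>1 C\<^sub>2 \<rho>))"

definition W_minus :: "(real \<Rightarrow> real) \<Rightarrow> (real \<Rightarrow> real) \<Rightarrow> ereal" where
  "W_minus C\<^sub>1 C\<^sub>2 = Lim (at_right 0) (\<lambda>r. ereal (W C\<^sub>1 C\<^sub>2 r))"

definition W_plus :: "(real \<Rightarrow> real) \<Rightarrow> (real \<Rightarrow> real) \<Rightarrow> ereal" where
  "W_plus C\<^sub>1 C\<^sub>2 = Lim at_top (\<lambda>r. ereal (W C\<^sub>1 C\<^sub>2 r))"

definition radius :: "(real \<Rightarrow> real) \<Rightarrow> (real \<Rightarrow> real) \<Rightarrow> real \<Rightarrow> real" where
  "radius C\<^sub>1 C\<^sub>2 = the_inv_into {0<..} (W C\<^sub>1 C\<^sub>2)"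

definition warp :: "(real \<Rightarrow> real) \<Rightarrow> (real \<Rightarrow> real) \<Rightarrow> real \<Rightarrow> real" where
  "warp C\<^sub>1 C\<^sub>2 s = 4 * C\<^sub>1 ((radius C\<^sub>1 C\<^sub>2 s)\<^sup>2) * (radius C\<^sub>1 C\<^sub>2 s)\<^sup>2"

definition Gbar ::
    "(real \<Rightarrow> real) \<Rightarrow> (real \<Rightarrow> real) \<Rightarrow> (real \<times> 'm::reference_measure L2) metric_tensor" where
  "Gbar C\<^sub>1 C\<^sub>2 p v w = warp C\<^sub>1 C\<^sub>2 (fst p) * inner (snd v) (snd w) + fst v * fst w"

end

theory Submission
  imports Defs
begin

text \<open>
  The space is a warped product over the line, and both kinds of completeness come down to one fact:
  since \<open>W\<close> maps \<open>(0, \<infinity>)\<close> onto all of \<open>\<real>\<close>, the warping function \<open>a\<close> is smooth and positive on the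
  whole line (\<open>smooth_warp\<close>, \<open>warp_pos\<close>), and is therefore bounded from both sides on every compact
  interval.

  \<^bold>\<open>Metric completeness.\<close> A path of length \<open>l\<close> moves the radial coordinate by at most \<open>l\<close>
  (\<open>path_length_ge_radial\<close>). It thus stays in a compact interval of radii, where its length is at
  least a constant multiple of its displacement in \<open>L\<^sup>2\<close> (\<open>path_length_ge_angular\<close>). In the other
  direction, great circles bound the distance from above (\<open>short_path\<close>); for antipodal points this
  uses that \<open>L\<^sup>2\<close> has dimension at least two (\<open>orthogonal_unit\<close>). So on bounded sets the geodesic
  distance is equivalent to that of \<open>\<real> \<times> L\<^sup>2\<close>, in which \<open>\<real> \<times> S\<close> is closed, and \<open>L\<^sup>2\<close> is complete
  (\<open>L2_complete\<close>).

  \<^bold>\<open>Geodesic completeness.\<close> Critical curves \<open>(s, \<phi>)\<close> of the energy satisfy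
  \<open>s'' = a'(s) \<bar>\<phi>'\<bar>\<^sup>2 / 2\<close> and \<open>(a(s) \<phi>')' = - a(s) \<bar>\<phi>'\<bar>\<^sup>2 \<phi>\<close> (\<open>euler_lagrange\<close>), and conversely
  (\<open>geodesic_eq_critical\<close>). The angular momentum \<open>L = a(s) \<bar>\<phi>'\<bar>\<close> is conserved, \<open>\<phi>\<close> runs along a great
  circle with angular speed \<open>L / a(s)\<close>, and \<open>s\<close> moves like a particle in the potential
  \<open>L\<^sup>2 / (2 a(s))\<close> (\<open>geodesic_eq_explicit\<close>). This potential is nonnegative, so conservation of energy
  bounds the speed of the particle, which cannot escape to infinity in finite time
  (\<open>conservative_global\<close>).

  The argument is the same for smooth functions. The variations that give the equation of \<open>\<phi>\<close> push it
  towards a position \<open>\<phi>(\<tau>)\<close> of the same curve, and the great circle is spanned by two positions of the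
  curve. Both constructions stay in \<open>S \<inter> C\<^sup>\<infinity>\<close> if the curve does. The lemma \<open>geodesically_completeI\<close> is
  therefore stated for any notion of smooth curve that is stable under them.
\<close>

section \<open>Calculus of smooth maps\<close>

lemma Ck_on_cong:
  fixes f g :: "'a::euclidean_space \<Rightarrow> 'b::real_normed_vector"
  assumes "open U" and "\<And>x. x \<in> U \<Longrightarrow> f x = g x"
  shows "Ck_on k U f \<longleftrightarrow> Ck_on k U g"
  using assms(2)
proof (induction k arbitrary: f g)
  case 0
  then show ?case by (auto cong: continuous_on_cong)
next
  case (Suc k)
  have imp: "Ck_on (Suc k) U g" if eq: "\<And>x. x \<in> U \<Longrightarrow> f x = g x" and f: "Ck_on (Suc k) U f" for f g :: "'a \<Rightarrow> 'b"
  proof -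
    have d: "(g has_derivative frechet_derivative f (at x)) (at x)" if "x \<in> U" for x
    proof (rule has_derivative_transform_within_open[OF _ assms(1) that])
      show "(f has_derivative frechet_derivative f (at x)) (at x)"
        using f that by (simp add: frechet_derivative_works)
    qed (use eq in auto)
    then have "frechet_derivative g (at x) = frechet_derivative f (at x)" if "x \<in> U" for x
      using that frechet_derivative_at by metis
    then show ?thesis
      using d f Suc.IH[of "\<lambda>x. frechet_derivative f (at x) v" "\<lambda>x. frechet_derivative g (at x) v" for v]
      by (auto simp: differentiable_def)
  qed
  show ?case
    using imp[of f g] imp[of g f] Suc.prems by metis
qed

text \<open>Any formula for the derivative may be used in place of \<open>frechet_derivative\<close>, whose value is
  arbitrary outside \<open>U\<close>.\<close>

lemma Ck_on_SucI:
  assumes "open U" and "\<And>x. x \<in> U \<Longrightarrow> (f has_derivative f' x) (at x)"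
    and "\<And>v. Ck_on k U (\<lambda>x. f' x v)"
  shows "Ck_on (Suc k) U f"
proof -
  have "frechet_derivative f (at x) = f' x" if "x \<in> U" for x
    using assms(2)[OF that] frechet_derivative_at by metis
  then have "Ck_on k U (\<lambda>x. frechet_derivative f (at x) v)" for v
    using assms(3)[of v] by (subst Ck_on_cong[OF assms(1), where g = "\<lambda>x. f' x v"]) auto
  then show ?thesis
    using assms(2) by (auto simp: differentiable_def)
qed

lemma Ck_on_continuous: "Ck_on k U f \<Longrightarrow> continuous_on U f"
proof (cases k)
  case (Suc n)
  assume "Ck_on k U f"
  with Suc show ?thesis
    by (auto intro!: continuous_at_imp_continuous_on differentiable_imp_continuous_within)
qed simp

lemma Ck_on_Suc_imp: "Ck_on (Suc k) U f \<Longrightarrow> Ck_on k U f"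
proof (induction k arbitrary: f)
  case 0
  then show ?case using Ck_on_continuous[OF 0] by simp
next
  case (Suc k)
  then show ?case unfolding Ck_on.simps(2)[of _ U f] by blast
qed

lemma Ck_on_has_derivative:
  "Ck_on (Suc k) U f \<Longrightarrow> x \<in> U \<Longrightarrow> (f has_derivative frechet_derivative f (at x)) (at x)"
  by (simp add: frechet_derivative_works)

lemma Ck_on_subset: "Ck_on k U f \<Longrightarrow> V \<subseteq> U \<Longrightarrow> Ck_on k V f"
  by (induction k arbitrary: f) (auto intro: continuous_on_subset)

lemma Ck_on_const: "open U \<Longrightarrow> Ck_on k U (\<lambda>x. c)"
proof (induction k arbitrary: c)
  case (Suc k)
  show ?case
    by (rule Ck_on_SucI[OF Suc.prems has_derivative_const]) (use Suc in auto)
qed simp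

lemma Ck_on_linear:
  assumes "open U" "bounded_linear L" "Ck_on k U f"
  shows "Ck_on k U (\<lambda>x. L (f x))"
  using assms(3)
proof (induction k arbitrary: f)
  case 0
  then show ?case
    using assms(2) by (auto intro: bounded_linear.continuous_on)
next
  case (Suc k)
  show ?case
  proof (rule Ck_on_SucI[OF assms(1)])
    show "((\<lambda>x. L (f x)) has_derivative (\<lambda>v. L (frechet_derivative f (at x) v))) (at x)" if "x \<in> U" for x
      using bounded_linear.has_derivative[OF assms(2) Ck_on_has_derivative[OF Suc.prems that]] .
  qed (use Suc in auto)
qed

lemma Ck_on_add:
  assumes "open U" "Ck_on k U f" "Ck_on k U g"
  shows "Ck_on k U (\<lambda>x. f x + g x)"
  using assms(2,3)
proof (induction k arbitrary: f g)
  case 0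
  then show ?case by (auto intro: continuous_on_add)
next
  case (Suc k)
  show ?case
    by (rule Ck_on_SucI[OF assms(1) has_derivative_add[OF Ck_on_has_derivative[OF Suc.prems(1)] Ck_on_has_derivative[OF Suc.prems(2)]]])
      (use Suc in auto)
qed

lemma Ck_on_sum:
  assumes "open U" "\<And>i. i \<in> A \<Longrightarrow> Ck_on k U (f i)"
  shows "Ck_on k U (\<lambda>x. \<Sum>i\<in>A. f i x)"
  using assms(2)
  by (induction A rule: infinite_finite_induct) (auto simp: Ck_on_const assms(1) intro!: Ck_on_add)

lemma Ck_on_bilinear:
  assumes "open U" "bounded_bilinear pr" "Ck_on k U f" "Ck_on k U g"
  shows "Ck_on k U (\<lambda>x. pr (f x) (g x))"
  using assms(3,4)
proof (induction k arbitrary: f g)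
  case 0
  then show ?case
    using assms(2) by (auto intro: bounded_bilinear.continuous_on)
next
  case (Suc k)
  show ?case
  proof (rule Ck_on_SucI[OF assms(1) bounded_bilinear.FDERIV[OF assms(2) Ck_on_has_derivative[OF Suc.prems(1)] Ck_on_has_derivative[OF Suc.prems(2)]]])
    show "Ck_on k U (\<lambda>x. pr (f x) (frechet_derivative g (at x) v) + pr (frechet_derivative f (at x) v) (g x))" for v
      using Suc.prems Suc.prems[THEN Ck_on_Suc_imp]
      by (intro Ck_on_add assms(1) Suc.IH) auto
  qed
qed

text \<open>The chain rule reads \<open>D\<^sub>v(g \<circ> f) = \<Sum>\<^sub>b (D\<^sub>v f \<bullet> b) (D\<^sub>b g \<circ> f)\<close>, summed over a basis, which reduces
  the class \<open>C\<^sup>k\<^sup>+\<^sup>1\<close> to products of maps of class \<open>C\<^sup>k\<close>.\<close>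

lemma Ck_on_compose:
  fixes f :: "'a::euclidean_space \<Rightarrow> 'b::euclidean_space" and g :: "'b \<Rightarrow> 'c::real_normed_vector"
  assumes "open U" "open V" "f ` U \<subseteq> V" "Ck_on k U f" "Ck_on k V g"
  shows "Ck_on k U (\<lambda>x. g (f x))"
  using assms(4,5)
proof (induction k arbitrary: g)
  case 0
  then show ?case
    using assms(3) by (auto intro: continuous_on_compose2)
next
  case (Suc k)
  show ?case
  proof (rule Ck_on_SucI[OF assms(1)])
    fix x assume x: "x \<in> U"
    show "((\<lambda>x. g (f x)) has_derivative (\<lambda>v. \<Sum>b\<in>Basis. (frechet_derivative f (at x) v \<bullet> b) *\<^sub>R frechet_derivative g (at (f x)) b)) (at x)"
    proof (rule has_derivative_eq_rhs)
      have g: "(g has_derivative frechet_derivative g (at (f x))) (at (f x))"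
        using Ck_on_has_derivative[OF Suc.prems(2)] x assms(3) by auto
      show "((\<lambda>x. g (f x)) has_derivative (\<lambda>v. frechet_derivative g (at (f x)) (frechet_derivative f (at x) v))) (at x)"
        using has_derivative_compose[OF Ck_on_has_derivative[OF Suc.prems(1) x] g] .
      have "frechet_derivative g (at (f x)) w = (\<Sum>b\<in>Basis. (w \<bullet> b) *\<^sub>R frechet_derivative g (at (f x)) b)" for w
        by (subst euclidean_representation[symmetric, of w])
           (simp add: linear_sum[OF has_derivative_linear[OF g]] linear_scale[OF has_derivative_linear[OF g]] del: euclidean_representation)
      then show "(\<lambda>v. frechet_derivative g (at (f x)) (frechet_derivative f (at x) v)) = (\<lambda>v. \<Sum>b\<in>Basis. (frechet_derivative f (at x) v \<bullet> b) *\<^sub>R frechet_derivative g (at (f x)) b)"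
        by metis
    qed
  next
    fix v
    show "Ck_on k U (\<lambda>x. \<Sum>b\<in>Basis. (frechet_derivative f (at x) v \<bullet> b) *\<^sub>R frechet_derivative g (at (f x)) b)"
      using Suc.prems Ck_on_Suc_imp
      by (intro Ck_on_sum assms(1) Ck_on_bilinear[OF _ bounded_bilinear_scaleR]
          Ck_on_linear[OF _ bounded_linear_inner_left] Suc.IH) auto
  qed
qed

lemma smooth_on_cong:
  "open U \<Longrightarrow> (\<And>x. x \<in> U \<Longrightarrow> f x = g x) \<Longrightarrow> smooth_on U f \<longleftrightarrow> smooth_on U g"
  using Ck_on_cong[of U f g] by (simp add: smooth_on_def)

lemma smooth_on_subset: "smooth_on U f \<Longrightarrow> V \<subseteq> U \<Longrightarrow> smooth_on V f"
  by (auto simp: smooth_on_def intro: Ck_on_subset)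

lemma smooth_on_continuous: "smooth_on U f \<Longrightarrow> continuous_on U f"
  by (auto simp: smooth_on_def intro: Ck_on_continuous[of 0])

lemma smooth_on_has_derivative:
  "smooth_on U f \<Longrightarrow> x \<in> U \<Longrightarrow> (f has_derivative frechet_derivative f (at x)) (at x)"
  using Ck_on_has_derivative[of 0] by (auto simp: smooth_on_def simp del: Ck_on.simps)

lemma smooth_on_frechet: "smooth_on U f \<Longrightarrow> smooth_on U (\<lambda>x. frechet_derivative f (at x) v)"
  unfolding smooth_on_def by (metis Ck_on.simps(2))

lemma smooth_on_const: "open U \<Longrightarrow> smooth_on U (\<lambda>x. c)"
  by (simp add: smooth_on_def Ck_on_const)

lemma smooth_on_linear: "open U \<Longrightarrow> bounded_linear L \<Longrightarrow> smooth_on U f \<Longrightarrow> smooth_on U (\<lambda>x. L (f x))"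
  by (simp add: smooth_on_def Ck_on_linear)

lemma smooth_on_ident:
  assumes "open U" shows "smooth_on U (\<lambda>x. x)"
  unfolding smooth_on_def
proof
  show "Ck_on k U (\<lambda>x. x)" for k
    by (cases k) (auto simp del: Ck_on.simps(2) intro!: Ck_on_SucI[OF assms has_derivative_ident] Ck_on_const assms)
qed

lemma smooth_on_add: "open U \<Longrightarrow> smooth_on U f \<Longrightarrow> smooth_on U g \<Longrightarrow> smooth_on U (\<lambda>x. f x + g x)"
  by (simp add: smooth_on_def Ck_on_add)

lemma smooth_on_bilinear:
  "open U \<Longrightarrow> bounded_bilinear pr \<Longrightarrow> smooth_on U f \<Longrightarrow> smooth_on U g \<Longrightarrow> smooth_on U (\<lambda>x. pr (f x) (g x))"
  by (simp add: smooth_on_def Ck_on_bilinear)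

lemmas smooth_on_scaleR = smooth_on_bilinear[OF _ bounded_bilinear_scaleR]
lemmas smooth_on_inner = smooth_on_bilinear[OF _ bounded_bilinear_inner]
lemmas smooth_on_mult = smooth_on_bilinear[OF _ bounded_bilinear_mult]
lemmas smooth_on_fst = smooth_on_linear[OF _ bounded_linear_fst]
lemmas smooth_on_snd = smooth_on_linear[OF _ bounded_linear_snd]

lemma smooth_on_uminus: "open U \<Longrightarrow> smooth_on U f \<Longrightarrow> smooth_on U (\<lambda>x. - f x)"
  by (rule smooth_on_linear[OF _ bounded_linear_minus[OF bounded_linear_ident]])

lemma smooth_on_diff: "open U \<Longrightarrow> smooth_on U f \<Longrightarrow> smooth_on U g \<Longrightarrow> smooth_on U (\<lambda>x. f x - g x)"
  using smooth_on_add[OF _ _ smooth_on_uminus, of U f g] by simp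

lemma smooth_on_power:
  fixes f :: "'a::euclidean_space \<Rightarrow> real"
  shows "open U \<Longrightarrow> smooth_on U f \<Longrightarrow> smooth_on U (\<lambda>x. f x ^ n)"
  by (induction n) (auto intro: smooth_on_const smooth_on_mult)

lemma smooth_on_Pair:
  assumes "open U" "smooth_on U f" "smooth_on U g"
  shows "smooth_on U (\<lambda>x. (f x, g x))"
proof -
  have "bounded_linear (\<lambda>a::'b. (a, 0::'c))" "bounded_linear (\<lambda>b::'c. (0::'b, b))"
    by (intro bounded_linear_Pair bounded_linear_ident bounded_linear_zero)+
  from smooth_on_add[OF assms(1) smooth_on_linear[OF assms(1) this(1) assms(2)]
    smooth_on_linear[OF assms(1) this(2) assms(3)]]
  show ?thesis by simp
qed

lemma smooth_on_compose:
  assumes "smooth_on V g" "open U" "open V" "f ` U \<subseteq> V" "smooth_on U f"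
  shows "smooth_on U (\<lambda>x. g (f x))"
  using assms(1,5) Ck_on_compose[OF assms(2-4)] unfolding smooth_on_def by blast

subsection \<open>Functions of one variable\<close>

lemma Ck_on_SucI_real:
  fixes f :: "real \<Rightarrow> 'b::real_normed_vector"
  assumes "open U" "\<And>x. x \<in> U \<Longrightarrow> (f has_vector_derivative f' x) (at x)" "Ck_on k U f'"
  shows "Ck_on (Suc k) U f"
  using assms
  by (intro Ck_on_SucI[where f' = "\<lambda>x v. v *\<^sub>R f' x"] Ck_on_bilinear[OF _ bounded_bilinear_scaleR] Ck_on_const)
     (auto simp: has_vector_derivative_def)

lemma smooth_on_vector_derivative:
  fixes f :: "real \<Rightarrow> 'b::real_normed_vector"
  assumes "open U" "smooth_on U f"
  shows "smooth_on U (\<lambda>t. vector_derivative f (at t))"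
    and "t \<in> U \<Longrightarrow> (f has_vector_derivative vector_derivative f (at t)) (at t)"
proof -
  have d: "f differentiable (at t)" if "t \<in> U" for t
    using smooth_on_has_derivative[OF assms(2) that] by (auto simp: differentiable_def)
  then have "vector_derivative f (at t) = frechet_derivative f (at t) 1" if "t \<in> U" for t
    using that by (simp add: frechet_derivative_eq_vector_derivative)
  then show "smooth_on U (\<lambda>t. vector_derivative f (at t))"
    using smooth_on_frechet[OF assms(2), of 1] smooth_on_cong[OF assms(1)] by (metis (no_types, lifting))
  show "t \<in> U \<Longrightarrow> (f has_vector_derivative vector_derivative f (at t)) (at t)"
    using d vector_derivative_works by blast
qed

lemma fst_has_derivative:
  fixes f :: "real \<Rightarrow> real \<times> 'b::real_normed_vector"
  shows "(f has_vector_derivative D) (at t) \<Longrightarrow> ((\<lambda>t. fst (f t)) has_real_derivative fst D) (at t)"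
  unfolding has_real_derivative_iff_has_vector_derivative
  by (rule bounded_linear.has_vector_derivative[OF bounded_linear_fst])

lemma snd_has_derivative:
  "(f has_vector_derivative D) (at t) \<Longrightarrow> ((\<lambda>t. snd (f t)) has_vector_derivative snd D) (at t)"
  by (rule bounded_linear.has_vector_derivative[OF bounded_linear_snd])

lemma inner_has_derivative:
  fixes f g :: "real \<Rightarrow> 'b::real_inner"
  assumes "(f has_vector_derivative f') (at t)" "(g has_vector_derivative g') (at t)"
  shows "((\<lambda>t. f t \<bullet> g t) has_real_derivative f t \<bullet> g' + f' \<bullet> g t) (at t)"
  using bounded_bilinear.has_vector_derivative[OF bounded_bilinear_inner assms]
  by (simp add: has_real_derivative_iff_has_vector_derivative)

text \<open>A solution of \<open>f' = h \<circ> f\<close> with smooth \<open>h\<close> gains one derivative with each use of the equation.\<close>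

lemma smooth_on_bootstrap:
  fixes f :: "real \<Rightarrow> 'a::euclidean_space"
  assumes "open U" "open V" "f ` U \<subseteq> V" "smooth_on V h"
    and d: "\<And>x. x \<in> U \<Longrightarrow> (f has_vector_derivative h (f x)) (at x)"
  shows "smooth_on U f"
  unfolding smooth_on_def
proof
  fix k
  show "Ck_on k U f"
  proof (induction k)
    case 0
    show ?case
      using d by (auto intro!: continuous_at_imp_continuous_on has_vector_derivative_continuous)
  next
    case (Suc k)
    show ?case
      using assms(4) by (intro Ck_on_SucI_real[OF assms(1) d] Ck_on_compose[OF assms(1-3) Suc]) (auto simp: smooth_on_def)
  qed
qed

lemma smooth_on_antiderivative:
  fixes f :: "real \<Rightarrow> 'a::real_normed_vector"
  assumes "open U" "\<And>x. x \<in> U \<Longrightarrow> (f has_vector_derivative f' x) (at x)" "smooth_on U f'"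
  shows "smooth_on U f"
  using Ck_on_SucI_real[OF assms(1,2)] Ck_on_Suc_imp assms(3) unfolding smooth_on_def by blast

text \<open>Sine and cosine are treated together because each is the derivative of the other, so that the
  pair solves an autonomous equation.\<close>

lemma smooth_on_cos_sin: "smooth_on UNIV (\<lambda>x. (cos x, sin x :: real))"
proof (rule smooth_on_bootstrap)
  show "smooth_on UNIV (\<lambda>p :: real \<times> real. (- snd p, fst p))"
    by (intro smooth_on_Pair smooth_on_uminus smooth_on_fst smooth_on_snd smooth_on_ident open_UNIV)
  show "((\<lambda>x. (cos x, sin x)) has_vector_derivative (- snd (cos x, sin x), fst (cos x, sin x :: real))) (at x)" for x
    using DERIV_cos[of x] DERIV_sin[of x]
    by (intro has_vector_derivative_Pair) (auto simp: has_real_derivative_iff_has_vector_derivative)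
qed auto

lemma smooth_on_cos:
  assumes "open U" "smooth_on U f" shows "smooth_on U (\<lambda>x. cos (f x) :: real)"
  using smooth_on_fst[OF assms(1) smooth_on_compose[OF smooth_on_cos_sin assms(1) open_UNIV _ assms(2)]] by simp

lemma smooth_on_sin:
  assumes "open U" "smooth_on U f" shows "smooth_on U (\<lambda>x. sin (f x) :: real)"
  using smooth_on_snd[OF assms(1) smooth_on_compose[OF smooth_on_cos_sin assms(1) open_UNIV _ assms(2)]] by simp

text \<open>Real powers form a class that is closed under differentiation up to constants; square roots and
  reciprocals are the cases \<open>c = 1/2\<close> and \<open>c = -1\<close>.\<close>

lemma smooth_on_powr:
  fixes f :: "'a::euclidean_space \<Rightarrow> real"
  assumes "open U" "smooth_on U f" "\<And>x. x \<in> U \<Longrightarrow> 0 < f x"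
  shows "smooth_on U (\<lambda>x. f x powr c)"
proof -
  have "Ck_on k {0<..} (\<lambda>x::real. x powr c)" for k
  proof (induction k arbitrary: c)
    case 0
    show ?case by (auto intro!: continuous_intros)
  next
    case (Suc k)
    show ?case
    proof (rule Ck_on_SucI_real)
      show "((\<lambda>x. x powr c) has_vector_derivative c * x powr (c - 1)) (at x)" if "x \<in> {0<..}" for x :: real
        using has_real_derivative_powr[of x c] that by (simp add: has_real_derivative_iff_has_vector_derivative)
      show "Ck_on k {0<..} (\<lambda>x::real. c * x powr (c - 1))"
        using Ck_on_linear[OF _ bounded_linear_mult_right Suc] by simp
    qed simp
  qed
  then have "smooth_on {0<..} (\<lambda>x::real. x powr c)"
    by (simp add: smooth_on_def)
  from smooth_on_compose[OF this assms(1) _ _ assms(2)] assms(3) show ?thesis by auto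
qed

lemma smooth_on_inverse:
  fixes f :: "'a::euclidean_space \<Rightarrow> real"
  assumes "open U" "smooth_on U f" "\<And>x. x \<in> U \<Longrightarrow> 0 < f x"
  shows "smooth_on U (\<lambda>x. 1 / f x)"
  using smooth_on_powr[OF assms, of "-1"] smooth_on_cong[OF assms(1), of "\<lambda>x. f x powr -1" "\<lambda>x. 1 / f x"] assms(3)
  by (metis (no_types, lifting) less_eq_real_def powr_minus_divide powr_one)

lemma smooth_on_sqrt:
  fixes f :: "'a::euclidean_space \<Rightarrow> real"
  assumes "open U" "smooth_on U f" "\<And>x. x \<in> U \<Longrightarrow> 0 < f x"
  shows "smooth_on U (\<lambda>x. sqrt (f x))"
  using smooth_on_powr[OF assms, of "1/2"] smooth_on_cong[OF assms(1), of "\<lambda>x. f x powr (1/2)" "\<lambda>x. sqrt (f x)"] assms(3)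
  by (metis (no_types, lifting) less_eq_real_def powr_half_sqrt)

section \<open>The arc length coordinate and the warping function\<close>

locale complete_radial_metric =
  fixes C\<^sub>1 C\<^sub>2 :: "real \<Rightarrow> real"
  assumes smooth_C1: "smooth_on {0<..} C\<^sub>1" and smooth_C2: "smooth_on {0<..} C\<^sub>2"
    and C1_pos: "\<And>m. 0 < m \<Longrightarrow> 0 < C\<^sub>1 m"
    and C2_bound: "\<And>m. 0 < m \<Longrightarrow> - (1 / m) * C\<^sub>1 m < C\<^sub>2 m"
    and W_minus_inf: "W_minus C\<^sub>1 C\<^sub>2 = - \<infinity>" and W_plus_inf: "W_plus C\<^sub>1 C\<^sub>2 = \<infinity>"
begin

lemma g2_pos: "0 < r \<Longrightarrow> 0 < g2 C\<^sub>1 C\<^sub>2 r"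
  using C2_bound[of "r\<^sup>2"] by (simp add: g2_def field_simps)

lemma smooth_on_square: "smooth_on {0<..} f \<Longrightarrow> smooth_on {0<..} (\<lambda>r. f (r\<^sup>2 :: real))"
  by (rule smooth_on_compose) (auto intro!: smooth_on_power smooth_on_ident)

lemma smooth_sqrt_g2: "smooth_on {0<..} (\<lambda>r. sqrt (g2 C\<^sub>1 C\<^sub>2 r))"
proof (rule smooth_on_sqrt)
  show "smooth_on {0<..} (g2 C\<^sub>1 C\<^sub>2)"
    unfolding g2_def
    by (intro smooth_on_mult smooth_on_add smooth_on_const smooth_on_power smooth_on_ident smooth_on_square
        smooth_C1 smooth_C2 open_greaterThan)
qed (auto simp: g2_pos)

lemma W_deriv:
  assumes "0 < r" shows "(W C\<^sub>1 C\<^sub>2 has_real_derivative sqrt (g2 C\<^sub>1 C\<^sub>2 r)) (at r)"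
proof -
  define c d where "c = min (r/2) (1/2)" and "d = max (2 * r) 2"
  have cd: "0 < c" "c < r" "r < d" "c \<le> 1" "1 \<le> d"
    using assms by (auto simp: c_def d_def)
  have "(W C\<^sub>1 C\<^sub>2 has_vector_derivative sqrt (g2 C\<^sub>1 C\<^sub>2 r)) (at r within {c..d})"
    using interval_integral_FTC2[of c 1 d "\<lambda>r. sqrt (g2 C\<^sub>1 C\<^sub>2 r)" r] cd
      continuous_on_subset[OF smooth_on_continuous[OF smooth_sqrt_g2], of "{c..d}"]
    by (force simp: W_def[abs_def] one_ereal_def)
  then show ?thesis
    using cd by (simp add: has_real_derivative_iff_has_vector_derivative at_within_Icc_at)
qed

lemma W_strict_mono: "0 < r \<Longrightarrow> r < r' \<Longrightarrow> W C\<^sub>1 C\<^sub>2 r < W C\<^sub>1 C\<^sub>2 r'"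
    by (rule DERIV_pos_imp_increasing)
    (auto intro!: exI[of _ "sqrt (g2 C\<^sub>1 C\<^sub>2 _)"] W_deriv simp: g2_pos)

lemma W_inj: "inj_on (W C\<^sub>1 C\<^sub>2) {0<..}"
  using W_strict_mono by (intro linorder_inj_onI) force+

text \<open>Since \<open>W\<close> is monotone its one-sided limits exist in the extended reals, so that the two
  hypotheses on \<open>Lim\<close> do force \<open>W\<close> to be unbounded in both directions.\<close>

lemma W_surj: "\<exists>r>0. W C\<^sub>1 C\<^sub>2 r = s"
proof -
  let ?W = "W C\<^sub>1 C\<^sub>2"
  define l where "l = (INF r\<in>{0<..}. ereal (?W r))"
  define u where "u = (SUP r\<in>{0<..}. ereal (?W r))"
  have mono: "?W r \<le> ?W r'" if "0 < r" "r \<le> r'" for r r'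
    using W_strict_mono[of r r'] that by (cases "r = r'") auto
  have "((\<lambda>r. ereal (?W r)) \<longlongrightarrow> l) (at_right 0)"
  proof (rule order_tendstoI)
    fix y assume "y < l"
    have "y < ereal (?W r)" if "r > 0" for r
      using \<open>y < l\<close> INF_lower[of r "{0<..}" "\<lambda>r. ereal (?W r)"] that unfolding l_def by simp
    then show "\<forall>\<^sub>F r in at_right 0. y < ereal (?W r)"
      by (rule eventually_mono[OF eventually_at_right_less[of 0]])
  next
    fix y assume "l < y"
    then obtain r0 where r0: "0 < r0" "ereal (?W r0) < y"
      by (auto simp: l_def INF_less_iff)
    then have "ereal (?W r) < y" if "0 < r" "r < r0" for r
      using mono[of r r0] that by (auto intro: le_less_trans[of _ "ereal (?W r0)"])
    then show "\<forall>\<^sub>F r in at_right 0. ereal (?W r) < y"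
      using r0(1) by (auto simp: eventually_at_right[OF r0(1)])
  qed
  then have "l = - \<infinity>"
    using W_minus_inf by (simp add: W_minus_def tendsto_Lim)
  then obtain r1 where r1: "0 < r1" "?W r1 < s"
    using INF_less_iff[of "\<lambda>r. ereal (?W r)" "{0<..}" "ereal s"] by (auto simp: l_def)
  have "((\<lambda>r. ereal (?W r)) \<longlongrightarrow> u) at_top"
  proof (rule order_tendstoI)
    fix y assume "u < y"
    have "ereal (?W r) < y" if "r > 0" for r
      using \<open>u < y\<close> SUP_upper[of r "{0<..}" "\<lambda>r. ereal (?W r)"] that unfolding u_def by simp
    then show "\<forall>\<^sub>F r in at_top. ereal (?W r) < y"
      by (rule eventually_mono[OF eventually_gt_at_top[of 0]])
  next
    fix y assume "y < u"
    then obtain r0 where r0: "0 < r0" "y < ereal (?W r0)"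
      by (auto simp: u_def less_SUP_iff)
    then have "y < ereal (?W r)" if "r0 \<le> r" for r
      using mono[of r0 r] that by (auto intro: less_le_trans[of _ "ereal (?W r0)"])
    then show "\<forall>\<^sub>F r in at_top. y < ereal (?W r)"
      by (rule eventually_mono[OF eventually_ge_at_top[of r0]])
  qed
  then have "u = \<infinity>"
    using W_plus_inf by (simp add: W_plus_def tendsto_Lim)
  then obtain r2 where r2: "0 < r2" "s < ?W r2"
    using less_SUP_iff[of "ereal s" "\<lambda>r. ereal (?W r)" "{0<..}"] by (auto simp: u_def)
  have "r1 \<le> r2"
    using mono[of r2 r1] r1 r2 by (cases "r1 \<le> r2") auto
  then obtain r where "r1 \<le> r" "r \<le> r2" "?W r = s"
  proof -
    have "continuous_on {r1..r2} ?W"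
      using r1(1) by (intro continuous_at_imp_continuous_on ballI DERIV_isCont[OF W_deriv]) auto
    from IVT'[OF _ _ \<open>r1 \<le> r2\<close> this, of s] r1 r2 that show ?thesis by auto
  qed
  with r1 show ?thesis by (intro exI[of _ r]) auto
qed

lemma radius_pos: "0 < radius C\<^sub>1 C\<^sub>2 s"
  and W_radius: "W C\<^sub>1 C\<^sub>2 (radius C\<^sub>1 C\<^sub>2 s) = s"
proof -
  obtain r where "0 < r" "W C\<^sub>1 C\<^sub>2 r = s" using W_surj by blast
  then have s: "s \<in> W C\<^sub>1 C\<^sub>2 ` {0<..}" by auto
  show "0 < radius C\<^sub>1 C\<^sub>2 s"
    using the_inv_into_into[OF W_inj s subset_refl] by (simp add: radius_def)
  show "W C\<^sub>1 C\<^sub>2 (radius C\<^sub>1 C\<^sub>2 s) = s"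
    using f_the_inv_into_f[OF W_inj s] by (simp add: radius_def)
qed

lemma radius_W: "0 < r \<Longrightarrow> radius C\<^sub>1 C\<^sub>2 (W C\<^sub>1 C\<^sub>2 r) = r"
  by (simp add: radius_def the_inv_into_f_f[OF W_inj])

lemma radius_deriv:
  "(radius C\<^sub>1 C\<^sub>2 has_real_derivative 1 / sqrt (g2 C\<^sub>1 C\<^sub>2 (radius C\<^sub>1 C\<^sub>2 s))) (at s)"
proof -
  define r where "r = radius C\<^sub>1 C\<^sub>2 s"
  have r: "0 < r" "W C\<^sub>1 C\<^sub>2 r = s" by (simp_all add: r_def radius_pos W_radius)
  have "isCont (radius C\<^sub>1 C\<^sub>2) (W C\<^sub>1 C\<^sub>2 r)"
  proof (rule isCont_inverse_function[where f = "W C\<^sub>1 C\<^sub>2" and x = r and d = "r/2"])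
    fix z assume "\<bar>z - r\<bar> \<le> r/2"
    then have z: "0 < z" using r(1) by linarith
    show "radius C\<^sub>1 C\<^sub>2 (W C\<^sub>1 C\<^sub>2 z) = z" by (rule radius_W[OF z])
    show "isCont (W C\<^sub>1 C\<^sub>2) z" by (rule DERIV_isCont[OF W_deriv[OF z]])
  qed (use r(1) in simp)
  then have "(radius C\<^sub>1 C\<^sub>2 has_real_derivative inverse (sqrt (g2 C\<^sub>1 C\<^sub>2 r))) (at s)"
    using W_deriv[OF r(1)] g2_pos[OF r(1)]
    by (intro DERIV_inverse_function[where f = "W C\<^sub>1 C\<^sub>2" and a = "s - 1" and b = "s + 1"])
      (simp_all add: W_radius r(2) flip: r_def)
  then show ?thesis by (simp add: r_def inverse_eq_divide)
qed

lemma smooth_radius: "smooth_on UNIV (radius C\<^sub>1 C\<^sub>2)"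
proof (rule smooth_on_bootstrap)
  show "smooth_on {0<..} (\<lambda>r. 1 / sqrt (g2 C\<^sub>1 C\<^sub>2 r))"
    by (rule smooth_on_inverse[OF _ smooth_sqrt_g2]) (auto simp: g2_pos)
qed (auto simp: radius_pos radius_deriv simp flip: has_real_derivative_iff_has_vector_derivative)

lemma warp_pos: "0 < warp C\<^sub>1 C\<^sub>2 s"
  using radius_pos[of s] C1_pos[of "(radius C\<^sub>1 C\<^sub>2 s)\<^sup>2"] by (simp add: warp_def)

lemma smooth_warp: "smooth_on UNIV (warp C\<^sub>1 C\<^sub>2)"
proof -
  have "smooth_on UNIV (\<lambda>s. C\<^sub>1 ((radius C\<^sub>1 C\<^sub>2 s)\<^sup>2))"
    by (rule smooth_on_compose[OF smooth_C1])
      (simp_all add: less_imp_neq[OF radius_pos, symmetric] smooth_radius image_subset_iff smooth_on_power del: zero_less_power2)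
  then show ?thesis
    unfolding warp_def
    by (intro smooth_on_mult smooth_on_const smooth_on_power smooth_radius open_UNIV)
qed

end

section \<open>The equation \<open>x'' = F(x)\<close> of a particle on the line\<close>

lemma gronwall_zero:
  fixes u :: "real \<Rightarrow> real"
  assumes d: "\<And>t. t \<in> {a..b} \<Longrightarrow> (u has_real_derivative u' t) (at t)"
    and bound: "\<And>t. t \<in> {a..b} \<Longrightarrow> \<bar>u' t\<bar> \<le> K * u t"
    and "t0 \<in> {a..b}" "u t0 = 0" "t \<in> {a..b}"
  shows "u t \<le> 0"
proof (cases "t0 \<le> t")
  case True
  have "exp (- K * t) * u t \<le> exp (- K * t0) * u t0"
  proof (rule DERIV_nonpos_imp_nonincreasing[OF True])
    fix x assume x: "t0 \<le> x" "x \<le> t"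
    have "((\<lambda>x. exp (- K * x) * u x) has_real_derivative exp (- K * x) * (u' x - K * u x)) (at x)"
      using x assms(3,5) by (auto intro!: derivative_eq_intros d simp: algebra_simps)
    moreover have "exp (- K * x) * (u' x - K * u x) \<le> 0"
      using bound[of x] x assms(3,5) by (intro mult_nonneg_nonpos) auto
    ultimately show "\<exists>y. ((\<lambda>x. exp (- K * x) * u x) has_real_derivative y) (at x) \<and> y \<le> 0" by blast
  qed
  with assms(4) show ?thesis by (simp add: mult_le_0_iff)
next
  case False
  then have "t \<le> t0" by simp
  have "exp (K * t) * u t \<le> exp (K * t0) * u t0"
  proof (rule DERIV_nonneg_imp_nondecreasing[OF \<open>t \<le> t0\<close>])
    fix x assume x: "t \<le> x" "x \<le> t0"
    have "((\<lambda>x. exp (K * x) * u x) has_real_derivative exp (K * x) * (u' x + K * u x)) (at x)"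
      using x assms(3,5) by (auto intro!: derivative_eq_intros d simp: algebra_simps)
    moreover have "0 \<le> exp (K * x) * (u' x + K * u x)"
      using bound[of x] x assms(3,5) by (intro mult_nonneg_nonneg) auto
    ultimately show "\<exists>y. ((\<lambda>x. exp (K * x) * u x) has_real_derivative y) (at x) \<and> 0 \<le> y" by blast
  qed
  with assms(4) show ?thesis by (simp add: mult_le_0_iff)
qed

lemma lipschitz_on_interval:
  fixes F :: "real \<Rightarrow> real"
  assumes "\<And>s. (F has_real_derivative F' s) (at s)" "continuous_on UNIV F'"
  obtains K where "0 \<le> K" "\<And>x y. x \<in> {p..q} \<Longrightarrow> y \<in> {p..q} \<Longrightarrow> \<bar>F x - F y\<bar> \<le> K * \<bar>x - y\<bar>"
proof -
  have "compact (F' ` {p..q})"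
    by (rule compact_continuous_image[OF continuous_on_subset[OF assms(2)]]) auto
  then obtain K where K: "\<And>x. x \<in> {p..q} \<Longrightarrow> \<bar>F' x\<bar> \<le> K"
    by (fastforce dest!: compact_imp_bounded simp: bounded_iff)
  have "\<bar>F x - F y\<bar> \<le> \<bar>K\<bar> * \<bar>x - y\<bar>" if "x \<in> {p..q}" "y \<in> {p..q}" for x y
  proof -
    have "norm (F x - F y) \<le> \<bar>K\<bar> * norm (x - y)"
    proof (rule field_differentiable_bound)
      show "(F has_field_derivative F' z) (at z within {p..q})" for z
        using assms(1) by (rule DERIV_subset) auto
      show "norm (F' z) \<le> \<bar>K\<bar>" if "z \<in> {p..q}" for z
        using K[OF that] by simp
    qed (use that in auto)
    then show ?thesis by simp
  qed
  then show thesis using that[of "\<bar>K\<bar>"] by simp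
qed

text \<open>Gronwall's inequality for the squared distance of the two solutions in phase space. The force is
  Lipschitz only on compact sets, which suffices because the solutions are bounded between \<open>t0\<close> and \<open>t\<close>.\<close>

lemma conservative_unique:
  fixes F :: "real \<Rightarrow> real"
  assumes F: "\<And>s. (F has_real_derivative F' s) (at s)" "continuous_on UNIV F'"
    and I: "is_interval I" "t0 \<in> I" "t \<in> I"
    and x: "\<And>t. t \<in> I \<Longrightarrow> (x has_real_derivative v t) (at t)" "\<And>t. t \<in> I \<Longrightarrow> (v has_real_derivative F (x t)) (at t)"
    and y: "\<And>t. t \<in> I \<Longrightarrow> (y has_real_derivative w t) (at t)" "\<And>t. t \<in> I \<Longrightarrow> (w has_real_derivative F (y t)) (at t)"
    and init: "x t0 = y t0" "v t0 = w t0"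
  shows "x t = y t \<and> v t = w t"
proof -
  define a b where "a = min t0 t" and "b = max t0 t"
  have sub: "{a..b} \<subseteq> I"
  proof
    fix s assume "s \<in> {a..b}"
    then have "t0 \<le> s \<and> s \<le> t \<or> t \<le> s \<and> s \<le> t0" by (auto simp: a_def b_def)
    then show "s \<in> I" using mem_is_interval_1_I[OF I(1)] I(2,3) by blast
  qed
  have "continuous_on {a..b} x" "continuous_on {a..b} y"
    using sub by (auto intro!: continuous_at_imp_continuous_on DERIV_isCont[OF x(1)] DERIV_isCont[OF y(1)])
  then have "bounded (x ` {a..b} \<union> y ` {a..b})"
    by (intro compact_imp_bounded compact_Un compact_continuous_image) auto
  then obtain R where "\<forall>z \<in> x ` {a..b} \<union> y ` {a..b}. norm z \<le> R"
    unfolding bounded_iff by blast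
  then have R: "x s \<in> {-R..R} \<and> y s \<in> {-R..R}" if "s \<in> {a..b}" for s
    using that by (simp add: abs_le_iff ball_Un) force
  obtain K where K: "0 \<le> K" "\<And>p q. p \<in> {-R..R} \<Longrightarrow> q \<in> {-R..R} \<Longrightarrow> \<bar>F p - F q\<bar> \<le> K * \<bar>p - q\<bar>"
    using lipschitz_on_interval[OF F, of "-R" R] by blast
  define u where "u s = (x s - y s)\<^sup>2 + (v s - w s)\<^sup>2" for s
  define u' where "u' s = 2 * ((x s - y s) * (v s - w s)) + 2 * ((v s - w s) * (F (x s) - F (y s)))" for s
  have "u t \<le> 0"
  proof (rule gronwall_zero[where u = u and u' = u' and K = "1 + K" and a = a and b = b and t = t])
    fix s assume s: "s \<in> {a..b}"
    then have sI: "s \<in> I" using sub by auto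
    show "(u has_real_derivative u' s) (at s)"
      unfolding u_def u'_def
      using x(1)[OF sI] x(2)[OF sI] y(1)[OF sI] y(2)[OF sI]
      by (auto intro!: derivative_eq_intros)
    define p q where "p = \<bar>x s - y s\<bar>" and "q = \<bar>v s - w s\<bar>"
    have pq: "0 \<le> p" "0 \<le> q" "2 * (p * q) \<le> u s"
      using sum_squares_bound[of p q] by (auto simp: p_def q_def u_def)
    have "\<bar>F (x s) - F (y s)\<bar> \<le> K * p"
      using K(2) R[OF s] by (auto simp: p_def)
    then have "q * \<bar>F (x s) - F (y s)\<bar> \<le> q * (K * p)"
      by (rule mult_left_mono) (use pq in auto)
    moreover have "\<bar>u' s\<bar> \<le> 2 * (p * q) + 2 * (q * \<bar>F (x s) - F (y s)\<bar>)"
      unfolding u'_def p_def q_def by (simp flip: abs_mult)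
    moreover have "K * (2 * (p * q)) \<le> K * u s"
      using pq K(1) by (intro mult_left_mono) auto
    ultimately show "\<bar>u' s\<bar> \<le> (1 + K) * u s"
      using pq by (simp add: algebra_simps)
  next
    show "u t0 = 0" using init by (simp add: u_def)
  qed (simp_all add: a_def b_def)
  then have "u t = 0"
    using sum_power2_ge_zero[of "x t - y t" "v t - w t"] by (simp add: u_def)
  then show ?thesis
    by (simp add: u_def sum_power2_eq_zero_iff)
qed

lemma antiderivative_exists:
  fixes g :: "real \<Rightarrow> 'a::euclidean_space"
  assumes "continuous_on UNIV g"
  shows "\<exists>G. G t0 = c \<and> (\<forall>t. (G has_vector_derivative g t) (at t))"
proof -
  obtain G where "\<And>t. (G has_vector_derivative g t) (at t)"
    using einterval_antiderivative[of "-\<infinity>" "\<infinity>" g] assms by (auto simp: continuous_on_eq_continuous_at)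
  then have "\<forall>t. ((\<lambda>t. G t + (c - G t0)) has_vector_derivative g t) (at t)"
    by (auto intro!: derivative_eq_intros)
  then show ?thesis by (intro exI[of _ "\<lambda>t. G t + (c - G t0)"]) auto
qed

lemma exp_growth_bound:
  fixes G :: "real \<Rightarrow> 'a::real_normed_vector"
  assumes "0 < c" "G 0 = 0" and d: "\<And>t. (G has_vector_derivative g t) (at t)"
    and bound: "\<And>t. norm (g t) \<le> C * exp (c * \<bar>t\<bar>)"
  shows "norm (G t) \<le> C / c * exp (c * \<bar>t\<bar>)"
proof -
  have C: "0 \<le> C"
    using order_trans[OF norm_ge_zero bound[of 0]] by simp
  have pos: "norm (G t) \<le> C / c * exp (c * t)" if "0 < t" "G 0 = 0"
      "\<And>t. (G has_vector_derivative g t) (at t)" "\<And>t. norm (g t) \<le> C * exp (c * \<bar>t\<bar>)"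
    for G g and t :: real
  proof -
    have "norm (G t - G 0) \<le> C / c * exp (c * t) - C / c * exp (c * 0)"
    proof (rule differentiable_bound_general[OF \<open>0 < t\<close>])
      show "continuous_on {0..t} G"
        using that(3) by (auto intro!: continuous_at_imp_continuous_on has_vector_derivative_continuous)
      show "continuous_on {0..t} (\<lambda>t. C / c * exp (c * t))" by (intro continuous_intros)
      fix x assume x: "0 < x" "x < t"
      show "((\<lambda>t. C / c * exp (c * t)) has_vector_derivative C * exp (c * x)) (at x)"
        using \<open>0 < c\<close> by (auto intro!: derivative_eq_intros simp flip: has_real_derivative_iff_has_vector_derivative)
      show "(G has_vector_derivative g x) (at x)" using that(3) .
      show "norm (g x) \<le> C * exp (c * x)" using that(4)[of x] x by simp
    qed
    moreover have "0 \<le> C / c" using C \<open>0 < c\<close> by simp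
    ultimately show ?thesis using that(2) by simp
  qed
  consider "t = 0" | "t > 0" | "t < 0" by linarith
  then show ?thesis
  proof cases
    case 1
    then show ?thesis using assms C by simp
  next
    case 2
    then show ?thesis using pos[OF 2 assms(2) d bound] by simp
  next
    case 3
    have "((\<lambda>t. G (- t)) has_vector_derivative - g (- t)) (at t)" for t
      using vector_diff_chain_at[of uminus "-1" t G "g (- t)"] d[of "-t"]
      by (simp add: o_def has_vector_derivative_minus[OF has_vector_derivative_id, simplified])
    from pos[OF _ _ this, of "- t"] 3 assms(2) bound[of "- s" for s] show ?thesis by simp
  qed
qed

text \<open>Picard iteration; in the norm weighted by \<open>exp (- 2 K \<bar>t\<bar>)\<close> each step halves the error.\<close>

lemma picard_global:
  fixes f :: "'a::euclidean_space \<Rightarrow> 'a"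
  assumes K: "0 < K" and lip: "\<And>x y. norm (f x - f y) \<le> K * norm (x - y)"
  shows "\<exists>y. y 0 = y0 \<and> (\<forall>t. (y has_vector_derivative f (y t)) (at t))"
proof -
  have f_cont: "continuous_on UNIV f"
    by (rule lipschitz_on_continuous_on[of K]) (use K lip in \<open>auto intro!: lipschitz_onI simp: dist_norm\<close>)
  define step where "step y = (SOME G. G 0 = y0 \<and> (\<forall>t. (G has_vector_derivative f (y t)) (at t)))" for y
  have step: "step y 0 = y0" "(step y has_vector_derivative f (y t)) (at t)" if "continuous_on UNIV y" for y t
    using someI_ex[OF antiderivative_exists[OF continuous_on_compose2[OF f_cont that], of 0 y0]]
    by (auto simp: step_def)
  define Y where "Y n = (step ^^ n) (\<lambda>_. y0)" for n
  have Y_cont: "continuous_on UNIV (Y n)" for n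
  proof (induction n)
    case (Suc n)
    then show ?case
      using step(2) by (auto simp: Y_def intro!: continuous_at_imp_continuous_on has_vector_derivative_continuous)
  qed (simp add: Y_def)
  have Y0: "Y n 0 = y0" for n
    using step(1)[OF Y_cont] by (cases n) (simp_all add: Y_def)
  have Y_deriv: "(Y (Suc n) has_vector_derivative f (Y n t)) (at t)" for n t
    using step(2)[OF Y_cont, of n t] by (simp add: Y_def)
  define B where "B t = norm (f y0) / (2 * K) * exp (2 * K * \<bar>t\<bar>)" for t
  have B_nonneg: "0 \<le> B t" for t using K by (simp add: B_def)
  have one: "norm (Y (Suc n) t - Y n t) \<le> B t * (1/2) ^ n" for n t
  proof (induction n arbitrary: t)
    case 0
    have "norm (f y0) \<le> norm (f y0) * exp (2 * K * \<bar>t\<bar>)" for t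
      using K by (simp add: mult_le_cancel_left1)
    moreover have "((\<lambda>t. Y (Suc 0) t - Y 0 t) has_vector_derivative f y0) (at t)" for t
      using Y_deriv[of 0 t] by (auto simp: Y_def intro!: derivative_eq_intros)
    ultimately show ?case
      using exp_growth_bound[of "2 * K" "\<lambda>t. Y (Suc 0) t - Y 0 t" "\<lambda>_. f y0" "norm (f y0)" t] K Y0
      by (simp add: B_def)
  next
    case (Suc n)
    define C where "C = norm (f y0) / (2 * K) * (1/2) ^ n * K"
    have "((\<lambda>t. Y (Suc (Suc n)) t - Y (Suc n) t) has_vector_derivative f (Y (Suc n) t) - f (Y n t)) (at t)" for t
      by (intro has_vector_derivative_diff Y_deriv)
    moreover have "norm (f (Y (Suc n) t) - f (Y n t)) \<le> C * exp (2 * K * \<bar>t\<bar>)" for t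
    proof -
      have "norm (f (Y (Suc n) t) - f (Y n t)) \<le> K * norm (Y (Suc n) t - Y n t)" by (rule lip)
      also have "\<dots> \<le> K * (B t * (1/2) ^ n)"
        using K Suc by (intro mult_left_mono) auto
      also have "\<dots> = C * exp (2 * K * \<bar>t\<bar>)" using K by (simp add: B_def C_def)
      finally show ?thesis .
    qed
    ultimately have "norm (Y (Suc (Suc n)) t - Y (Suc n) t) \<le> C / (2 * K) * exp (2 * K * \<bar>t\<bar>)"
      using K Y0 by (intro exp_growth_bound) auto
    also have "\<dots> = B t * (1/2) ^ Suc n" using K by (simp add: B_def C_def)
    finally show ?case .
  qed
  have many: "norm (Y (n + k) t - Y n t) \<le> B t * (2 * (1/2) ^ n - 2 * (1/2) ^ (n + k))" for n k t
  proof (induction k)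
    case (Suc k)
    have "norm (Y (n + Suc k) t - Y n t) \<le> norm (Y (Suc (n + k)) t - Y (n + k) t) + norm (Y (n + k) t - Y n t)"
      using norm_triangle_ineq[of "Y (Suc (n + k)) t - Y (n + k) t" "Y (n + k) t - Y n t"] by simp
    with Suc one[of "n + k" t] show ?case by (simp add: algebra_simps)
  qed simp
  have close: "norm (Y m t - Y n t) \<le> B t * (2 * (1/2) ^ n)" if "n \<le> m" for m n t
  proof -
    have "norm (Y m t - Y n t) \<le> B t * (2 * (1/2) ^ n - 2 * (1/2) ^ m)"
      using many[of n "m - n" t] that by simp
    also have "\<dots> \<le> B t * (2 * (1/2) ^ n)"
      using B_nonneg by (intro mult_left_mono) auto
    finally show ?thesis .
  qed
  have null: "(\<lambda>n. c * (2 * (1/2) ^ n)) \<longlonglongrightarrow> 0" for c :: real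
    by (intro tendsto_mult_right_zero tendsto_mult_right_zero LIMSEQ_power_zero) simp
  have "Cauchy (\<lambda>n. Y n t)" for t
  proof (rule metric_CauchyI, unfold dist_norm)
    fix e :: real assume "0 < e"
    then obtain N where N: "B t * (2 * (1/2) ^ N) < e"
      using order_tendstoD(2)[OF null[of "B t"] \<open>0 < e\<close>] by (auto simp: eventually_sequentially)
    have lt: "norm (Y m t - Y n t) < e" if "N \<le> n" "n \<le> m" for m n
    proof -
      have "norm (Y m t - Y n t) \<le> B t * (2 * (1/2) ^ n)"
        using close that by blast
      also have "\<dots> \<le> B t * (2 * (1/2) ^ N)"
        using B_nonneg that by (intro mult_left_mono power_decreasing) auto
      finally show ?thesis using N by simp
    qed
    show "\<exists>M. \<forall>m\<ge>M. \<forall>n\<ge>M. norm (Y m t - Y n t) < e"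
      using lt by (metis nle_le norm_minus_commute)
  qed
  then have conv: "(\<lambda>n. Y n t) \<longlonglongrightarrow> lim (\<lambda>n. Y n t)" for t
    using Cauchy_convergent convergent_LIMSEQ_iff by blast
  define y where "y t = lim (\<lambda>n. Y n t)" for t
  have y_close: "norm (y t - Y n t) \<le> B t * (2 * (1/2) ^ n)" for n t
  proof (rule tendsto_upperbound)
    show "((\<lambda>m. norm (Y m t - Y n t)) \<longlongrightarrow> norm (y t - Y n t)) sequentially"
      unfolding y_def by (intro tendsto_intros conv)
    show "\<forall>\<^sub>F m in sequentially. norm (Y m t - Y n t) \<le> B t * (2 * (1/2) ^ n)"
      using close by (auto simp: eventually_sequentially)
  qed simp
  have "(y has_vector_derivative f (y t)) (at t)" for t
  proof -
    define T where "T = \<bar>t\<bar> + 1"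
    define S where "S = {- T<..<T}"
    have tS: "t \<in> S" and S: "open S" "convex S" by (auto simp: S_def T_def)
    have "\<exists>g. \<forall>x\<in>S. (\<lambda>n. Y (Suc n) x) \<longlonglongrightarrow> g x \<and> (g has_derivative (\<lambda>h. h *\<^sub>R f (y x))) (at x within S)"
    proof (rule has_derivative_sequence[OF S(2)])
      show "(Y (Suc n) has_derivative (\<lambda>h. h *\<^sub>R f (Y n x))) (at x within S)" for n x
        using Y_deriv[of n x] by (auto simp: has_vector_derivative_def intro: has_derivative_at_withinI)
      show "t \<in> S" by fact
      show "(\<lambda>n. Y (Suc n) t) \<longlonglongrightarrow> y t"
        unfolding y_def by (rule LIMSEQ_Suc[OF conv])
      fix e :: real assume "0 < e"
      have "\<forall>\<^sub>F n in sequentially. K * B T * (2 * (1/2) ^ n) < e"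
        by (rule order_tendstoD(2)[OF null \<open>0 < e\<close>])
      then show "\<forall>\<^sub>F n in sequentially. \<forall>x\<in>S. \<forall>h. norm (h *\<^sub>R f (Y n x) - h *\<^sub>R f (y x)) \<le> e * norm h"
      proof (rule eventually_mono, intro ballI allI)
        fix n x and h :: real assume n: "K * B T * (2 * (1/2) ^ n) < e" and x: "x \<in> S"
        have "B x \<le> B T"
          using x K by (auto simp: B_def S_def intro!: mult_left_mono divide_right_mono)
        have "norm (f (Y n x) - f (y x)) \<le> K * norm (Y n x - y x)" by (rule lip)
        also have "\<dots> \<le> K * (B x * (2 * (1/2) ^ n))"
          using y_close[of x n] K by (intro mult_left_mono) (auto simp: norm_minus_commute)
        also have "\<dots> \<le> K * (B T * (2 * (1/2) ^ n))"
          using \<open>B x \<le> B T\<close> K by (intro mult_left_mono mult_right_mono) auto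
        finally have "norm (f (Y n x) - f (y x)) \<le> e" using n by (simp add: mult_ac)
        then have "\<bar>h\<bar> * norm (f (Y n x) - f (y x)) \<le> \<bar>h\<bar> * e"
          by (intro mult_left_mono) auto
        then show "norm (h *\<^sub>R f (Y n x) - h *\<^sub>R f (y x)) \<le> e * norm h"
          by (simp add: mult_ac flip: scaleR_right_diff_distrib)
      qed
    qed
    then obtain g where g: "\<And>x. x \<in> S \<Longrightarrow> (\<lambda>n. Y (Suc n) x) \<longlonglongrightarrow> g x"
        "(g has_derivative (\<lambda>h. h *\<^sub>R f (y t))) (at t within S)"
      using tS by blast
    have "g x = y x" if "x \<in> S" for x
      unfolding y_def by (rule LIMSEQ_unique[OF g(1)[OF that] LIMSEQ_Suc[OF conv]])
    with g(2) show ?thesis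
      unfolding has_vector_derivative_def at_within_open[OF tS S(1)]
      by (rule has_derivative_transform_within_open[OF _ S(1) tS])
  qed
  moreover have "y 0 = y0" by (simp add: y_def Y0)
  ultimately show ?thesis by blast
qed

text \<open>The right hand side, made Lipschitz by clamping the position to \<open>[x0 - R, x0 + R]\<close>, has global
  solutions. As long as such a solution stays in that interval it conserves \<open>v\<^sup>2/2 + V\<close>, so its speed is
  at most \<open>c\<close>, and it cannot leave the interval before the time \<open>T\<close> with \<open>c T < R\<close>.\<close>

lemma clamped_solution_bound:
  fixes F V x v :: "real \<Rightarrow> real"
  assumes V: "\<And>s. (V has_real_derivative - F s) (at s)" "\<And>s. 0 \<le> V s"
    and cl: "\<And>s. \<bar>s - x 0\<bar> \<le> R \<Longrightarrow> cl s = s"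
    and x: "\<And>t. (x has_real_derivative v t) (at t)" "\<And>t. (v has_real_derivative F (cl (x t))) (at t)"
    and c: "0 \<le> c" "(v 0)\<^sup>2 + 2 * V (x 0) = c\<^sup>2"
    and T: "c * T < R" "0 \<le> t" "t \<le> T"
  shows "\<bar>x t - x 0\<bar> < R"
proof (rule ccontr)
  assume far: "\<not> \<bar>x t - x 0\<bar> < R"
  define A where "A = {0..t} \<inter> {s. R \<le> \<bar>x s - x 0\<bar>}"
  have "closed {s. R \<le> \<bar>x s - x 0\<bar>}"
    by (intro closed_Collect_le continuous_intros continuous_at_imp_continuous_on ballI DERIV_isCont[OF x(1)])
  then have "compact A"
    unfolding A_def by (intro compact_Int_closed) auto
  moreover have "t \<in> A" using far T by (auto simp: A_def)
  ultimately obtain e where e: "e \<in> A" "\<And>s. s \<in> A \<Longrightarrow> e \<le> s"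
    using compact_attains_inf[of A] by auto
  have "0 \<le> c * T" using c T by (intro mult_nonneg_nonneg) auto
  then have "0 < R" using T by simp
  then have e0: "0 < e" "e \<le> t" "R \<le> \<bar>x e - x 0\<bar>"
    using e(1) by (auto simp: A_def less_eq_real_def)
  have near: "\<bar>x s - x 0\<bar> < R" if "0 \<le> s" "s < e" for s
    using e(2)[of s] that e0 by (force simp: A_def)
  have energy: "(v s)\<^sup>2 + 2 * V (x s) = (v 0)\<^sup>2 + 2 * V (x 0)" if s: "0 < s" "s < e" for s
  proof (rule DERIV_isconst_end[OF s(1)])
    have der: "((\<lambda>s. (v s)\<^sup>2 + 2 * V (x s)) has_real_derivative 2 * v z * F (cl (x z)) - 2 * F (x z) * v z) (at z)" for z
      using DERIV_chain2[OF V(1) x(1), of z] by (auto intro!: derivative_eq_intros x)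
    show "continuous_on {0..s} (\<lambda>s. (v s)\<^sup>2 + 2 * V (x s))"
      by (intro continuous_at_imp_continuous_on ballI DERIV_isCont[OF der])
    show "((\<lambda>s. (v s)\<^sup>2 + 2 * V (x s)) has_real_derivative 0) (at z)" if "0 < z" "z < s" for z
      using der[of z] cl[of "x z"] near[of z] that s by (simp add: less_imp_le)
  qed
  have speed: "\<bar>v s\<bar> \<le> c" if "0 < s" "s < e" for s
    using energy[OF that] V(2)[of "x s"] c(2) abs_le_square_iff[of "v s" c] c(1) by simp
  have "norm (x e - x 0) \<le> c * e - c * 0"
  proof (rule differentiable_bound_general[OF e0(1)])
    show "continuous_on {0..e} x" by (intro continuous_at_imp_continuous_on ballI DERIV_isCont[OF x(1)])
    show "continuous_on {0..e} (\<lambda>s. c * s)" by (intro continuous_intros)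
    show "(x has_vector_derivative v s) (at s)" for s
      using x(1) by (simp add: has_real_derivative_iff_has_vector_derivative)
    show "((\<lambda>s. c * s) has_vector_derivative c) (at s)" for s
      by (auto intro!: derivative_eq_intros simp flip: has_real_derivative_iff_has_vector_derivative)
  qed (use speed in auto)
  also have "\<dots> \<le> c * T" using e0 T c by (simp add: mult_left_mono)
  finally show False using e0 T by simp
qed

lemma conservative_local:
  fixes F F' V :: "real \<Rightarrow> real"
  assumes F: "\<And>s. (F has_real_derivative F' s) (at s)" "continuous_on UNIV F'"
    and V: "\<And>s. (V has_real_derivative - F s) (at s)" "\<And>s. 0 \<le> V s" and "0 < T"
  shows "\<exists>x v. x 0 = x0 \<and> v 0 = v0 \<and>
    (\<forall>t\<in>{-T<..<T}. (x has_real_derivative v t) (at t) \<and> (v has_real_derivative F (x t)) (at t))"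
proof -
  define c where "c = sqrt (v0\<^sup>2 + 2 * V x0)"
  have c: "0 \<le> c" "v0\<^sup>2 + 2 * V x0 = c\<^sup>2"
    using V(2)[of x0] by (simp_all add: c_def)
  define R where "R = c * T + 1"
  have R: "0 < R" "c * T < R" using c(1) \<open>0 < T\<close> by (simp_all add: R_def add_nonneg_pos)
  define cl where "cl s = max (x0 - R) (min (x0 + R) s)" for s
  have cl: "cl s \<in> {x0 - R..x0 + R}" "\<bar>cl s - cl s'\<bar> \<le> \<bar>s - s'\<bar>" "\<bar>s - x0\<bar> \<le> R \<Longrightarrow> cl s = s" for s s'
    using R by (auto simp: cl_def max_def min_def abs_le_iff)
  obtain K where K: "0 \<le> K"
      "\<And>x y. x \<in> {x0 - R..x0 + R} \<Longrightarrow> y \<in> {x0 - R..x0 + R} \<Longrightarrow> \<bar>F x - F y\<bar> \<le> K * \<bar>x - y\<bar>"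
    using lipschitz_on_interval[OF F] by blast
  define f where "f p = (snd p, F (cl (fst p)))" for p :: "real \<times> real"
  have "norm (f p - f q) \<le> (K + 1) * norm (p - q)" for p q
  proof -
    have "\<bar>F (cl (fst p)) - F (cl (fst q))\<bar> \<le> K * \<bar>cl (fst p) - cl (fst q)\<bar>"
      by (intro K(2) cl(1))
    also have "\<dots> \<le> K * \<bar>fst p - fst q\<bar>" by (intro mult_left_mono cl(2) K(1))
    also have "\<dots> \<le> K * norm (p - q)"
      using K(1) norm_fst_le[of "fst p - fst q" "snd p - snd q"]
      by (intro mult_left_mono) (simp_all add: minus_prod_def)
    finally have "\<bar>F (cl (fst p)) - F (cl (fst q))\<bar> \<le> K * norm (p - q)" .
    moreover have "\<bar>snd p - snd q\<bar> \<le> norm (p - q)"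
      using norm_snd_le[of "snd p - snd q" "fst p - fst q"] by (simp add: minus_prod_def)
    moreover have "norm (f p - f q) \<le> \<bar>snd p - snd q\<bar> + \<bar>F (cl (fst p)) - F (cl (fst q))\<bar>"
      using norm_Pair_le[of "snd p - snd q" "F (cl (fst p)) - F (cl (fst q))"] by (simp add: f_def minus_prod_def)
    ultimately show ?thesis by (simp add: algebra_simps)
  qed
  from picard_global[OF _ this, of "(x0, v0)"] K(1)
  obtain y where y: "y 0 = (x0, v0)" "\<And>t. (y has_vector_derivative f (y t)) (at t)" by auto
  define x v where "x t = fst (y t)" and "v t = snd (y t)" for t
  have x: "(x has_real_derivative v t) (at t)" and v: "(v has_real_derivative F (cl (x t))) (at t)" for t
    using fst_has_derivative[OF y(2)[of t]] snd_has_derivative[OF y(2)[of t]]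
    by (simp_all add: f_def x_def[abs_def] v_def[abs_def] has_real_derivative_iff_has_vector_derivative)
  have init: "x 0 = x0" "v 0 = v0" using y(1) by (simp_all add: x_def v_def)
  have "cl (x t) = x t" if t: "t \<in> {-T<..<T}" for t
  proof (cases "0 \<le> t")
    case True
    have "\<bar>x t - x 0\<bar> < R"
      by (rule clamped_solution_bound[where v = v and cl = cl and c = c and T = T, OF V _ x v])
        (use True t c R cl(3) init in auto)
    then show ?thesis using cl(3) init by simp
  next
    case False
    \<comment> \<open>The equation is invariant under time reversal.\<close>
    have "((\<lambda>t. x (- t)) has_real_derivative - v (- t)) (at t)"
      "((\<lambda>t. - v (- t)) has_real_derivative F (cl (x (- t)))) (at t)" for t
      using DERIV_chain2[OF x DERIV_minus[OF DERIV_ident], of t] DERIV_minus[OF DERIV_chain2[OF v DERIV_minus[OF DERIV_ident], of t]]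
      by simp_all
    then have "\<bar>x (- (- t)) - x (- 0)\<bar> < R"
      by (intro clamped_solution_bound[where x = "\<lambda>t. x (- t)" and v = "\<lambda>t. - v (- t)" and t = "- t" and cl = cl and c = c and T = T, OF V])
        (use False t c R cl(3) init in auto)
    then show ?thesis using cl(3) init by simp
  qed
  with x v init show ?thesis by metis
qed

text \<open>The solutions on the intervals \<open>(-n, n)\<close> agree where they overlap, by uniqueness.\<close>

lemma conservative_global:
  fixes F F' V :: "real \<Rightarrow> real"
  assumes F: "\<And>s. (F has_real_derivative F' s) (at s)" "continuous_on UNIV F'"
    and V: "\<And>s. (V has_real_derivative - F s) (at s)" "\<And>s. 0 \<le> V s"
  shows "\<exists>x v. x t0 = x0 \<and> v t0 = v0 \<and>
    (\<forall>t. (x has_real_derivative v t) (at t) \<and> (v has_real_derivative F (x t)) (at t))"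
proof -
  have "\<forall>n::nat. \<exists>p. fst p 0 = x0 \<and> snd p 0 = v0 \<and> (\<forall>t\<in>{-real (Suc n)<..<real (Suc n)}.
      (fst p has_real_derivative snd p t) (at t) \<and> (snd p has_real_derivative F (fst p t)) (at t))"
    using conservative_local[OF F V, of "real (Suc n)" x0 v0 for n] by (simp add: split_paired_Ex del: of_nat_Suc)
  then obtain P where P: "\<And>n::nat. fst (P n) 0 = x0 \<and> snd (P n) 0 = v0 \<and> (\<forall>t\<in>{-real (Suc n)<..<real (Suc n)}.
      (fst (P n) has_real_derivative snd (P n) t) (at t) \<and> (snd (P n) has_real_derivative F (fst (P n) t)) (at t))"
    by metis
  have agree: "fst (P n) t = fst (P m) t \<and> snd (P n) t = snd (P m) t"
    if "\<bar>t\<bar> < Suc n" "\<bar>t\<bar> < Suc m" for n m and t :: real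
    by (rule conservative_unique[OF F, where I = "{-real (Suc (min n m))<..<real (Suc (min n m))}" and ?t0.0 = 0])
      (use that P[of n] P[of m] in \<open>auto simp: is_interval_oo min_def abs_less_iff split: if_splits\<close>)
  define N where "N t = nat \<lceil>\<bar>t\<bar>\<rceil>" for t :: real
  have N: "\<bar>t\<bar> < Suc (N t)" for t
    unfolding N_def by linarith
  define x v where "x t = fst (P (N t)) t" and "v t = snd (P (N t)) t" for t
  have "(x has_real_derivative v t) (at t) \<and> (v has_real_derivative F (x t)) (at t)" for t
  proof -
    define S where "S = {-real (Suc (N t))<..<real (Suc (N t))}"
    have S: "open S" "t \<in> S" using N[of t] by (auto simp: S_def abs_less_iff)
    have eq: "fst (P (N t)) s = x s" "snd (P (N t)) s = v s" if "s \<in> S" for s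
      using agree[of s "N t" "N s"] N[of s] that by (auto simp: S_def x_def v_def abs_less_iff)
    have "(fst (P (N t)) has_real_derivative v t) (at t)" "(snd (P (N t)) has_real_derivative F (x t)) (at t)"
      using P[of "N t"] S(2) unfolding eq(1)[OF S(2), symmetric] eq(2)[OF S(2), symmetric] S_def by blast+
    then show ?thesis
      using has_field_derivative_transform_within_open[OF _ S, of "fst (P (N t))" _ x]
        has_field_derivative_transform_within_open[OF _ S, of "snd (P (N t))" _ v] eq by blast
  qed
  then have "((\<lambda>t. x (t - t0)) has_real_derivative v (t - t0)) (at t)"
    "((\<lambda>t. v (t - t0)) has_real_derivative F (x (t - t0))) (at t)" for t
    using DERIV_at_within_shift[of x "v (t - t0)" "- t0" t UNIV] DERIV_at_within_shift[of v "F (x (t - t0))" "- t0" t UNIV]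
    by (simp_all add: add.commute)
  moreover have "x 0 = x0" "v 0 = v0" using P[of "N 0"] by (simp_all add: x_def v_def)
  ultimately show ?thesis
    by (intro exI[of _ "\<lambda>t. x (t - t0)"] exI[of _ "\<lambda>t. v (t - t0)"]) simp
qed

section \<open>The first variation of the energy of a warped product\<close>

definition warped_metric :: "(real \<Rightarrow> real) \<Rightarrow> (real \<times> 'b::real_inner) metric_tensor" where
  "warped_metric a p v w = a (fst p) * inner (snd v) (snd w) + fst v * fst w"

lemma smooth_on_partial:
  fixes f :: "real \<times> real \<Rightarrow> 'b::real_normed_vector"
  assumes "smooth_on B f" "(x, t) \<in> B"
  shows "((\<lambda>x. f (x, t)) has_vector_derivative frechet_derivative f (at (x, t)) (1, 0)) (at x)"
    and "((\<lambda>t. f (x, t)) has_vector_derivative frechet_derivative f (at (x, t)) (0, 1)) (at t)"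
proof -
  have D: "(f has_derivative frechet_derivative f (at (x, t))) (at (x, t))"
    by (rule smooth_on_has_derivative[OF assms])
  then have lin: "frechet_derivative f (at (x, t)) (c *\<^sub>R p) = c *\<^sub>R frechet_derivative f (at (x, t)) p" for c p
    by (rule linear_scale[OF has_derivative_linear])
  have "((\<lambda>x. (x, t)) has_derivative (\<lambda>h. (h, 0))) (at x)" "((\<lambda>t. (x, t)) has_derivative (\<lambda>h. (0, h))) (at t)"
    by (auto intro!: derivative_eq_intros)
  note chain = has_derivative_compose[OF this(1) D] has_derivative_compose[OF this(2) D]
  have "(\<lambda>h. frechet_derivative f (at (x, t)) (h, 0)) = (\<lambda>h. h *\<^sub>R frechet_derivative f (at (x, t)) (1, 0))"
    "(\<lambda>h. frechet_derivative f (at (x, t)) (0, h)) = (\<lambda>h. h *\<^sub>R frechet_derivative f (at (x, t)) (0, 1))"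
    unfolding lin[symmetric] by simp_all
  with chain show "((\<lambda>x. f (x, t)) has_vector_derivative frechet_derivative f (at (x, t)) (1, 0)) (at x)"
    and "((\<lambda>t. f (x, t)) has_vector_derivative frechet_derivative f (at (x, t)) (0, 1)) (at t)"
    by (simp_all only: has_vector_derivative_def)
qed

lemma leibniz_rule_slices:
  fixes f f' :: "real \<Rightarrow> real \<Rightarrow> real"
  assumes "0 < \<delta>" and d: "\<And>x t. x \<in> {-\<delta><..<\<delta>} \<Longrightarrow> t \<in> {t\<^sub>0..t\<^sub>1} \<Longrightarrow> ((\<lambda>x. f x t) has_real_derivative f' x t) (at x)"
    and "\<And>x. x \<in> {-\<delta><..<\<delta>} \<Longrightarrow> continuous_on {t\<^sub>0..t\<^sub>1} (f x)"
    and "continuous_on ({-\<delta><..<\<delta>} \<times> {t\<^sub>0..t\<^sub>1}) (\<lambda>(x, t). f' x t)"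
  shows "((\<lambda>x. integral {t\<^sub>0..t\<^sub>1} (f x)) has_real_derivative integral {t\<^sub>0..t\<^sub>1} (f' 0)) (at 0)"
proof -
  have "((\<lambda>x. integral (cbox t\<^sub>0 t\<^sub>1) (f x)) has_real_derivative integral (cbox t\<^sub>0 t\<^sub>1) (f' 0)) (at 0 within {-\<delta><..<\<delta>})"
    using assms by (intro leibniz_rule_field_derivative) (auto intro: DERIV_subset integrable_continuous_real)
  then show ?thesis using \<open>0 < \<delta>\<close> by (simp add: at_within_open[OF _ open_greaterThanLessThan])
qed

text \<open>The integration by parts is carried out for the fixed momentum \<open>q\<close> before differentiating in
  the parameter, so that the mixed second derivatives of \<open>\<Gamma>\<close> never have to be exchanged.\<close>

lemma first_variation:
  fixes \<Gamma> :: "real \<times> real \<Rightarrow> real \<times> 'b::real_inner"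
  assumes a: "\<And>s. (a has_real_derivative a' s) (at s)" "continuous_on UNIV a'"
    and J: "t\<^sub>0 < t\<^sub>1" "{t\<^sub>0..t\<^sub>1} \<subseteq> J" and \<delta>: "0 < \<delta>"
    and smooth: "smooth_on ({-\<delta><..<\<delta>} \<times> J) \<Gamma>"
    and ends: "\<And>x. x \<in> {-\<delta><..<\<delta>} \<Longrightarrow> \<Gamma> (x, t\<^sub>0) = p\<^sub>0 \<and> \<Gamma> (x, t\<^sub>1) = p\<^sub>1"
    and v: "\<And>t. t \<in> {t\<^sub>0..t\<^sub>1} \<Longrightarrow> ((\<lambda>t. \<Gamma> (0, t)) has_vector_derivative v t) (at t)"
    and q: "\<And>t. t \<in> {t\<^sub>0..t\<^sub>1} \<Longrightarrow> ((\<lambda>t. (fst (v t), a (fst (\<Gamma> (0, t))) *\<^sub>R snd (v t))) has_vector_derivative q' t) (at t)"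
      "continuous_on {t\<^sub>0..t\<^sub>1} q'"
    and \<xi>: "\<And>t. t \<in> {t\<^sub>0..t\<^sub>1} \<Longrightarrow> ((\<lambda>x. \<Gamma> (x, t)) has_vector_derivative \<xi> t) (at 0)"
  shows "((\<lambda>x. energy (warped_metric a) t\<^sub>0 t\<^sub>1 (\<lambda>t. \<Gamma> (x, t))) has_real_derivative
    integral {t\<^sub>0..t\<^sub>1} (\<lambda>t. a' (fst (\<Gamma> (0, t))) / 2 * fst (\<xi> t) * (snd (v t) \<bullet> snd (v t)) - q' t \<bullet> \<xi> t)) (at 0)"
proof -
  define B where "B = {-\<delta><..<\<delta>} \<times> J"
  define D1 D2 where "D1 = (\<lambda>p. frechet_derivative \<Gamma> (at p) (1, 0))" and "D2 = (\<lambda>p. frechet_derivative \<Gamma> (at p) (0, 1))"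
  define D12 where "D12 = (\<lambda>p. frechet_derivative D2 (at p) (1, 0))"
  define q where "q t = (fst (v t), a (fst (\<Gamma> (0, t))) *\<^sub>R snd (v t))" for t
  have sm: "smooth_on B \<Gamma>" "smooth_on B D1" "smooth_on B D2" "smooth_on B D12"
    using smooth by (simp_all add: B_def D1_def D2_def D12_def smooth_on_frechet)
  have sub: "{-\<delta><..<\<delta>} \<times> {t\<^sub>0..t\<^sub>1} \<subseteq> B" using J by (auto simp: B_def)
  have mem: "(x, t) \<in> B" if "x \<in> {-\<delta><..<\<delta>}" "t \<in> {t\<^sub>0..t\<^sub>1}" for x t using that sub by auto
  note cont2 = continuous_on_subset[OF smooth_on_continuous[OF sm(1)] sub]
    continuous_on_subset[OF smooth_on_continuous[OF sm(2)] sub]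
    continuous_on_subset[OF smooth_on_continuous[OF sm(3)] sub]
    continuous_on_subset[OF smooth_on_continuous[OF sm(4)] sub]
  have slice: "continuous_on {t\<^sub>0..t\<^sub>1} (\<lambda>t. f (x, t))"
    if "continuous_on ({-\<delta><..<\<delta>} \<times> {t\<^sub>0..t\<^sub>1}) f" "x \<in> {-\<delta><..<\<delta>}" for x and f :: "real \<times> real \<Rightarrow> real \<times> 'b"
    using that by (auto intro!: continuous_on_compose2[OF that(1)] continuous_intros)
  have d1: "((\<lambda>x. \<Gamma> (x, t)) has_vector_derivative D1 (x, t)) (at x)"
    and d2: "((\<lambda>t. \<Gamma> (x, t)) has_vector_derivative D2 (x, t)) (at t)"
    and d12: "((\<lambda>x. D2 (x, t)) has_vector_derivative D12 (x, t)) (at x)"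
    if "x \<in> {-\<delta><..<\<delta>}" "t \<in> {t\<^sub>0..t\<^sub>1}" for x t
    using smooth_on_partial[OF sm(1) mem[OF that]] smooth_on_partial[OF sm(3) mem[OF that]]
    by (simp_all add: D1_def D2_def D12_def)
  have zero: "0 \<in> {-\<delta><..<\<delta>}" using \<delta> by simp
  have v_eq: "D2 (0, t) = v t" and \<xi>_eq: "D1 (0, t) = \<xi> t" if "t \<in> {t\<^sub>0..t\<^sub>1}" for t
    using vector_derivative_unique_at[OF d2[OF zero that] v[OF that]]
      vector_derivative_unique_at[OF d1[OF zero that] \<xi>[OF that]] .
  have a_cont: "continuous_on UNIV a"
    by (intro continuous_at_imp_continuous_on ballI DERIV_isCont[OF a(1)])
  define e where "e x t = a (fst (\<Gamma> (x, t))) * (snd (D2 (x, t)) \<bullet> snd (D2 (x, t))) + fst (D2 (x, t)) * fst (D2 (x, t))" for x t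
  define e' where "e' x t = a' (fst (\<Gamma> (x, t))) * fst (D1 (x, t)) * (snd (D2 (x, t)) \<bullet> snd (D2 (x, t)))
    + 2 * (a (fst (\<Gamma> (x, t))) * (snd (D2 (x, t)) \<bullet> snd (D12 (x, t))) + fst (D2 (x, t)) * fst (D12 (x, t)))" for x t
  have E: "((\<lambda>x. integral {t\<^sub>0..t\<^sub>1} (e x)) has_real_derivative integral {t\<^sub>0..t\<^sub>1} (e' 0)) (at 0)"
  proof (rule leibniz_rule_slices[OF \<delta>])
    fix x t assume xt: "x \<in> {-\<delta><..<\<delta>}" "t \<in> {t\<^sub>0..t\<^sub>1}"
    note da = DERIV_chain2[OF a(1) fst_has_derivative[OF d1[OF xt]]]
    note di = inner_has_derivative[OF snd_has_derivative[OF d12[OF xt]] snd_has_derivative[OF d12[OF xt]]]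
    note df = fst_has_derivative[OF d12[OF xt]]
    show "((\<lambda>x. e x t) has_real_derivative e' x t) (at x)"
      unfolding e_def
      by (rule DERIV_cong[OF DERIV_add[OF DERIV_mult[OF da di] DERIV_mult[OF df df]]])
        (simp add: e'_def algebra_simps inner_commute)
  next
    show "continuous_on {t\<^sub>0..t\<^sub>1} (e x)" if "x \<in> {-\<delta><..<\<delta>}" for x
      unfolding e_def using that
      by (intro continuous_intros continuous_on_compose2[OF a_cont] slice cont2) auto
    show "continuous_on ({-\<delta><..<\<delta>} \<times> {t\<^sub>0..t\<^sub>1}) (\<lambda>(x, t). e' x t)"
      unfolding e'_def split_beta prod.collapse
      by (intro continuous_intros continuous_on_compose2[OF a_cont] continuous_on_compose2[OF a(2)] cont2) auto
  qed
  have "energy (warped_metric a) t\<^sub>0 t\<^sub>1 (\<lambda>t. \<Gamma> (x, t)) = integral {t\<^sub>0..t\<^sub>1} (e x) / 2"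
    if "x \<in> {-\<delta><..<\<delta>}" for x
    unfolding energy_def
    by (intro arg_cong[where f = "\<lambda>r. r / 2"] integral_cong)
      (simp add: warped_metric_def e_def vector_derivative_at[OF d2[OF that]])
  then have energy: "((\<lambda>x. energy (warped_metric a) t\<^sub>0 t\<^sub>1 (\<lambda>t. \<Gamma> (x, t))) has_real_derivative integral {t\<^sub>0..t\<^sub>1} (e' 0) / 2) (at 0)"
    using has_field_derivative_transform_within_open[OF DERIV_cdivide[OF E, of 2] open_greaterThanLessThan zero] by simp
  have q_cont: "continuous_on {t\<^sub>0..t\<^sub>1} q"
    unfolding q_def by (intro continuous_at_imp_continuous_on ballI has_vector_derivative_continuous[OF q(1)])
  have q_cont2: "continuous_on ({-\<delta><..<\<delta>} \<times> {t\<^sub>0..t\<^sub>1}) (\<lambda>p. q (snd p))"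
      "continuous_on ({-\<delta><..<\<delta>} \<times> {t\<^sub>0..t\<^sub>1}) (\<lambda>p. q' (snd p))"
    by (auto intro!: continuous_on_compose2[OF q_cont] continuous_on_compose2[OF q(2)] continuous_intros)
  have F: "((\<lambda>x. integral {t\<^sub>0..t\<^sub>1} (\<lambda>t. q t \<bullet> D2 (x, t))) has_real_derivative integral {t\<^sub>0..t\<^sub>1} (\<lambda>t. q t \<bullet> D12 (0, t))) (at 0)"
  proof (rule leibniz_rule_slices[OF \<delta>])
    show "((\<lambda>x. q t \<bullet> D2 (x, t)) has_real_derivative q t \<bullet> D12 (x, t)) (at x)"
      if "x \<in> {-\<delta><..<\<delta>}" "t \<in> {t\<^sub>0..t\<^sub>1}" for x t
      using inner_has_derivative[OF has_vector_derivative_const d12[OF that], of "q t"] by simp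
    show "continuous_on {t\<^sub>0..t\<^sub>1} (\<lambda>t. q t \<bullet> D2 (x, t))" if "x \<in> {-\<delta><..<\<delta>}" for x
      using that by (intro continuous_intros q_cont slice cont2)
    show "continuous_on ({-\<delta><..<\<delta>} \<times> {t\<^sub>0..t\<^sub>1}) (\<lambda>(x, t). q t \<bullet> D12 (x, t))"
      unfolding split_beta prod.collapse by (intro continuous_intros q_cont2 cont2)
  qed
  have H: "((\<lambda>x. integral {t\<^sub>0..t\<^sub>1} (\<lambda>t. q' t \<bullet> \<Gamma> (x, t))) has_real_derivative integral {t\<^sub>0..t\<^sub>1} (\<lambda>t. q' t \<bullet> D1 (0, t))) (at 0)"
  proof (rule leibniz_rule_slices[OF \<delta>])
    show "((\<lambda>x. q' t \<bullet> \<Gamma> (x, t)) has_real_derivative q' t \<bullet> D1 (x, t)) (at x)"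
      if "x \<in> {-\<delta><..<\<delta>}" "t \<in> {t\<^sub>0..t\<^sub>1}" for x t
      using inner_has_derivative[OF has_vector_derivative_const d1[OF that], of "q' t"] by simp
    show "continuous_on {t\<^sub>0..t\<^sub>1} (\<lambda>t. q' t \<bullet> \<Gamma> (x, t))" if "x \<in> {-\<delta><..<\<delta>}" for x
      using that by (intro continuous_intros q slice cont2)
    show "continuous_on ({-\<delta><..<\<delta>} \<times> {t\<^sub>0..t\<^sub>1}) (\<lambda>(x, t). q' t \<bullet> D1 (x, t))"
      unfolding split_beta prod.collapse by (intro continuous_intros q_cont2 cont2)
  qed
  have parts: "integral {t\<^sub>0..t\<^sub>1} (\<lambda>t. q t \<bullet> D2 (x, t)) = q t\<^sub>1 \<bullet> p\<^sub>1 - q t\<^sub>0 \<bullet> p\<^sub>0 - integral {t\<^sub>0..t\<^sub>1} (\<lambda>t. q' t \<bullet> \<Gamma> (x, t))"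
    if x: "x \<in> {-\<delta><..<\<delta>}" for x
  proof -
    have i: "(\<lambda>t. q t \<bullet> D2 (x, t)) integrable_on {t\<^sub>0..t\<^sub>1}" "(\<lambda>t. q' t \<bullet> \<Gamma> (x, t)) integrable_on {t\<^sub>0..t\<^sub>1}"
      using x by (auto intro!: integrable_continuous_real continuous_intros q_cont q slice cont2)
    have "((\<lambda>t. q t \<bullet> D2 (x, t) + q' t \<bullet> \<Gamma> (x, t)) has_integral q t\<^sub>1 \<bullet> \<Gamma> (x, t\<^sub>1) - q t\<^sub>0 \<bullet> \<Gamma> (x, t\<^sub>0)) {t\<^sub>0..t\<^sub>1}"
    proof (rule fundamental_theorem_of_calculus)
      show "((\<lambda>t. q t \<bullet> \<Gamma> (x, t)) has_vector_derivative q t \<bullet> D2 (x, t) + q' t \<bullet> \<Gamma> (x, t)) (at t within {t\<^sub>0..t\<^sub>1})"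
        if "t \<in> {t\<^sub>0..t\<^sub>1}" for t
        using inner_has_derivative[OF q(1)[OF that, folded q_def] d2[OF x that]]
        by (auto simp: has_real_derivative_iff_has_vector_derivative intro: has_vector_derivative_at_within)
    qed (use J in simp)
    then show ?thesis
      using integral_add[OF i] ends[OF x] by (simp add: integral_unique)
  qed
  have "integral {t\<^sub>0..t\<^sub>1} (\<lambda>t. q t \<bullet> D12 (0, t)) = - integral {t\<^sub>0..t\<^sub>1} (\<lambda>t. q' t \<bullet> D1 (0, t))"
  proof (rule DERIV_unique[OF F])
    show "((\<lambda>x. integral {t\<^sub>0..t\<^sub>1} (\<lambda>t. q t \<bullet> D2 (x, t))) has_real_derivative - integral {t\<^sub>0..t\<^sub>1} (\<lambda>t. q' t \<bullet> D1 (0, t))) (at 0)"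
      by (rule has_field_derivative_transform_within_open[OF DERIV_cong[OF DERIV_diff[OF DERIV_const H]] open_greaterThanLessThan zero])
        (auto simp: parts)
  qed
  moreover have "integral {t\<^sub>0..t\<^sub>1} (e' 0) / 2 =
      integral {t\<^sub>0..t\<^sub>1} (\<lambda>t. a' (fst (\<Gamma> (0, t))) / 2 * fst (D1 (0, t)) * (snd (D2 (0, t)) \<bullet> snd (D2 (0, t))) + q t \<bullet> D12 (0, t))"
    unfolding integral_divide[symmetric]
    by (intro integral_cong) (simp add: e'_def q_def inner_prod_def v_eq field_simps)
  moreover have i: "(\<lambda>t. a' (fst (\<Gamma> (0, t))) / 2 * fst (D1 (0, t)) * (snd (D2 (0, t)) \<bullet> snd (D2 (0, t)))) integrable_on {t\<^sub>0..t\<^sub>1}"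
    "(\<lambda>t. q t \<bullet> D12 (0, t)) integrable_on {t\<^sub>0..t\<^sub>1}" "(\<lambda>t. q' t \<bullet> D1 (0, t)) integrable_on {t\<^sub>0..t\<^sub>1}"
    using zero by (auto intro!: integrable_continuous_real continuous_intros q_cont q slice cont2 continuous_on_compose2[OF a(2)])
  ultimately have "integral {t\<^sub>0..t\<^sub>1} (e' 0) / 2 =
      integral {t\<^sub>0..t\<^sub>1} (\<lambda>t. a' (fst (\<Gamma> (0, t))) / 2 * fst (D1 (0, t)) * (snd (D2 (0, t)) \<bullet> snd (D2 (0, t))) - q' t \<bullet> D1 (0, t))"
    by (simp only: integral_add[OF i(1,2)] integral_diff[OF i(1,3)] add_uminus_conv_diff)
  also have "\<dots> = integral {t\<^sub>0..t\<^sub>1} (\<lambda>t. a' (fst (\<Gamma> (0, t))) / 2 * fst (\<xi> t) * (snd (v t) \<bullet> snd (v t)) - q' t \<bullet> \<xi> t)"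
    by (intro integral_cong) (simp add: v_eq \<xi>_eq)
  finally show ?thesis using energy by simp
qed

section \<open>The geodesic equation\<close>

text \<open>A single arch of the cosine, vanishing at \<open>t\<^sub>0\<close> and \<open>t\<^sub>1\<close>. Its values beyond these points are still at
  most \<open>1\<close> in absolute value, which keeps the variations below away from the origin of \<open>L\<^sup>2\<close> on all of
  their domain.\<close>

definition bump :: "real \<Rightarrow> real \<Rightarrow> real \<Rightarrow> real" where
  "bump t\<^sub>0 t\<^sub>1 t = cos (pi * ((t - (t\<^sub>0 + t\<^sub>1) / 2) / (t\<^sub>1 - t\<^sub>0)))"

lemma bump_ends: "t\<^sub>0 < t\<^sub>1 \<Longrightarrow> bump t\<^sub>0 t\<^sub>1 t\<^sub>0 = 0" "t\<^sub>0 < t\<^sub>1 \<Longrightarrow> bump t\<^sub>0 t\<^sub>1 t\<^sub>1 = 0"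
proof -
  assume "t\<^sub>0 < t\<^sub>1"
  then have "(t\<^sub>0 - (t\<^sub>0 + t\<^sub>1) / 2) / (t\<^sub>1 - t\<^sub>0) = - (1/2)" "(t\<^sub>1 - (t\<^sub>0 + t\<^sub>1) / 2) / (t\<^sub>1 - t\<^sub>0) = 1/2"
    by (simp_all add: field_simps)
  then have "bump t\<^sub>0 t\<^sub>1 t\<^sub>0 = cos (pi * - (1/2))" "bump t\<^sub>0 t\<^sub>1 t\<^sub>1 = cos (pi * (1/2))"
    by (simp_all only: bump_def)
  then show "bump t\<^sub>0 t\<^sub>1 t\<^sub>0 = 0" "bump t\<^sub>0 t\<^sub>1 t\<^sub>1 = 0" by simp_all
qed

lemma bump_mid: "bump (t - d) (t + d) t = 1"
  by (simp add: bump_def)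

lemma bump_nonneg:
  assumes "t\<^sub>0 < t\<^sub>1" "t \<in> {t\<^sub>0..t\<^sub>1}" shows "0 \<le> bump t\<^sub>0 t\<^sub>1 t"
proof -
  have "-(1/2) \<le> (t - (t\<^sub>0 + t\<^sub>1) / 2) / (t\<^sub>1 - t\<^sub>0)" "(t - (t\<^sub>0 + t\<^sub>1) / 2) / (t\<^sub>1 - t\<^sub>0) \<le> 1/2"
    using assms by (simp_all add: field_simps)
  then have "pi * -(1/2) \<le> pi * ((t - (t\<^sub>0 + t\<^sub>1) / 2) / (t\<^sub>1 - t\<^sub>0))" "pi * ((t - (t\<^sub>0 + t\<^sub>1) / 2) / (t\<^sub>1 - t\<^sub>0)) \<le> pi * (1/2)"
    by (simp_all only: mult_left_mono pi_ge_zero)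
  then show ?thesis unfolding bump_def by (intro cos_ge_zero) auto
qed

lemma bump_bound: "\<bar>bump t\<^sub>0 t\<^sub>1 t\<bar> \<le> 1"
  by (simp add: bump_def)

lemma bump_continuous: "continuous_on S (bump t\<^sub>0 t\<^sub>1)"
  unfolding bump_def divide_inverse by (intro continuous_intros)

lemma smooth_on_bump: "open U \<Longrightarrow> smooth_on U f \<Longrightarrow> smooth_on U (\<lambda>p. bump t\<^sub>0 t\<^sub>1 (f p))"
  unfolding bump_def divide_inverse
  by (intro smooth_on_cos smooth_on_mult smooth_on_diff smooth_on_const)

text \<open>Criticality is available on every compact subinterval of \<open>I\<close>. One test function per interval is
  therefore enough: around a point where \<open>R\<close> is positive, the interval is chosen so small that \<open>R\<close> is
  positive on all of it.\<close>

lemma fundamental_lemma_bump: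
  fixes R :: "real \<Rightarrow> real"
  assumes "open I" "continuous_on I R" "t \<in> I"
    and zero: "\<And>t\<^sub>0 t\<^sub>1. t\<^sub>0 < t\<^sub>1 \<Longrightarrow> {t\<^sub>0..t\<^sub>1} \<subseteq> I \<Longrightarrow> integral {t\<^sub>0..t\<^sub>1} (\<lambda>t. R t * bump t\<^sub>0 t\<^sub>1 t) = 0"
  shows "R t = 0"
proof -
  have "R t \<le> 0" if cont: "continuous_on I R" and
    zero: "\<And>t\<^sub>0 t\<^sub>1. t\<^sub>0 < t\<^sub>1 \<Longrightarrow> {t\<^sub>0..t\<^sub>1} \<subseteq> I \<Longrightarrow> integral {t\<^sub>0..t\<^sub>1} (\<lambda>t. R t * bump t\<^sub>0 t\<^sub>1 t) = 0" for R :: "real \<Rightarrow> real"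
  proof (rule ccontr)
    assume "\<not> R t \<le> 0"
    then have "open (I \<inter> R -` {0<..})" "t \<in> I \<inter> R -` {0<..}"
      using continuous_on_open_vimage[OF assms(1), of R] cont assms(3) by (auto simp: Int_commute)
    then obtain d where d: "0 < d" "cball t d \<subseteq> I \<inter> R -` {0<..}"
      by (meson open_contains_cball)
    then have sub: "{t - d..t + d} \<subseteq> I" and pos: "\<And>s. s \<in> {t - d..t + d} \<Longrightarrow> 0 < R s"
      by (auto simp: cball_eq_atLeastAtMost)
    have "\<forall>s\<in>{t - d..t + d}. R s * bump (t - d) (t + d) s = 0"
    proof (rule integral_eq_0_iff[THEN iffD1])
      show "continuous_on {t - d..t + d} (\<lambda>s. R s * bump (t - d) (t + d) s)"
        by (intro continuous_intros continuous_on_subset[OF cont sub] bump_continuous)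
      show "0 \<le> R s * bump (t - d) (t + d) s" if "s \<in> {t - d..t + d}" for s
        using pos[OF that] bump_nonneg[OF _ that] d by simp
      show "integral {t - d..t + d} (\<lambda>s. R s * bump (t - d) (t + d) s) = 0"
        using zero[OF _ sub] d by simp
    qed (use d in simp)
    then have "R t = 0" using d bump_mid[of t d] by force
    then show False using pos[of t] d by simp
  qed
  from this[OF assms(2) zero] this[of "\<lambda>t. - R t"] show ?thesis
    using assms(2) zero by (force intro: continuous_on_minus)
qed

text \<open>Two families of variations. The second moves \<open>\<phi>\<close> in the direction \<open>h\<close> and projects back to the unit
  sphere; it is used with positions \<open>h = \<phi>(\<tau>)\<close> of the curve itself.\<close>

definition vary_radius :: "(real \<Rightarrow> real \<times> 'b::real_inner) \<Rightarrow> real \<Rightarrow> real \<Rightarrow> real \<times> real \<Rightarrow> real \<times> 'b" where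
  "vary_radius \<gamma> t\<^sub>0 t\<^sub>1 = (\<lambda>(\<epsilon>, t). (fst (\<gamma> t) + \<epsilon> * bump t\<^sub>0 t\<^sub>1 t, snd (\<gamma> t)))"

definition push :: "(real \<Rightarrow> real \<times> 'b::real_inner) \<Rightarrow> 'b \<Rightarrow> real \<Rightarrow> real \<Rightarrow> real \<times> real \<Rightarrow> 'b" where
  "push \<gamma> h t\<^sub>0 t\<^sub>1 p = snd (\<gamma> (snd p)) + (fst p * bump t\<^sub>0 t\<^sub>1 (snd p)) *\<^sub>R h"

definition vary_direction :: "(real \<Rightarrow> real \<times> 'b::real_inner) \<Rightarrow> 'b \<Rightarrow> real \<Rightarrow> real \<Rightarrow> real \<times> real \<Rightarrow> real \<times> 'b" where
  "vary_direction \<gamma> h t\<^sub>0 t\<^sub>1 = (\<lambda>p. (fst (\<gamma> (snd p)), (1 / norm (push \<gamma> h t\<^sub>0 t\<^sub>1 p)) *\<^sub>R push \<gamma> h t\<^sub>0 t\<^sub>1 p))"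

abbreviation strip :: "real set \<Rightarrow> (real \<times> real) set" where
  "strip I \<equiv> {-(1/2)<..<1/2} \<times> I"

lemma open_strip: "open I \<Longrightarrow> open (strip I)"
  by (intro open_Times) auto

lemma smooth_on_strip:
  fixes f :: "real \<Rightarrow> 'b::real_normed_vector"
  assumes "open I" "smooth_on I f"
  shows "smooth_on (strip I) (\<lambda>p. f (snd p))"
  using assms by (intro smooth_on_compose[OF assms(2)] smooth_on_snd smooth_on_ident open_strip) auto

lemma smooth_vary_radius:
  assumes "open I" "smooth_on I \<gamma>"
  shows "smooth_on (strip I) (vary_radius \<gamma> t\<^sub>0 t\<^sub>1)"
proof -
  note [intro] = smooth_on_strip[OF assms] open_strip[OF assms(1)]
  show ?thesis
    unfolding vary_radius_def split_beta
    by (intro smooth_on_Pair smooth_on_add smooth_on_mult smooth_on_bump smooth_on_fst smooth_on_snd smooth_on_ident) auto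
qed

lemma smooth_push:
  assumes "open I" "smooth_on I \<gamma>"
  shows "smooth_on (strip I) (push \<gamma> h t\<^sub>0 t\<^sub>1)"
proof -
  note [intro] = smooth_on_strip[OF assms] open_strip[OF assms(1)]
  show ?thesis
    unfolding push_def
    by (intro smooth_on_add smooth_on_scaleR smooth_on_mult smooth_on_bump smooth_on_fst smooth_on_snd smooth_on_ident smooth_on_const) auto
qed

lemma push_nonzero:
  assumes "p \<in> strip I" "\<And>t. t \<in> I \<Longrightarrow> snd (\<gamma> t) \<bullet> snd (\<gamma> t) = 1" "h \<bullet> h = 1"
  shows "0 < norm (push \<gamma> h t\<^sub>0 t\<^sub>1 p)"
proof -
  define c where "c = fst p * bump t\<^sub>0 t\<^sub>1 (snd p)"
  have "\<bar>fst p\<bar> * \<bar>bump t\<^sub>0 t\<^sub>1 (snd p)\<bar> \<le> \<bar>fst p\<bar> * 1"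
    by (intro mult_left_mono bump_bound) auto
  then have "\<bar>c\<bar> < 1" using assms(1) by (auto simp: c_def abs_mult mem_Times_iff)
  moreover have "norm (snd (\<gamma> (snd p))) = 1" "norm (c *\<^sub>R h) = \<bar>c\<bar>"
    using assms by (auto simp: norm_eq_sqrt_inner)
  ultimately have "0 < norm (snd (\<gamma> (snd p)) + c *\<^sub>R h)"
    using norm_diff_ineq[of "snd (\<gamma> (snd p))" "c *\<^sub>R h"] by linarith
  then show ?thesis by (simp only: push_def c_def)
qed

lemma smooth_push_norm:
  assumes "open I" "smooth_on I \<gamma>" "\<And>t. t \<in> I \<Longrightarrow> snd (\<gamma> t) \<bullet> snd (\<gamma> t) = 1" "h \<bullet> h = 1"
  shows "smooth_on (strip I) (\<lambda>p. 1 / norm (push \<gamma> h t\<^sub>0 t\<^sub>1 p))"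
proof (rule smooth_on_inverse[OF open_strip[OF assms(1)]])
  have pos: "0 < norm (push \<gamma> h t\<^sub>0 t\<^sub>1 p)" if "p \<in> strip I" for p
    by (rule push_nonzero[OF that assms(3,4)])
  show "smooth_on (strip I) (\<lambda>p. norm (push \<gamma> h t\<^sub>0 t\<^sub>1 p))"
    unfolding norm_eq_sqrt_inner
    using pos by (intro smooth_on_sqrt smooth_on_inner smooth_push open_strip assms(1,2)) (simp add: norm_eq_sqrt_inner)
qed (rule push_nonzero[OF _ assms(3,4)])

lemma smooth_vary_direction:
  assumes "open I" "smooth_on I \<gamma>" "\<And>t. t \<in> I \<Longrightarrow> snd (\<gamma> t) \<bullet> snd (\<gamma> t) = 1" "h \<bullet> h = 1"
  shows "smooth_on (strip I) (vary_direction \<gamma> h t\<^sub>0 t\<^sub>1)"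
  unfolding vary_direction_def
  by (intro smooth_on_Pair smooth_on_scaleR smooth_push_norm smooth_push smooth_on_strip smooth_on_fst
      smooth_on_strip[where f = "\<lambda>t. fst (\<gamma> t)"] open_strip assms)

lemma vary_direction_sphere:
  assumes "p \<in> strip I" "\<And>t. t \<in> I \<Longrightarrow> snd (\<gamma> t) \<bullet> snd (\<gamma> t) = 1" "h \<bullet> h = 1"
  shows "snd (vary_direction \<gamma> h t\<^sub>0 t\<^sub>1 p) \<bullet> snd (vary_direction \<gamma> h t\<^sub>0 t\<^sub>1 p) = 1"
  using push_nonzero[of p I \<gamma> h t\<^sub>0 t\<^sub>1, OF assms]
  by (simp add: vary_direction_def dot_square_norm power2_eq_square)

lemma vary_direction_zero:
  assumes "snd (\<gamma> t) \<bullet> snd (\<gamma> t) = 1" "\<epsilon> * bump t\<^sub>0 t\<^sub>1 t = 0"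
  shows "vary_direction \<gamma> h t\<^sub>0 t\<^sub>1 (\<epsilon>, t) = \<gamma> t"
  using assms by (simp only: vary_direction_def push_def snd_conv fst_conv) (simp add: norm_eq_sqrt_inner)

lemma vary_direction_deriv:
  assumes \<phi>: "snd (\<gamma> t) \<bullet> snd (\<gamma> t) = 1"
  shows "((\<lambda>\<epsilon>. vary_direction \<gamma> h t\<^sub>0 t\<^sub>1 (\<epsilon>, t)) has_vector_derivative
    (0, bump t\<^sub>0 t\<^sub>1 t *\<^sub>R (h - (snd (\<gamma> t) \<bullet> h) *\<^sub>R snd (\<gamma> t)))) (at 0)"
proof -
  define \<phi> b where "\<phi> = snd (\<gamma> t)" and "b = bump t\<^sub>0 t\<^sub>1 t"
  define u where "u \<epsilon> = \<phi> + (\<epsilon> * b) *\<^sub>R h" for \<epsilon> :: real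
  have u0: "u 0 = \<phi>" "norm \<phi> = 1" "\<phi> \<bullet> \<phi> = 1" using assms by (simp_all add: u_def \<phi>_def norm_eq_sqrt_inner)
  have u: "(u has_vector_derivative b *\<^sub>R h) (at 0)"
    unfolding u_def by (auto intro!: derivative_eq_intros simp: has_vector_derivative_def)
  have n: "((\<lambda>\<epsilon>. norm (u \<epsilon>)) has_real_derivative b * (\<phi> \<bullet> h)) (at 0)"
  proof -
    have "((\<lambda>\<epsilon>. u \<epsilon> \<bullet> u \<epsilon>) has_real_derivative 2 * (b * (\<phi> \<bullet> h))) (at 0)"
      using inner_has_derivative[OF u u] u0 by (simp add: inner_commute)
    from DERIV_chain2[OF DERIV_real_sqrt this] u0 show ?thesis
      by (simp add: norm_eq_sqrt_inner)
  qed
  have "((\<lambda>\<epsilon>. 1 / norm (u \<epsilon>)) has_real_derivative - (b * (\<phi> \<bullet> h))) (at 0)"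
    using DERIV_inverse_fun[OF n] u0 by (simp add: inverse_eq_divide)
  then have "((\<lambda>\<epsilon>. (1 / norm (u \<epsilon>)) *\<^sub>R u \<epsilon>) has_vector_derivative
      (1 / norm (u 0)) *\<^sub>R (b *\<^sub>R h) + (- (b * (\<phi> \<bullet> h))) *\<^sub>R u 0) (at 0)"
    by (intro has_vector_derivative_scaleR u)
  from has_vector_derivative_Pair[OF has_vector_derivative_const this, of "fst (\<gamma> t)"]
  have "((\<lambda>\<epsilon>. (fst (\<gamma> t), (1 / norm (u \<epsilon>)) *\<^sub>R u \<epsilon>)) has_vector_derivative
      (0, b *\<^sub>R (h - (\<phi> \<bullet> h) *\<^sub>R \<phi>))) (at 0)"
    using u0 by (simp add: algebra_simps)
  then show ?thesis
    by (simp only: vary_direction_def push_def u_def \<phi>_def b_def fst_conv snd_conv)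
qed

lemma derivative_of_constant:
  fixes f :: "real \<Rightarrow> real"
  assumes "open I" "t \<in> I" "\<And>s. s \<in> I \<Longrightarrow> f s = c" "(f has_real_derivative D) (at t)"
  shows "D = 0"
  using DERIV_unique[OF has_field_derivative_transform_within_open[OF assms(4,1,2), of "\<lambda>_. c"] DERIV_const] assms(3)
  by auto

locale warping =
  fixes a :: "real \<Rightarrow> real"
  assumes smooth_a: "smooth_on UNIV a" and a_pos: "\<And>s. 0 < a s"
begin

definition a' :: "real \<Rightarrow> real" where
  "a' s = vector_derivative a (at s)"

lemma a_deriv: "(a has_real_derivative a' s) (at s)"
  and smooth_a': "smooth_on UNIV a'"
  using smooth_on_vector_derivative[OF open_UNIV smooth_a]
  by (simp_all add: a'_def[abs_def] has_real_derivative_iff_has_vector_derivative)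

lemma a'_continuous: "continuous_on UNIV a'"
  by (rule smooth_on_continuous[OF smooth_a'])

text \<open>Here \<open>(w, \<psi>)\<close> is the velocity. The last condition is the equation for \<open>\<phi>\<close> in momentum form: the
  derivative of \<open>a \<phi>'\<close> has no tangential component, and its normal component is dictated by the sphere.\<close>

definition geodesic_eq :: "real set \<Rightarrow> (real \<Rightarrow> real \<times> 'b::real_inner) \<Rightarrow> (real \<Rightarrow> real) \<Rightarrow> (real \<Rightarrow> 'b) \<Rightarrow> bool" where
  "geodesic_eq I \<gamma> w \<psi> \<longleftrightarrow> (\<forall>t\<in>I.
     (\<gamma> has_vector_derivative (w t, \<psi> t)) (at t) \<and>
     (w has_real_derivative a' (fst (\<gamma> t)) / 2 * (\<psi> t \<bullet> \<psi> t)) (at t) \<and>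
     ((\<lambda>t. a (fst (\<gamma> t)) *\<^sub>R \<psi> t) has_vector_derivative (- (a (fst (\<gamma> t)) * (\<psi> t \<bullet> \<psi> t))) *\<^sub>R snd (\<gamma> t)) (at t))"

text \<open>The variations towards \<open>\<phi>(\<tau>)\<close> only show that the tangential part of \<open>(a \<phi>')'\<close> at time \<open>t\<close> is orthogonal to
  the vectors \<open>\<phi>(\<tau>)\<close>, \<open>\<tau> \<in> I\<close>. That is enough, without any density argument, because this tangential
  part is built from \<open>\<phi>\<close>, \<open>\<phi>'\<close> and \<open>\<phi>''\<close> and so lies in the closed span of the curve.\<close>

lemma euler_lagrange:
  fixes \<gamma> :: "real \<Rightarrow> real \<times> 'b::real_inner"
  assumes I: "open I" and \<gamma>: "smooth_on I \<gamma>" and unit: "\<And>t. t \<in> I \<Longrightarrow> snd (\<gamma> t) \<bullet> snd (\<gamma> t) = 1"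
    and geodesic: "geodesic P\<^sub>1 P\<^sub>2 (warped_metric a) I \<gamma>"
    and adm1: "\<And>t\<^sub>0 t\<^sub>1. P\<^sub>2 (strip I) (vary_radius \<gamma> t\<^sub>0 t\<^sub>1)"
    and adm2: "\<And>t\<^sub>0 t\<^sub>1 \<tau>. \<tau> \<in> I \<Longrightarrow> P\<^sub>2 (strip I) (vary_direction \<gamma> (snd (\<gamma> \<tau>)) t\<^sub>0 t\<^sub>1)"
  shows "\<exists>w \<psi>. geodesic_eq I \<gamma> w \<psi>"
proof -
  define v where "v t = vector_derivative \<gamma> (at t)" for t
  define q where "q t = (fst (v t), a (fst (\<gamma> t)) *\<^sub>R snd (v t))" for t
  define q' where "q' t = vector_derivative q (at t)" for t
  define \<phi> \<psi> p p' where "\<phi> t = snd (\<gamma> t)" and "\<psi> t = snd (v t)" and "p t = snd (q t)" and "p' t = snd (q' t)" for t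
  have smooth_v: "smooth_on I v" and v: "\<And>t. t \<in> I \<Longrightarrow> (\<gamma> has_vector_derivative v t) (at t)"
    using smooth_on_vector_derivative[OF I \<gamma>] by (simp_all add: v_def[abs_def])
  have "smooth_on I q"
    unfolding q_def
    by (intro smooth_on_Pair smooth_on_scaleR smooth_on_fst smooth_on_snd smooth_v I \<gamma>
        smooth_on_compose[OF smooth_a I open_UNIV subset_UNIV])
  then have smooth_q': "smooth_on I q'" and q': "\<And>t. t \<in> I \<Longrightarrow> (q has_vector_derivative q' t) (at t)"
    using smooth_on_vector_derivative[OF I] by (simp_all add: q'_def[abs_def])
  have cont: "continuous_on I \<gamma>" "continuous_on I v" "continuous_on I q'"
    using \<gamma> smooth_v smooth_q' by (simp_all add: smooth_on_continuous)
  have crit: "integral {t\<^sub>0..t\<^sub>1} (\<lambda>t. a' (fst (\<gamma> t)) / 2 * fst (\<xi> t) * (\<psi> t \<bullet> \<psi> t) - q' t \<bullet> \<xi> t) = 0"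
    if t01: "t\<^sub>0 < t\<^sub>1" "{t\<^sub>0..t\<^sub>1} \<subseteq> I" and \<Gamma>: "P\<^sub>2 (strip I) \<Gamma>" "smooth_on (strip I) \<Gamma>"
      and zero: "\<And>t. t \<in> I \<Longrightarrow> \<Gamma> (0, t) = \<gamma> t" and ends: "\<And>\<epsilon>. \<Gamma> (\<epsilon>, t\<^sub>0) = \<gamma> t\<^sub>0 \<and> \<Gamma> (\<epsilon>, t\<^sub>1) = \<gamma> t\<^sub>1"
      and \<xi>: "\<And>t. t \<in> I \<Longrightarrow> ((\<lambda>\<epsilon>. \<Gamma> (\<epsilon>, t)) has_vector_derivative \<xi> t) (at 0)"
    for t\<^sub>0 t\<^sub>1 \<Gamma> \<xi>
  proof -
    have "((\<lambda>\<epsilon>. energy (warped_metric a) t\<^sub>0 t\<^sub>1 (\<lambda>t. \<Gamma> (\<epsilon>, t))) has_real_derivative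
      integral {t\<^sub>0..t\<^sub>1} (\<lambda>t. a' (fst (\<Gamma> (0, t))) / 2 * fst (\<xi> t) * (snd (v t) \<bullet> snd (v t)) - q' t \<bullet> \<xi> t)) (at 0)"
    proof (rule first_variation[OF a_deriv a'_continuous t01, where \<delta> = "1/2"])
      show "((\<lambda>t. \<Gamma> (0, t)) has_vector_derivative v t) (at t)" if "t \<in> {t\<^sub>0..t\<^sub>1}" for t
        using that t01(2) zero v by (intro has_vector_derivative_transform_within_open[OF v I]) auto
      show "((\<lambda>t. (fst (v t), a (fst (\<Gamma> (0, t))) *\<^sub>R snd (v t))) has_vector_derivative q' t) (at t)" if "t \<in> {t\<^sub>0..t\<^sub>1}" for t
        using that t01(2) zero by (intro has_vector_derivative_transform_within_open[OF q' I]) (auto simp: q_def)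
      show "continuous_on {t\<^sub>0..t\<^sub>1} q'" using continuous_on_subset[OF cont(3) t01(2)] .
    qed (use \<Gamma> ends \<xi> t01 in auto)
    moreover have "((\<lambda>\<epsilon>. energy (warped_metric a) t\<^sub>0 t\<^sub>1 (\<lambda>t. \<Gamma> (\<epsilon>, t))) has_real_derivative 0) (at 0)"
      using geodesic[unfolded geodesic_def, THEN conjunct2, rule_format, of t\<^sub>0 t\<^sub>1 I "1/2" \<Gamma>] t01 I \<Gamma>(1) zero ends by auto
    ultimately have "integral {t\<^sub>0..t\<^sub>1} (\<lambda>t. a' (fst (\<Gamma> (0, t))) / 2 * fst (\<xi> t) * (snd (v t) \<bullet> snd (v t)) - q' t \<bullet> \<xi> t) = 0"
      by (rule DERIV_unique)
    moreover have "integral {t\<^sub>0..t\<^sub>1} (\<lambda>t. a' (fst (\<gamma> t)) / 2 * fst (\<xi> t) * (\<psi> t \<bullet> \<psi> t) - q' t \<bullet> \<xi> t) =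
        integral {t\<^sub>0..t\<^sub>1} (\<lambda>t. a' (fst (\<Gamma> (0, t))) / 2 * fst (\<xi> t) * (snd (v t) \<bullet> snd (v t)) - q' t \<bullet> \<xi> t)"
      using zero t01(2) by (intro integral_cong) (auto simp: \<psi>_def subset_iff)
    ultimately show ?thesis by simp
  qed
  have radial: "fst (q' t) = a' (fst (\<gamma> t)) / 2 * (\<psi> t \<bullet> \<psi> t)" if t: "t \<in> I" for t
  proof -
    have "a' (fst (\<gamma> t)) / 2 * (\<psi> t \<bullet> \<psi> t) - fst (q' t) = 0"
    proof (rule fundamental_lemma_bump[OF I _ t])
      show "continuous_on I (\<lambda>t. a' (fst (\<gamma> t)) / 2 * (\<psi> t \<bullet> \<psi> t) - fst (q' t))"
        unfolding \<psi>_def by (intro continuous_intros continuous_on_compose2[OF a'_continuous] cont) auto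
      fix t\<^sub>0 t\<^sub>1 assume t01: "t\<^sub>0 < t\<^sub>1" "{t\<^sub>0..t\<^sub>1} \<subseteq> I"
      have "integral {t\<^sub>0..t\<^sub>1} (\<lambda>t. a' (fst (\<gamma> t)) / 2 * fst (bump t\<^sub>0 t\<^sub>1 t, 0 :: 'b) * (\<psi> t \<bullet> \<psi> t) - q' t \<bullet> (bump t\<^sub>0 t\<^sub>1 t, 0)) = 0"
      proof (rule crit[OF t01 adm1 smooth_vary_radius[OF I \<gamma>]])
        show "((\<lambda>\<epsilon>. vary_radius \<gamma> t\<^sub>0 t\<^sub>1 (\<epsilon>, t)) has_vector_derivative (bump t\<^sub>0 t\<^sub>1 t, 0)) (at 0)" for t
          unfolding vary_radius_def split
          by (intro has_vector_derivative_Pair has_vector_derivative_const)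
            (auto intro!: derivative_eq_intros simp flip: has_real_derivative_iff_has_vector_derivative)
      qed (use bump_ends[OF t01(1)] in \<open>auto simp: vary_radius_def\<close>)
      then show "integral {t\<^sub>0..t\<^sub>1} (\<lambda>t. (a' (fst (\<gamma> t)) / 2 * (\<psi> t \<bullet> \<psi> t) - fst (q' t)) * bump t\<^sub>0 t\<^sub>1 t) = 0"
        by (simp add: inner_prod_def algebra_simps)
    qed
    then show ?thesis by simp
  qed
  have angular: "p' t \<bullet> (\<phi> \<tau> - (\<phi> t \<bullet> \<phi> \<tau>) *\<^sub>R \<phi> t) = 0" if t: "t \<in> I" "\<tau> \<in> I" for t \<tau>
  proof (rule fundamental_lemma_bump[OF I _ t(1)])
    show "continuous_on I (\<lambda>t. p' t \<bullet> (\<phi> \<tau> - (\<phi> t \<bullet> \<phi> \<tau>) *\<^sub>R \<phi> t))"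
      unfolding p'_def \<phi>_def by (intro continuous_intros cont)
    fix t\<^sub>0 t\<^sub>1 assume t01: "t\<^sub>0 < t\<^sub>1" "{t\<^sub>0..t\<^sub>1} \<subseteq> I"
    define \<xi> where "\<xi> t = (0 :: real, bump t\<^sub>0 t\<^sub>1 t *\<^sub>R (\<phi> \<tau> - (\<phi> t \<bullet> \<phi> \<tau>) *\<^sub>R \<phi> t))" for t
    have \<tau>: "snd (\<gamma> \<tau>) \<bullet> snd (\<gamma> \<tau>) = 1" by (rule unit[OF t(2)])
    have I01: "t\<^sub>0 \<in> I" "t\<^sub>1 \<in> I" using t01 by auto
    have "integral {t\<^sub>0..t\<^sub>1} (\<lambda>t. a' (fst (\<gamma> t)) / 2 * fst (\<xi> t) * (\<psi> t \<bullet> \<psi> t) - q' t \<bullet> \<xi> t) = 0"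
    proof (rule crit[OF t01 adm2[OF t(2)] smooth_vary_direction[OF I \<gamma> unit \<tau>]])
      show "((\<lambda>\<epsilon>. vary_direction \<gamma> (snd (\<gamma> \<tau>)) t\<^sub>0 t\<^sub>1 (\<epsilon>, t)) has_vector_derivative \<xi> t) (at 0)" if "t \<in> I" for t
        using vary_direction_deriv[of \<gamma> t, OF unit[OF that]] by (simp add: \<xi>_def \<phi>_def)
    qed (use bump_ends[OF t01(1)] I01 unit in \<open>auto intro!: vary_direction_zero\<close>)
    then have "integral {t\<^sub>0..t\<^sub>1} (\<lambda>t. - ((p' t \<bullet> (\<phi> \<tau> - (\<phi> t \<bullet> \<phi> \<tau>) *\<^sub>R \<phi> t)) * bump t\<^sub>0 t\<^sub>1 t)) = 0"
      by (simp add: inner_prod_def \<xi>_def p'_def mult.commute)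
    then show "integral {t\<^sub>0..t\<^sub>1} (\<lambda>t. p' t \<bullet> (\<phi> \<tau> - (\<phi> t \<bullet> \<phi> \<tau>) *\<^sub>R \<phi> t) * bump t\<^sub>0 t\<^sub>1 t) = 0"
      by simp
  qed
  have \<phi>': "(\<phi> has_vector_derivative \<psi> t) (at t)" and p': "(p has_vector_derivative p' t) (at t)" if "t \<in> I" for t
    using snd_has_derivative[OF v[OF that]] snd_has_derivative[OF q'[OF that]]
    by (simp_all add: \<phi>_def[abs_def] \<psi>_def p_def[abs_def] p'_def)
  have q1': "((\<lambda>t. fst (v t)) has_real_derivative fst (q' t)) (at t)" if "t \<in> I" for t
    using fst_has_derivative[OF q'[OF that]] by (simp add: q_def[abs_def])
  have p_eq: "p t = a (fst (\<gamma> t)) *\<^sub>R \<psi> t" for t by (simp add: p_def q_def \<psi>_def)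
  have force: "p' t = (- (a (fst (\<gamma> t)) * (\<psi> t \<bullet> \<psi> t))) *\<^sub>R \<phi> t" if t: "t \<in> I" for t
  proof -
    define R where "R = p' t - (p' t \<bullet> \<phi> t) *\<^sub>R \<phi> t"
    \<comment> \<open>The residual is orthogonal to the whole curve, hence to all of its derivatives, hence to itself.\<close>
    have R\<phi>: "R \<bullet> \<phi> \<tau> = 0" if "\<tau> \<in> I" for \<tau>
      using angular[OF t that] by (simp add: R_def inner_diff_left inner_diff_right)
    have "R \<bullet> \<psi> \<tau> = 0" if "\<tau> \<in> I" for \<tau>
      using derivative_of_constant[OF I that R\<phi> inner_has_derivative[OF has_vector_derivative_const \<phi>'[OF that]]] by simp
    then have Rp: "R \<bullet> p \<tau> = 0" if "\<tau> \<in> I" for \<tau> using that by (simp add: p_eq)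
    have "R \<bullet> p' t = 0"
      using derivative_of_constant[OF I t Rp inner_has_derivative[OF has_vector_derivative_const p'[OF t]]] by simp
    then have "R \<bullet> R = 0" using R\<phi>[OF t] by (subst (2) R_def) (simp add: inner_diff_right)
    then have R0: "p' t = (p' t \<bullet> \<phi> t) *\<^sub>R \<phi> t" by (simp add: R_def)
    have "\<phi> \<tau> \<bullet> \<psi> \<tau> = 0" if "\<tau> \<in> I" for \<tau>
      using derivative_of_constant[OF I that _ inner_has_derivative[OF \<phi>'[OF that] \<phi>'[OF that]], of 1] unit
      by (simp add: \<phi>_def inner_commute)
    then have "\<phi> \<tau> \<bullet> p \<tau> = 0" if "\<tau> \<in> I" for \<tau> using that by (simp add: p_eq)
    then have "\<phi> t \<bullet> p' t + \<psi> t \<bullet> p t = 0"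
      using derivative_of_constant[OF I t _ inner_has_derivative[OF \<phi>'[OF t] p'[OF t]]] by blast
    then have "p' t \<bullet> \<phi> t = - (a (fst (\<gamma> t)) * (\<psi> t \<bullet> \<psi> t))"
      by (simp add: p_eq inner_commute)
    with R0 show ?thesis by simp
  qed
  have "geodesic_eq I \<gamma> (\<lambda>t. fst (v t)) \<psi>"
    unfolding geodesic_eq_def
  proof (intro ballI conjI)
    fix t assume t: "t \<in> I"
    show "(\<gamma> has_vector_derivative (fst (v t), \<psi> t)) (at t)" using v[OF t] by (simp add: \<psi>_def)
    show "((\<lambda>t. fst (v t)) has_real_derivative a' (fst (\<gamma> t)) / 2 * (\<psi> t \<bullet> \<psi> t)) (at t)"
      using q1'[OF t] radial[OF t] by simp
    show "((\<lambda>t. a (fst (\<gamma> t)) *\<^sub>R \<psi> t) has_vector_derivative (- (a (fst (\<gamma> t)) * (\<psi> t \<bullet> \<psi> t))) *\<^sub>R snd (\<gamma> t)) (at t)"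
      using p'[OF t] force[OF t] by (simp add: p_eq[abs_def] \<phi>_def)
  qed
  then show ?thesis by blast
qed

end

section \<open>Geodesics and their extension\<close>

lemma constant_on_interval:
  fixes f :: "real \<Rightarrow> real"
  assumes "is_interval I" "t\<^sub>0 \<in> I" "t \<in> I" "\<And>t. t \<in> I \<Longrightarrow> (f has_real_derivative 0) (at t)"
  shows "f t = f t\<^sub>0"
proof -
  have "\<exists>k. \<forall>t\<in>I. f t = k"
    using assms(1,4) by (intro has_field_derivative_zero_constant) (auto simp: is_interval_convex_1 intro: DERIV_subset)
  then show ?thesis using assms(2,3) by auto
qed

lemma rotating_frame:
  fixes e\<^sub>1 e\<^sub>2 :: "'b::real_normed_vector"
  assumes "(\<theta> has_real_derivative k) (at t)"
  shows "((\<lambda>t. cos (\<theta> t) *\<^sub>R e\<^sub>1 + sin (\<theta> t) *\<^sub>R e\<^sub>2) has_vector_derivative k *\<^sub>R (cos (\<theta> t) *\<^sub>R e\<^sub>2 - sin (\<theta> t) *\<^sub>R e\<^sub>1)) (at t)"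
    and "((\<lambda>t. cos (\<theta> t) *\<^sub>R e\<^sub>2 - sin (\<theta> t) *\<^sub>R e\<^sub>1) has_vector_derivative (- k) *\<^sub>R (cos (\<theta> t) *\<^sub>R e\<^sub>1 + sin (\<theta> t) *\<^sub>R e\<^sub>2)) (at t)"
proof -
  have trig: "((\<lambda>t. cos (\<theta> t)) has_real_derivative - sin (\<theta> t) * k) (at t)"
    "((\<lambda>t. sin (\<theta> t)) has_real_derivative cos (\<theta> t) * k) (at t)"
    by (auto intro!: derivative_eq_intros assms)
  note scaled = has_vector_derivative_scaleR[OF trig(1) has_vector_derivative_const]
    has_vector_derivative_scaleR[OF trig(2) has_vector_derivative_const]
  show "((\<lambda>t. cos (\<theta> t) *\<^sub>R e\<^sub>1 + sin (\<theta> t) *\<^sub>R e\<^sub>2) has_vector_derivative k *\<^sub>R (cos (\<theta> t) *\<^sub>R e\<^sub>2 - sin (\<theta> t) *\<^sub>R e\<^sub>1)) (at t)"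
    by (rule has_vector_derivative_eq_rhs[OF has_vector_derivative_add[OF scaled(1) scaled(2)]]) (simp add: algebra_simps)
  show "((\<lambda>t. cos (\<theta> t) *\<^sub>R e\<^sub>2 - sin (\<theta> t) *\<^sub>R e\<^sub>1) has_vector_derivative (- k) *\<^sub>R (cos (\<theta> t) *\<^sub>R e\<^sub>1 + sin (\<theta> t) *\<^sub>R e\<^sub>2)) (at t)"
    by (rule has_vector_derivative_eq_rhs[OF has_vector_derivative_diff[OF scaled(1) scaled(2)]]) (simp add: algebra_simps)
qed

context warping
begin

text \<open>A geodesic sweeps out a great circle at the angular speed \<open>L / a\<close>, where \<open>L = a \<bar>\<phi>'\<bar>\<close> is its conserved
  angular momentum. What remains is the motion of the radial coordinate in the potential
  \<open>L\<^sup>2 / (2 a)\<close>, which is nonnegative, so that it exists for all times.\<close>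

lemma geodesic_eq_explicit:
  fixes \<gamma> :: "real \<Rightarrow> real \<times> 'b::real_inner"
  assumes I: "open I" "is_interval I" "t\<^sub>0 \<in> I" and unit: "\<And>t. t \<in> I \<Longrightarrow> snd (\<gamma> t) \<bullet> snd (\<gamma> t) = 1"
    and eq: "geodesic_eq I \<gamma> w \<psi>"
  obtains x y \<theta> e L where
    "\<And>t. (x has_real_derivative y t) (at t)"
    "\<And>t. (y has_real_derivative L\<^sup>2 * a' (x t) / (2 * (a (x t))\<^sup>2)) (at t)"
    "\<And>t. (\<theta> has_real_derivative L / a (x t)) (at t)"
    "smooth_on UNIV x" "smooth_on UNIV \<theta>"
    "\<And>t. t \<in> I \<Longrightarrow> \<gamma> t = (x t, cos (\<theta> t) *\<^sub>R snd (\<gamma> t\<^sub>0) + sin (\<theta> t) *\<^sub>R e)"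
    "L = 0 \<and> e = 0 \<and> (\<forall>t. \<theta> t = 0) \<or> L > 0 \<and> e \<bullet> e = 1 \<and> snd (\<gamma> t\<^sub>0) \<bullet> e = 0 \<and> (\<exists>t\<in>I. sin (\<theta> t) \<noteq> 0)"
proof -
  define s \<phi> p where "s t = fst (\<gamma> t)" and "\<phi> t = snd (\<gamma> t)" and "p t = a (s t) *\<^sub>R \<psi> t" for t
  have s': "(s has_real_derivative w t) (at t)" and \<phi>': "(\<phi> has_vector_derivative \<psi> t) (at t)"
    and w': "(w has_real_derivative a' (s t) / 2 * (\<psi> t \<bullet> \<psi> t)) (at t)"
    and p': "(p has_vector_derivative (- (a (s t) * (\<psi> t \<bullet> \<psi> t))) *\<^sub>R \<phi> t) (at t)" if "t \<in> I" for t
  proof -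
    have \<gamma>': "(\<gamma> has_vector_derivative (w t, \<psi> t)) (at t)"
      using eq that by (simp add: geodesic_eq_def)
    show "(s has_real_derivative w t) (at t)" "(\<phi> has_vector_derivative \<psi> t) (at t)"
      using fst_has_derivative[OF \<gamma>'] snd_has_derivative[OF \<gamma>']
      by (simp_all add: s_def[abs_def] \<phi>_def[abs_def])
    show "(w has_real_derivative a' (s t) / 2 * (\<psi> t \<bullet> \<psi> t)) (at t)"
      "(p has_vector_derivative (- (a (s t) * (\<psi> t \<bullet> \<psi> t))) *\<^sub>R \<phi> t) (at t)"
      using eq that by (simp_all add: geodesic_eq_def s_def[abs_def] \<phi>_def p_def[abs_def])
  qed
  have \<phi>\<phi>: "\<phi> t \<bullet> \<phi> t = 1" if "t \<in> I" for t using unit[OF that] by (simp add: \<phi>_def)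
  have \<phi>\<psi>: "\<phi> t \<bullet> \<psi> t = 0" if "t \<in> I" for t
    using derivative_of_constant[OF I(1) that \<phi>\<phi> inner_has_derivative[OF \<phi>'[OF that] \<phi>'[OF that]]]
    by (simp add: inner_commute)
  define L where "L = norm (p t\<^sub>0)"
  have pp: "p t \<bullet> p t = L\<^sup>2" if t: "t \<in> I" for t
  proof -
    have "((\<lambda>t. p t \<bullet> p t) has_real_derivative 0) (at t)" if "t \<in> I" for t
      using inner_has_derivative[OF p'[OF that] p'[OF that]] \<phi>\<psi>[OF that]
      by (simp add: p_def inner_commute)
    from constant_on_interval[OF I(2,3) t this] show ?thesis
      by (simp add: L_def power2_norm_eq_inner)
  qed
  have \<psi>\<psi>: "\<psi> t \<bullet> \<psi> t = L\<^sup>2 / (a (s t))\<^sup>2" if "t \<in> I" for t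
    using pp[OF that] a_pos[of "s t"] by (simp add: p_def field_simps power2_eq_square)
  define F where "F r = L\<^sup>2 * a' r / (2 * (a r)\<^sup>2)" for r
  define V where "V r = L\<^sup>2 / (2 * a r)" for r
  have "smooth_on UNIV (\<lambda>r. (L\<^sup>2 / 2) * (a' r * ((1 / a r) * (1 / a r))))"
    by (intro smooth_on_mult smooth_on_const smooth_a' smooth_on_inverse smooth_a a_pos open_UNIV)
  moreover have "(\<lambda>r. (L\<^sup>2 / 2) * (a' r * ((1 / a r) * (1 / a r)))) = F"
    by (simp add: F_def[abs_def] power2_eq_square)
  ultimately have smooth_F: "smooth_on UNIV F" by simp
  define F' where "F' r = vector_derivative F (at r)" for r
  have F': "(F has_real_derivative F' r) (at r)" "continuous_on UNIV F'" for r
    using smooth_on_vector_derivative[OF open_UNIV smooth_F] smooth_on_continuous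
    by (auto simp: F'_def[abs_def] has_real_derivative_iff_has_vector_derivative)
  have V': "(V has_real_derivative - F r) (at r)" "0 \<le> V r" for r
  proof -
    have "((\<lambda>r. L\<^sup>2 / (2 * a r)) has_real_derivative - F r) (at r)"
      using a_pos[of r] by (auto intro!: derivative_eq_intros a_deriv simp: F_def field_simps power2_eq_square)
    then show "(V has_real_derivative - F r) (at r)" by (simp add: V_def[abs_def])
    show "0 \<le> V r" using a_pos[of r] by (simp add: V_def)
  qed
  obtain x y where xy: "x t\<^sub>0 = s t\<^sub>0" "y t\<^sub>0 = w t\<^sub>0"
      "\<And>t. (x has_real_derivative y t) (at t)" "\<And>t. (y has_real_derivative F (x t)) (at t)"
    using conservative_global[OF F' V', of t\<^sub>0 "s t\<^sub>0" "w t\<^sub>0"] by blast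
  have xs: "x t = s t" if t: "t \<in> I" for t
  proof -
    have "(w has_real_derivative F (s t)) (at t)" if "t \<in> I" for t
      using w'[OF that] \<psi>\<psi>[OF that] by (simp add: F_def mult.commute)
    then show ?thesis
      using conservative_unique[OF F' I(2,3) t, of x y s w] xy s' by blast
  qed
  have "smooth_on UNIV (\<lambda>t. (x t, y t))"
  proof (rule smooth_on_bootstrap)
    show "smooth_on UNIV (\<lambda>z. (snd z, F (fst z)))"
      by (intro smooth_on_Pair smooth_on_snd smooth_on_ident open_UNIV smooth_on_compose[OF smooth_F]
          smooth_on_fst subset_UNIV)
    show "((\<lambda>t. (x t, y t)) has_vector_derivative (snd (x t, y t), F (fst (x t, y t)))) (at t)" for t
      using xy(3,4)[of t] by (auto intro!: has_vector_derivative_Pair simp: has_real_derivative_iff_has_vector_derivative)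
  qed auto
  then have smooth_x: "smooth_on UNIV x"
    using smooth_on_fst[OF open_UNIV] by fastforce
  have smooth_rate: "smooth_on UNIV (\<lambda>t. L / a (x t))"
  proof -
    have "smooth_on UNIV (\<lambda>t. L * (1 / a (x t)))"
      by (intro smooth_on_mult smooth_on_const smooth_on_inverse a_pos open_UNIV
          smooth_on_compose[OF smooth_a] smooth_x subset_UNIV)
    then show ?thesis by simp
  qed
  obtain \<theta> where \<theta>: "\<theta> t\<^sub>0 = 0" "\<And>t. (\<theta> has_vector_derivative L / a (x t)) (at t)"
    using antiderivative_exists[OF smooth_on_continuous[OF smooth_rate], of t\<^sub>0 0] by blast
  then have \<theta>': "(\<theta> has_real_derivative L / a (x t)) (at t)" for t
    by (simp add: has_real_derivative_iff_has_vector_derivative)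
  have smooth_\<theta>: "smooth_on UNIV \<theta>"
    by (rule smooth_on_antiderivative[OF open_UNIV \<theta>(2) smooth_rate])
  define e where "e = (1 / L) *\<^sub>R p t\<^sub>0"
  have Le: "L *\<^sub>R e = p t\<^sub>0" by (auto simp: e_def L_def)
  define c where "c t = cos (\<theta> t) *\<^sub>R \<phi> t\<^sub>0 + sin (\<theta> t) *\<^sub>R e" for t
  define d where "d t = cos (\<theta> t) *\<^sub>R e - sin (\<theta> t) *\<^sub>R \<phi> t\<^sub>0" for t
  have c': "(c has_vector_derivative (L / a (x t)) *\<^sub>R d t) (at t)"
    and d': "(d has_vector_derivative (- (L / a (x t))) *\<^sub>R c t) (at t)" for t
    unfolding c_def d_def by (rule rotating_frame[OF \<theta>'])+
  have c0: "c t\<^sub>0 = \<phi> t\<^sub>0" "d t\<^sub>0 = e" by (simp_all add: c_def d_def \<theta>(1))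
  \<comment> \<open>Both \<open>(\<phi>, p)\<close> and \<open>(c, L d)\<close> solve the rotation equation \<open>\<phi>' = p / a\<close>, \<open>p' = - (L\<^sup>2 / a) \<phi>\<close>,
    which preserves \<open>L\<^sup>2 \<bar>\<phi>\<bar>\<^sup>2 + \<bar>p\<bar>\<^sup>2\<close>.\<close>
  have \<phi>'2: "(\<phi> has_vector_derivative (1 / a (s t)) *\<^sub>R p t) (at t)"
    and p'2: "(p has_vector_derivative (- (L\<^sup>2 / a (s t))) *\<^sub>R \<phi> t) (at t)" if "t \<in> I" for t
    using \<phi>'[OF that] p'[OF that] \<psi>\<psi>[OF that] a_pos[of "s t"]
    by (simp_all add: p_def power2_eq_square)
  have same_p: "p t = L *\<^sub>R d t" if t: "t \<in> I" for t
  proof -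
    define f where "f t = L\<^sup>2 * ((\<phi> t - c t) \<bullet> (\<phi> t - c t)) + (p t - L *\<^sub>R d t) \<bullet> (p t - L *\<^sub>R d t)" for t
    have "f t = f t\<^sub>0"
    proof (rule constant_on_interval[OF I(2,3) t])
      fix t assume t: "t \<in> I"
      define k where "k = 1 / a (s t)"
      have D1: "((\<lambda>t. \<phi> t - c t) has_vector_derivative k *\<^sub>R (p t - L *\<^sub>R d t)) (at t)"
        using has_vector_derivative_diff[OF \<phi>'2[OF t] c'[of t]] xs[OF t] by (simp add: k_def algebra_simps)
      have D2: "((\<lambda>t. p t - L *\<^sub>R d t) has_vector_derivative (- (L\<^sup>2 * k)) *\<^sub>R (\<phi> t - c t)) (at t)"
        using has_vector_derivative_diff[OF p'2[OF t]
            bounded_linear.has_vector_derivative[OF bounded_linear_scaleR_right d'[of t], of L]] xs[OF t]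
        by (simp add: k_def algebra_simps power2_eq_square)
      show "(f has_real_derivative 0) (at t)"
        unfolding f_def
        by (rule DERIV_cong[OF DERIV_add[OF DERIV_cmult[OF inner_has_derivative[OF D1 D1]] inner_has_derivative[OF D2 D2]]])
          (simp add: inner_commute)
    qed
    then have "f t = 0" using c0 Le by (simp add: f_def)
    moreover have "0 \<le> L\<^sup>2 * ((\<phi> t - c t) \<bullet> (\<phi> t - c t))" by simp
    ultimately have "(p t - L *\<^sub>R d t) \<bullet> (p t - L *\<^sub>R d t) \<le> 0" unfolding f_def by linarith
    then show ?thesis by (metis inner_eq_zero_iff inner_ge_zero order_antisym right_minus_eq)
  qed
  have same_\<phi>: "\<phi> t = c t" if t: "t \<in> I" for t
  proof -
    define f where "f t = (\<phi> t - c t) \<bullet> (\<phi> t - c t)" for t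
    have "f t = f t\<^sub>0"
    proof (rule constant_on_interval[OF I(2,3) t])
      fix t assume t: "t \<in> I"
      have "((\<lambda>t. \<phi> t - c t) has_vector_derivative 0) (at t)"
        using has_vector_derivative_diff[OF \<phi>'2[OF t] c'[of t]] xs[OF t] same_p[OF t] by simp
      from inner_has_derivative[OF this this] show "(f has_real_derivative 0) (at t)"
        by (simp add: f_def[abs_def])
    qed
    then show ?thesis using c0 by (simp add: f_def)
  qed
  have "L = 0 \<and> e = 0 \<and> (\<forall>t. \<theta> t = 0) \<or> L > 0 \<and> e \<bullet> e = 1 \<and> snd (\<gamma> t\<^sub>0) \<bullet> e = 0 \<and> (\<exists>t\<in>I. sin (\<theta> t) \<noteq> 0)"
  proof (cases "L = 0")
    case True
    have "\<theta> t = \<theta> t\<^sub>0" for t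
      using DERIV_isconst_all[of \<theta>] \<theta>' True by simp
    then show ?thesis using True \<theta>(1) by (simp add: e_def)
  next
    case False
    then have L: "0 < L" by (simp add: L_def)
    have "e \<bullet> e = 1" using pp[OF I(3)] L by (simp add: e_def power2_eq_square field_simps)
    moreover have "snd (\<gamma> t\<^sub>0) \<bullet> e = 0" using \<phi>\<psi>[OF I(3)] by (simp add: e_def p_def \<phi>_def)
    moreover have "\<exists>t\<in>I. sin (\<theta> t) \<noteq> 0"
    proof -
      have "(\<theta> \<longlongrightarrow> 0) (at t\<^sub>0)"
        using isContD[OF DERIV_isCont[OF \<theta>'[of t\<^sub>0]]] \<theta>(1) by simp
      then have "\<forall>\<^sub>F t in at t\<^sub>0. \<theta> t < pi"
        by (rule order_tendstoD) simp
      then have "\<forall>\<^sub>F t in at_right t\<^sub>0. \<theta> t < pi" by (simp add: eventually_at_split)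
      moreover have "\<forall>\<^sub>F t in at_right t\<^sub>0. t \<in> I"
        using topological_tendstoD[OF tendsto_ident_at I(1,3)] .
      ultimately have "\<forall>\<^sub>F t in at_right t\<^sub>0. t \<in> I \<and> \<theta> t < pi \<and> t\<^sub>0 < t"
        using eventually_at_right_less[of t\<^sub>0] by eventually_elim auto
      then obtain t where t: "t \<in> I" "\<theta> t < pi" "t\<^sub>0 < t"
        using eventually_happens[of _ "at_right t\<^sub>0"] trivial_limit_at_right_real by blast
      have "\<theta> t\<^sub>0 < \<theta> t"
        using \<theta>' L a_pos by (intro DERIV_pos_imp_increasing[OF t(3)]) (blast intro: divide_pos_pos)
      then show ?thesis using t \<theta>(1) sin_gt_zero[of "\<theta> t"] by (intro bexI[of _ t]) auto
    qed
    ultimately show ?thesis using L by simp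
  qed
  moreover have "\<gamma> t = (x t, cos (\<theta> t) *\<^sub>R snd (\<gamma> t\<^sub>0) + sin (\<theta> t) *\<^sub>R e)" if "t \<in> I" for t
    using xs[OF that] same_\<phi>[OF that] by (simp add: prod_eq_iff s_def \<phi>_def c_def)
  ultimately show thesis
    using xy(3,4) \<theta>' smooth_x smooth_\<theta> by (intro that[of x y L \<theta> e]) (simp_all add: F_def)
qed

lemma explicit_geodesic_eq:
  fixes e\<^sub>1 e\<^sub>2 :: "'b::real_inner"
  assumes x: "\<And>t. (x has_real_derivative y t) (at t)"
    and y: "\<And>t. (y has_real_derivative L\<^sup>2 * a' (x t) / (2 * (a (x t))\<^sup>2)) (at t)"
    and \<theta>: "\<And>t. (\<theta> has_real_derivative L / a (x t)) (at t)"
    and e: "e\<^sub>1 \<bullet> e\<^sub>1 = 1" "L = 0 \<or> e\<^sub>2 \<bullet> e\<^sub>2 = 1 \<and> e\<^sub>1 \<bullet> e\<^sub>2 = 0"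
  shows "\<exists>w \<psi>. geodesic_eq UNIV (\<lambda>t. (x t, cos (\<theta> t) *\<^sub>R e\<^sub>1 + sin (\<theta> t) *\<^sub>R e\<^sub>2)) w \<psi>"
proof -
  define d where "d t = cos (\<theta> t) *\<^sub>R e\<^sub>2 - sin (\<theta> t) *\<^sub>R e\<^sub>1" for t
  define c where "c t = cos (\<theta> t) *\<^sub>R e\<^sub>1 + sin (\<theta> t) *\<^sub>R e\<^sub>2" for t
  define \<psi> where "\<psi> t = (L / a (x t)) *\<^sub>R d t" for t
  have c': "(c has_vector_derivative (L / a (x t)) *\<^sub>R d t) (at t)"
    and d': "(d has_vector_derivative (- (L / a (x t))) *\<^sub>R c t) (at t)" for t
    unfolding c_def d_def by (rule rotating_frame[OF \<theta>])+
  have dd: "L\<^sup>2 * (d t \<bullet> d t) = L\<^sup>2" for t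
  proof (cases "L = 0")
    case False
    then have "d t \<bullet> d t = (cos (\<theta> t))\<^sup>2 + (sin (\<theta> t))\<^sup>2"
      using e by (simp add: d_def inner_diff_left inner_diff_right inner_commute power2_eq_square)
    then show ?thesis by simp
  qed simp
  have \<psi>\<psi>: "\<psi> t \<bullet> \<psi> t = L\<^sup>2 / (a (x t))\<^sup>2" for t
  proof -
    have "\<psi> t \<bullet> \<psi> t = (L\<^sup>2 * (d t \<bullet> d t)) / (a (x t))\<^sup>2"
      by (simp add: \<psi>_def power2_eq_square)
    then show ?thesis by (simp only: dd)
  qed
  have "geodesic_eq UNIV (\<lambda>t. (x t, c t)) y \<psi>"
    unfolding geodesic_eq_def
  proof (intro ballI conjI)
    fix t
    show "((\<lambda>t. (x t, c t)) has_vector_derivative (y t, \<psi> t)) (at t)"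
      using x c' by (auto intro!: has_vector_derivative_Pair simp: \<psi>_def has_real_derivative_iff_has_vector_derivative)
    show "(y has_real_derivative a' (fst (x t, c t)) / 2 * (\<psi> t \<bullet> \<psi> t)) (at t)"
      using y[of t] by (simp add: \<psi>\<psi> mult.commute)
    have "a (x t) *\<^sub>R \<psi> t = L *\<^sub>R d t" for t
      using a_pos[of "x t"] by (simp add: \<psi>_def)
    then show "((\<lambda>t. a (fst (x t, c t)) *\<^sub>R \<psi> t) has_vector_derivative (- (a (fst (x t, c t)) * (\<psi> t \<bullet> \<psi> t))) *\<^sub>R snd (x t, c t)) (at t)"
      using bounded_linear.has_vector_derivative[OF bounded_linear_scaleR_right d'[of t], of L] a_pos[of "x t"]
      by (simp add: \<psi>\<psi> power2_eq_square)
  qed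
  then show ?thesis unfolding c_def by blast
qed

text \<open>In the first variation the force on \<open>\<phi>\<close> is a multiple of \<open>\<phi>\<close>, hence orthogonal to every variation
  field tangent to the sphere. The variation agrees with \<open>\<gamma>\<close> only on \<open>[t\<^sub>0, t\<^sub>1]\<close>, so the equation is used
  in the interior, which suffices for the integral.\<close>

lemma geodesic_eq_critical:
  fixes \<gamma> :: "real \<Rightarrow> real \<times> 'b::real_inner"
  assumes eq: "geodesic_eq I \<gamma> w \<psi>"
    and t01: "t\<^sub>0 < t\<^sub>1" "{t\<^sub>0..t\<^sub>1} \<subseteq> I" and J: "{t\<^sub>0..t\<^sub>1} \<subseteq> J" "open J" and \<delta>: "0 < \<delta>"
    and \<Gamma>: "smooth_on ({-\<delta><..<\<delta>} \<times> J) \<Gamma>" "\<And>p. p \<in> {-\<delta><..<\<delta>} \<times> J \<Longrightarrow> snd (\<Gamma> p) \<bullet> snd (\<Gamma> p) = 1"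
    and zero: "\<And>t. t \<in> {t\<^sub>0..t\<^sub>1} \<Longrightarrow> \<Gamma> (0, t) = \<gamma> t"
    and ends: "\<And>\<epsilon>. \<epsilon> \<in> {-\<delta><..<\<delta>} \<Longrightarrow> \<Gamma> (\<epsilon>, t\<^sub>0) = \<gamma> t\<^sub>0 \<and> \<Gamma> (\<epsilon>, t\<^sub>1) = \<gamma> t\<^sub>1"
  shows "((\<lambda>\<epsilon>. energy (warped_metric a) t\<^sub>0 t\<^sub>1 (\<lambda>t. \<Gamma> (\<epsilon>, t))) has_real_derivative 0) (at 0)"
proof -
  define \<eta> where "\<eta> t = \<Gamma> (0, t)" for t
  define v where "v t = vector_derivative \<eta> (at t)" for t
  define q where "q t = (fst (v t), a (fst (\<eta> t)) *\<^sub>R snd (v t))" for t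
  define q' where "q' t = vector_derivative q (at t)" for t
  define \<xi> where "\<xi> t = frechet_derivative \<Gamma> (at (0, t)) (1, 0)" for t
  have B: "open ({-\<delta><..<\<delta>} \<times> J)" "0 \<in> {-\<delta><..<\<delta>}" using J(2) \<delta> by (auto intro: open_Times)
  have smooth_\<eta>: "smooth_on J \<eta>"
    unfolding \<eta>_def using B
    by (intro smooth_on_compose[OF \<Gamma>(1) J(2) B(1)] smooth_on_Pair smooth_on_const smooth_on_ident J) auto
  have smooth_v: "smooth_on J v" and v: "\<And>t. t \<in> J \<Longrightarrow> (\<eta> has_vector_derivative v t) (at t)"
    using smooth_on_vector_derivative[OF J(2) smooth_\<eta>] by (simp_all add: v_def[abs_def])
  have "smooth_on J q"
    unfolding q_def
    by (intro smooth_on_Pair smooth_on_scaleR smooth_on_fst smooth_on_snd smooth_v J smooth_\<eta>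
        smooth_on_compose[OF smooth_a J(2) open_UNIV subset_UNIV])
  then have smooth_q': "smooth_on J q'" and q': "\<And>t. t \<in> J \<Longrightarrow> (q has_vector_derivative q' t) (at t)"
    using smooth_on_vector_derivative[OF J(2)] by (simp_all add: q'_def[abs_def])
  have \<xi>: "((\<lambda>\<epsilon>. \<Gamma> (\<epsilon>, t)) has_vector_derivative \<xi> t) (at 0)" if "t \<in> J" for t
    unfolding \<xi>_def by (rule smooth_on_partial(1)[OF \<Gamma>(1)]) (use that \<delta> in auto)
  have "((\<lambda>\<epsilon>. energy (warped_metric a) t\<^sub>0 t\<^sub>1 (\<lambda>t. \<Gamma> (\<epsilon>, t))) has_real_derivative
      integral {t\<^sub>0..t\<^sub>1} (\<lambda>t. a' (fst (\<Gamma> (0, t))) / 2 * fst (\<xi> t) * (snd (v t) \<bullet> snd (v t)) - q' t \<bullet> \<xi> t)) (at 0)"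
  proof (rule first_variation[OF a_deriv a'_continuous t01(1) J(1) \<delta> \<Gamma>(1) ends])
    show "((\<lambda>t. \<Gamma> (0, t)) has_vector_derivative v t) (at t)" if "t \<in> {t\<^sub>0..t\<^sub>1}" for t
      using v[of t] that J(1) by (auto simp: \<eta>_def[abs_def])
    show "((\<lambda>t. (fst (v t), a (fst (\<Gamma> (0, t))) *\<^sub>R snd (v t))) has_vector_derivative q' t) (at t)" if "t \<in> {t\<^sub>0..t\<^sub>1}" for t
      using q'[of t] that J(1) by (auto simp: q_def[abs_def] \<eta>_def)
    show "continuous_on {t\<^sub>0..t\<^sub>1} q'"
      by (rule continuous_on_subset[OF smooth_on_continuous[OF smooth_q'] J(1)])
  qed (use \<xi> J(1) in auto)
  moreover have "integral {t\<^sub>0..t\<^sub>1} (\<lambda>t. a' (fst (\<Gamma> (0, t))) / 2 * fst (\<xi> t) * (snd (v t) \<bullet> snd (v t)) - q' t \<bullet> \<xi> t) = 0"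
  proof -
    have "a' (fst (\<Gamma> (0, t))) / 2 * fst (\<xi> t) * (snd (v t) \<bullet> snd (v t)) - q' t \<bullet> \<xi> t = 0" if t: "t \<in> {t\<^sub>0<..<t\<^sub>1}" for t
    proof -
      have tJ: "t \<in> J" "t \<in> I" using t J(1) t01 by auto
      have near: "\<eta> s = \<gamma> s" if "s \<in> {t\<^sub>0<..<t\<^sub>1}" for s using zero that by (simp add: \<eta>_def)
      have v_eq: "v s = (w s, \<psi> s)" if s: "s \<in> {t\<^sub>0<..<t\<^sub>1}" for s
      proof (rule vector_derivative_unique_at)
        show "(\<eta> has_vector_derivative v s) (at s)" using s by (intro v subsetD[OF J(1)]) auto
        show "(\<eta> has_vector_derivative (w s, \<psi> s)) (at s)"
        proof (rule has_vector_derivative_transform_within_open[OF _ open_greaterThanLessThan s])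
          have "s \<in> I" using s t01 by auto
          then show "(\<gamma> has_vector_derivative (w s, \<psi> s)) (at s)" using eq by (simp add: geodesic_eq_def)
        qed (simp add: near)
      qed
      have "q' t = (a' (fst (\<gamma> t)) / 2 * (\<psi> t \<bullet> \<psi> t), (- (a (fst (\<gamma> t)) * (\<psi> t \<bullet> \<psi> t))) *\<^sub>R snd (\<gamma> t))"
      proof (rule vector_derivative_unique_at)
        show "(q has_vector_derivative q' t) (at t)" using q' tJ by simp
        have "((\<lambda>t. (w t, a (fst (\<gamma> t)) *\<^sub>R \<psi> t)) has_vector_derivative
            (a' (fst (\<gamma> t)) / 2 * (\<psi> t \<bullet> \<psi> t), (- (a (fst (\<gamma> t)) * (\<psi> t \<bullet> \<psi> t))) *\<^sub>R snd (\<gamma> t))) (at t)"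
          using eq tJ by (intro has_vector_derivative_Pair) (auto simp: geodesic_eq_def has_real_derivative_iff_has_vector_derivative)
        then show "(q has_vector_derivative (a' (fst (\<gamma> t)) / 2 * (\<psi> t \<bullet> \<psi> t), (- (a (fst (\<gamma> t)) * (\<psi> t \<bullet> \<psi> t))) *\<^sub>R snd (\<gamma> t))) (at t)"
          by (rule has_vector_derivative_transform_within_open[OF _ open_greaterThanLessThan t]) (simp add: q_def v_eq near)
      qed
      moreover have "snd (\<gamma> t) \<bullet> snd (\<xi> t) = 0"
      proof -
        have "((\<lambda>\<epsilon>. snd (\<Gamma> (\<epsilon>, t))) has_vector_derivative snd (\<xi> t)) (at 0)"
          by (rule snd_has_derivative[OF \<xi>[OF tJ(1)]])
        from derivative_of_constant[OF open_greaterThanLessThan B(2) _ inner_has_derivative[OF this this], of 1]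
        show ?thesis using \<Gamma>(2) tJ(1) near[OF t] by (simp add: \<eta>_def inner_commute)
      qed
      ultimately show ?thesis
        using near[OF t] v_eq[OF t] by (simp add: \<eta>_def inner_prod_def)
    qed
    then have "((\<lambda>t. a' (fst (\<Gamma> (0, t))) / 2 * fst (\<xi> t) * (snd (v t) \<bullet> snd (v t)) - q' t \<bullet> \<xi> t) has_integral 0) {t\<^sub>0..t\<^sub>1}"
      by (intro has_integral_spike_finite[OF _ _ has_integral_0, of "{t\<^sub>0, t\<^sub>1}"]) auto
    then show ?thesis by (rule integral_unique)
  qed
  ultimately show ?thesis by simp
qed

text \<open>A great circle is spanned by two positions of the curve, so that the second axis \<open>e\<close> is a linear
  combination of positions. Hence nothing has to be known about the velocities of a curve in order to
  extend it within the given class.\<close>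

theorem geodesically_completeI:
  fixes P\<^sub>1 :: "real set \<Rightarrow> (real \<Rightarrow> real \<times> 'b::real_inner) \<Rightarrow> bool"
  assumes P1: "\<And>I \<gamma>. P\<^sub>1 I \<gamma> \<Longrightarrow> smooth_on I \<gamma> \<and> (\<forall>t\<in>I. snd (\<gamma> t) \<bullet> snd (\<gamma> t) = 1)"
    and P2: "\<And>D \<Gamma>. P\<^sub>2 D \<Gamma> \<Longrightarrow> smooth_on D \<Gamma> \<and> (\<forall>p\<in>D. snd (\<Gamma> p) \<bullet> snd (\<Gamma> p) = 1)"
    and adm1: "\<And>I \<gamma> t\<^sub>0 t\<^sub>1. open I \<Longrightarrow> P\<^sub>1 I \<gamma> \<Longrightarrow> P\<^sub>2 (strip I) (vary_radius \<gamma> t\<^sub>0 t\<^sub>1)"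
    and adm2: "\<And>I \<gamma> \<tau> t\<^sub>0 t\<^sub>1. open I \<Longrightarrow> P\<^sub>1 I \<gamma> \<Longrightarrow> \<tau> \<in> I \<Longrightarrow> P\<^sub>2 (strip I) (vary_direction \<gamma> (snd (\<gamma> \<tau>)) t\<^sub>0 t\<^sub>1)"
    and extend: "\<And>I \<gamma> t\<^sub>0 x \<theta> e. open I \<Longrightarrow> P\<^sub>1 I \<gamma> \<Longrightarrow> t\<^sub>0 \<in> I \<Longrightarrow> smooth_on UNIV x \<Longrightarrow> smooth_on UNIV \<theta> \<Longrightarrow>
      (\<And>t. (cos (\<theta> t) *\<^sub>R snd (\<gamma> t\<^sub>0) + sin (\<theta> t) *\<^sub>R e) \<bullet> (cos (\<theta> t) *\<^sub>R snd (\<gamma> t\<^sub>0) + sin (\<theta> t) *\<^sub>R e) = 1) \<Longrightarrow>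
      e \<in> span ((\<lambda>t. snd (\<gamma> t)) ` I) \<Longrightarrow>
      P\<^sub>1 UNIV (\<lambda>t. (x t, cos (\<theta> t) *\<^sub>R snd (\<gamma> t\<^sub>0) + sin (\<theta> t) *\<^sub>R e))"
  shows "geodesically_complete P\<^sub>1 P\<^sub>2 (warped_metric a)"
  unfolding geodesically_complete_def
proof (intro allI impI, elim conjE)
  fix I :: "real set" and \<gamma> :: "real \<Rightarrow> real \<times> 'b"
  assume I: "open I" "is_interval I" "I \<noteq> {}" and geo: "geodesic P\<^sub>1 P\<^sub>2 (warped_metric a) I \<gamma>"
  then obtain t\<^sub>0 where t0: "t\<^sub>0 \<in> I" by auto
  have P\<gamma>: "P\<^sub>1 I \<gamma>" using geo by (simp add: geodesic_def)
  have unit: "\<And>t. t \<in> I \<Longrightarrow> snd (\<gamma> t) \<bullet> snd (\<gamma> t) = 1" using P1[OF P\<gamma>] by blast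
  obtain w \<psi> where eq: "geodesic_eq I \<gamma> w \<psi>"
    using euler_lagrange[OF I(1) _ unit geo adm1[OF I(1) P\<gamma>] adm2[OF I(1) P\<gamma>]] P1[OF P\<gamma>] by blast
  obtain x y \<theta> e L where sol:
    "\<And>t. (x has_real_derivative y t) (at t)"
    "\<And>t. (y has_real_derivative L\<^sup>2 * a' (x t) / (2 * (a (x t))\<^sup>2)) (at t)"
    "\<And>t. (\<theta> has_real_derivative L / a (x t)) (at t)"
    and smooth: "smooth_on UNIV x" "smooth_on UNIV \<theta>"
    and agree: "\<And>t. t \<in> I \<Longrightarrow> \<gamma> t = (x t, cos (\<theta> t) *\<^sub>R snd (\<gamma> t\<^sub>0) + sin (\<theta> t) *\<^sub>R e)"
    and cases: "L = 0 \<and> e = 0 \<and> (\<forall>t. \<theta> t = 0) \<or> L > 0 \<and> e \<bullet> e = 1 \<and> snd (\<gamma> t\<^sub>0) \<bullet> e = 0 \<and> (\<exists>t\<in>I. sin (\<theta> t) \<noteq> 0)"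
    by (rule geodesic_eq_explicit[OF I(1,2) t0 unit eq]) (assumption, (rule that; assumption))
  define \<eta> where "\<eta> = (\<lambda>t. (x t, cos (\<theta> t) *\<^sub>R snd (\<gamma> t\<^sub>0) + sin (\<theta> t) *\<^sub>R e))"
  have circle: "(cos (\<theta> t) *\<^sub>R snd (\<gamma> t\<^sub>0) + sin (\<theta> t) *\<^sub>R e) \<bullet> (cos (\<theta> t) *\<^sub>R snd (\<gamma> t\<^sub>0) + sin (\<theta> t) *\<^sub>R e) = 1" for t
  proof -
    have "cos (\<theta> t) * cos (\<theta> t) + sin (\<theta> t) * sin (\<theta> t) = 1"
      using sin_cos_squared_add3 by blast
    then show ?thesis
      using cases unit[OF t0] by (auto simp: inner_add_left inner_add_right inner_commute)
  qed
  have "e \<in> span ((\<lambda>t. snd (\<gamma> t)) ` I)"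
  proof (cases "e = 0")
    case False
    then obtain t where t: "t \<in> I" "sin (\<theta> t) \<noteq> 0" using cases by auto
    have "e = (1 / sin (\<theta> t)) *\<^sub>R (snd (\<gamma> t) - cos (\<theta> t) *\<^sub>R snd (\<gamma> t\<^sub>0))"
      using agree[OF t(1)] t(2) by simp
    also have "\<dots> \<in> span ((\<lambda>t. snd (\<gamma> t)) ` I)"
      by (intro span_scale span_diff span_base imageI t t0)
    finally show ?thesis .
  qed (simp add: span_zero)
  then have P\<eta>: "P\<^sub>1 UNIV \<eta>"
    unfolding \<eta>_def by (rule extend[OF I(1) P\<gamma> t0 smooth circle])
  obtain w\<^sub>1 \<psi>\<^sub>1 where eq1: "geodesic_eq UNIV \<eta> w\<^sub>1 \<psi>\<^sub>1"
    using explicit_geodesic_eq[OF sol, of "snd (\<gamma> t\<^sub>0)" e] unit[OF t0] cases unfolding \<eta>_def by blast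
  have "geodesic P\<^sub>1 P\<^sub>2 (warped_metric a) UNIV \<eta>"
    unfolding geodesic_def
  proof (intro conjI allI impI, rule P\<eta>, elim conjE)
    fix t\<^sub>0 t\<^sub>1 J \<delta> and \<Gamma> :: "real \<times> real \<Rightarrow> real \<times> 'b"
    assume *: "t\<^sub>0 < t\<^sub>1" "{t\<^sub>0..t\<^sub>1} \<subseteq> UNIV" "{t\<^sub>0..t\<^sub>1} \<subseteq> J" "open J" "0 < \<delta>" "P\<^sub>2 ({- \<delta><..<\<delta>} \<times> J) \<Gamma>"
      "\<forall>t\<in>{t\<^sub>0..t\<^sub>1}. \<Gamma> (0, t) = \<eta> t" "\<forall>\<epsilon>\<in>{- \<delta><..<\<delta>}. \<Gamma> (\<epsilon>, t\<^sub>0) = \<eta> t\<^sub>0 \<and> \<Gamma> (\<epsilon>, t\<^sub>1) = \<eta> t\<^sub>1"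
    show "((\<lambda>\<epsilon>. energy (warped_metric a) t\<^sub>0 t\<^sub>1 (\<lambda>t. \<Gamma> (\<epsilon>, t))) has_real_derivative 0) (at 0)"
      by (rule geodesic_eq_critical[OF eq1 *(1-5)]) (use P2[OF *(6)] *(7,8) in auto)
  qed
  moreover have "\<forall>t\<in>I. \<eta> t = \<gamma> t" using agree by (simp add: \<eta>_def)
  ultimately show "\<exists>\<eta>. geodesic P\<^sub>1 P\<^sub>2 (warped_metric a) UNIV \<eta> \<and> (\<forall>t\<in>I. \<eta> t = \<gamma> t)" by blast
qed

end

section \<open>The Hilbert space and its smooth elements\<close>

lemma L2_cases:
  fixes \<phi> :: "'m::reference_measure L2"
  obtains f where "square_integrable f" "\<phi> = abs_L2 f"
proof
  have "L2_eq (rep_L2 \<phi>) (rep_L2 \<phi>)" by (rule Quotient3_rep_reflp[OF Quotient3_L2])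
  then show "square_integrable (rep_L2 \<phi>)" by (simp add: L2_eq_def)
  show "\<phi> = abs_L2 (rep_L2 \<phi>)" by (rule Quotient3_abs_rep[OF Quotient3_L2, symmetric])
qed

lemma L2_eq_refl: "square_integrable f \<Longrightarrow> L2_eq f f"
  by (simp add: L2_eq_def)

lemma abs_L2_add:
  "square_integrable f \<Longrightarrow> square_integrable g \<Longrightarrow> abs_L2 f + abs_L2 g = abs_L2 (\<lambda>x. f x + g x)"
  by (simp add: plus_L2.abs_eq L2_eq_refl)

lemma abs_L2_diff:
  "square_integrable f \<Longrightarrow> square_integrable g \<Longrightarrow> abs_L2 f - abs_L2 g = abs_L2 (\<lambda>x. f x - g x)"
  by (simp add: minus_L2.abs_eq L2_eq_refl)

lemma abs_L2_scale: "square_integrable f \<Longrightarrow> c *\<^sub>R abs_L2 f = abs_L2 (\<lambda>x. c * f x)"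
  by (simp add: scaleR_L2.abs_eq L2_eq_refl)

lemma inner_abs_L2:
  "square_integrable f \<Longrightarrow> square_integrable g \<Longrightarrow> abs_L2 f \<bullet> abs_L2 g = (\<integral>x. f x * g x \<partial>\<mu>\<^sub>0)"
  by (simp add: inner_L2.abs_eq L2_eq_refl)

lemma nn_integral_square:
  assumes "square_integrable f"
  shows "(\<integral>\<^sup>+ x. ennreal ((f x)\<^sup>2) \<partial>\<mu>\<^sub>0) = ennreal ((norm (abs_L2 f))\<^sup>2)"
proof -
  have "(norm (abs_L2 f))\<^sup>2 = (\<integral>x. (f x)\<^sup>2 \<partial>\<mu>\<^sub>0)"
    unfolding power2_norm_eq_inner inner_abs_L2[OF assms assms] by (simp add: power2_eq_square)
  then show ?thesis
    using assms by (simp add: square_integrable_def nn_integral_eq_integral)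
qed

lemma square_integrableI:
  assumes "f \<in> borel_measurable \<mu>\<^sub>0" "(\<integral>\<^sup>+ x. ennreal ((f x)\<^sup>2) \<partial>\<mu>\<^sub>0) < \<infinity>"
  shows "square_integrable f"
  unfolding square_integrable_def using assms by (auto intro!: integrableI_nonneg)

lemma square_integrable_bounded:
  assumes "finite_measure (\<mu>\<^sub>0 :: 'm::reference_measure measure)" "f \<in> borel_measurable (\<mu>\<^sub>0 :: 'm measure)" "\<And>x. \<bar>f x\<bar> \<le> B"
  shows "square_integrable f"
  unfolding square_integrable_def
proof
  have "norm ((f x)\<^sup>2) \<le> B\<^sup>2" for x
    using power_mono[OF assms(3)[of x], of 2] by simp
  then show "integrable \<mu>\<^sub>0 (\<lambda>x. (f x)\<^sup>2)"
    using assms(2) by (intro finite_measure.integrable_const_bound[OF assms(1), where B = "B\<^sup>2"]) auto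
qed (rule assms(2))

text \<open>On a finite measure the \<open>L\<^sup>2\<close>-norm controls the \<open>L\<^sup>1\<close>-norm, so that a rapidly convergent
  subsequence converges almost everywhere; Fatou's lemma turns the pointwise limit into a limit in norm.\<close>

lemma L2_complete:
  fixes X :: "nat \<Rightarrow> 'm::reference_measure L2"
  assumes fin: "finite_measure (\<mu>\<^sub>0 :: 'm measure)" and "Cauchy X"
  shows "convergent X"
proof -
  let ?M = "\<mu>\<^sub>0 :: 'm measure"
  have "\<forall>k. \<exists>N. \<forall>m\<ge>N. \<forall>n\<ge>N. norm (X m - X n) < (1/2) ^ k"
    using assms(2) by (auto simp: Cauchy_iff)
  then obtain N where N: "\<And>k m n. N k \<le> m \<Longrightarrow> N k \<le> n \<Longrightarrow> norm (X m - X n) < (1/2) ^ k" by metis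
  define r where "r k = (\<Sum>i\<le>k. N i)" for k
  have r_mono: "r k \<le> r j" if "k \<le> j" for k j
    unfolding r_def using that by (intro sum_mono2) auto
  have r_N: "N k \<le> r k" for k
    unfolding r_def using member_le_sum[of k "{..k}" N] by simp
  have r: "norm (X (r j) - X (r k)) < (1/2) ^ k" if "k \<le> j" for j k
    using N r_N r_mono[OF that] by (meson order_trans)
  have "\<exists>f. square_integrable f \<and> X (r k) = abs_L2 f" for k
    using L2_cases[of "X (r k)"] by metis
  then obtain f where f: "\<And>k. square_integrable (f k)" "\<And>k. X (r k) = abs_L2 (f k)" by metis
  have f_meas[measurable]: "f k \<in> borel_measurable ?M" for k
    using f(1) by (simp add: square_integrable_def)
  have f_diff: "square_integrable (\<lambda>x. f j x - f k x)" for j k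
    by (rule square_integrable_diff[OF f(1) f(1)])
  have norm_diff: "norm (X (r j) - X (r k)) = norm (abs_L2 (\<lambda>x. f j x - f k x))" for j k
    by (simp add: f(2) abs_L2_diff f(1))
  have one: "square_integrable (\<lambda>x::'m. 1)"
    by (rule square_integrable_bounded[OF fin, where B = 1]) auto
  define C where "C = norm (abs_L2 (\<lambda>x::'m. 1))"
  have L1: "(\<integral>\<^sup>+ x. ennreal \<bar>g x\<bar> \<partial>?M) \<le> ennreal (norm (abs_L2 g) * C)" if g: "square_integrable g" for g
  proof -
    have abs: "square_integrable (\<lambda>x. \<bar>g x\<bar>)" using g by (auto simp: square_integrable_def intro: borel_measurable_abs)
    have "norm (abs_L2 (\<lambda>x. \<bar>g x\<bar>)) = norm (abs_L2 g)"
      by (simp add: norm_eq_sqrt_inner inner_abs_L2 abs g)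
    then have "(\<integral>x. \<bar>g x\<bar> * 1 \<partial>?M) \<le> norm (abs_L2 g) * C"
      using norm_cauchy_schwarz[of "abs_L2 (\<lambda>x. \<bar>g x\<bar>)" "abs_L2 (\<lambda>x. 1)"]
      unfolding inner_abs_L2[OF abs one] C_def by simp
    then show ?thesis
      using square_integrable_mult[OF abs one] by (subst nn_integral_eq_integral) (auto intro: ennreal_leI)
  qed
  have "AE x in ?M. (\<Sum>k. ennreal \<bar>f (Suc k) x - f k x\<bar>) \<noteq> \<infinity>"
  proof (rule nn_integral_PInf_AE)
    have "(\<integral>\<^sup>+ x. (\<Sum>k. ennreal \<bar>f (Suc k) x - f k x\<bar>) \<partial>?M) = (\<Sum>k. \<integral>\<^sup>+ x. ennreal \<bar>f (Suc k) x - f k x\<bar> \<partial>?M)"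
      by (rule nn_integral_suminf) measurable
    also have "\<dots> \<le> (\<Sum>k. ennreal ((1/2) ^ k * C))"
    proof (rule suminf_le)
      fix k
      have "(\<integral>\<^sup>+ x. ennreal \<bar>f (Suc k) x - f k x\<bar> \<partial>?M) \<le> ennreal (norm (abs_L2 (\<lambda>x. f (Suc k) x - f k x)) * C)"
        by (rule L1[OF f_diff])
      also have "\<dots> \<le> ennreal ((1/2) ^ k * C)"
        using r[of k "Suc k"] by (intro ennreal_leI mult_right_mono) (auto simp: norm_diff C_def)
      finally show "(\<integral>\<^sup>+ x. ennreal \<bar>f (Suc k) x - f k x\<bar> \<partial>?M) \<le> ennreal ((1/2) ^ k * C)" .
    qed auto
    also have "\<dots> = ennreal (\<Sum>k. (1/2) ^ k * C)"
      by (rule suminf_ennreal2) (auto simp: C_def intro!: summable_mult2 summable_geometric)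
    also have "\<dots> < \<infinity>" by simp
    finally show "(\<integral>\<^sup>+ x. (\<Sum>k. ennreal \<bar>f (Suc k) x - f k x\<bar>) \<partial>?M) \<noteq> \<infinity>" by simp
  qed measurable
  then have conv: "AE x in ?M. convergent (\<lambda>k. f k x)"
  proof eventually_elim
    fix x assume "(\<Sum>k. ennreal \<bar>f (Suc k) x - f k x\<bar>) \<noteq> \<infinity>"
    then have "summable (\<lambda>k. \<bar>f (Suc k) x - f k x\<bar>)"
      by (intro summable_suminf_not_top) auto
    then have "convergent (\<lambda>n. \<Sum>k<n. f (Suc k) x - f k x)"
      using summable_rabs_cancel summable_iff_convergent by blast
    then have "convergent (\<lambda>n. f n x - f 0 x)"
      by (simp only: sum_lessThan_telescope[of "\<lambda>k. f k x"])
    from convergent_add[OF this convergent_const[of "f 0 x"]] show "convergent (\<lambda>k. f k x)" by simp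
  qed
  define h where "h x = lim (\<lambda>k. f k x)" for x
  have h_meas[measurable]: "h \<in> borel_measurable ?M"
    unfolding h_def by measurable
  have Fatou: "(\<integral>\<^sup>+ x. ennreal ((h x - f k x)\<^sup>2) \<partial>?M) \<le> ennreal (((1/2) ^ k)\<^sup>2)" for k
  proof -
    have "(\<integral>\<^sup>+ x. ennreal ((h x - f k x)\<^sup>2) \<partial>?M) = (\<integral>\<^sup>+ x. liminf (\<lambda>j. ennreal ((f j x - f k x)\<^sup>2)) \<partial>?M)"
    proof (rule nn_integral_cong_AE, use conv in eventually_elim)
      fix x assume "convergent (\<lambda>k. f k x)"
      then have "(\<lambda>j. ennreal ((f j x - f k x)\<^sup>2)) \<longlonglongrightarrow> ennreal ((h x - f k x)\<^sup>2)"
        unfolding h_def convergent_LIMSEQ_iff by (intro tendsto_intros)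
      then show "ennreal ((h x - f k x)\<^sup>2) = liminf (\<lambda>j. ennreal ((f j x - f k x)\<^sup>2))"
        by (rule lim_imp_Liminf[OF sequentially_bot, symmetric])
    qed
    also have "\<dots> \<le> liminf (\<lambda>j. \<integral>\<^sup>+ x. ennreal ((f j x - f k x)\<^sup>2) \<partial>?M)"
      by (rule nn_integral_liminf) measurable
    also have "\<dots> \<le> ennreal (((1/2) ^ k)\<^sup>2)"
    proof (rule Liminf_le)
      show "\<forall>\<^sub>F j in sequentially. (\<integral>\<^sup>+ x. ennreal ((f j x - f k x)\<^sup>2) \<partial>?M) \<le> ennreal (((1/2) ^ k)\<^sup>2)"
        using eventually_ge_at_top[of k]
      proof eventually_elim
        fix j assume "k \<le> j"
        then show "(\<integral>\<^sup>+ x. ennreal ((f j x - f k x)\<^sup>2) \<partial>?M) \<le> ennreal (((1/2) ^ k)\<^sup>2)"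
          using r[of k j] unfolding nn_integral_square[OF f_diff]
          by (intro ennreal_leI power_mono) (auto simp: norm_diff)
      qed
    qed simp
    finally show ?thesis .
  qed
  have hf: "square_integrable (\<lambda>x. h x - f k x)" for k
  proof (rule square_integrableI)
    show "(\<integral>\<^sup>+ x. ennreal ((h x - f k x)\<^sup>2) \<partial>?M) < \<infinity>"
      using Fatou[of k] by (auto intro: le_less_trans)
  qed measurable
  have "square_integrable (\<lambda>x. (h x - f 0 x) + f 0 x)"
    by (rule square_integrable_add[OF hf f(1)])
  then have h: "square_integrable h" by simp
  have close: "norm (abs_L2 h - X (r k)) \<le> (1/2) ^ k" for k
  proof -
    have "ennreal ((norm (abs_L2 (\<lambda>x. h x - f k x)))\<^sup>2) \<le> ennreal (((1/2) ^ k)\<^sup>2)"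
      using Fatou[of k] unfolding nn_integral_square[OF hf] .
    then have "(norm (abs_L2 (\<lambda>x. h x - f k x)))\<^sup>2 \<le> ((1/2) ^ k)\<^sup>2"
      by (subst (asm) ennreal_le_iff) simp_all
    then have "norm (abs_L2 (\<lambda>x. h x - f k x)) \<le> (1/2) ^ k"
      by (rule power2_le_imp_le) simp
    then show ?thesis unfolding f(2) abs_L2_diff[OF h f(1)] .
  qed
  have "X \<longlonglongrightarrow> abs_L2 h"
  proof (rule LIMSEQ_I)
    fix e :: real assume "0 < e"
    then obtain k where k: "(1/2) ^ k < e / 2"
      using real_arch_pow_inv[of "e / 2" "1/2"] by auto
    have "norm (X n - abs_L2 h) < e" if "N k \<le> n" for n
    proof -
      have "norm (X n - X (r k)) < (1/2) ^ k" by (rule N[OF that r_N])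
      moreover have "norm (X (r k) - abs_L2 h) \<le> (1/2) ^ k" using close[of k] by (simp add: norm_minus_commute)
      ultimately show ?thesis
        using norm_triangle_ineq[of "X n - X (r k)" "X (r k) - abs_L2 h"] k by simp
    qed
    then show "\<exists>no. \<forall>n\<ge>no. norm (X n - abs_L2 h) < e" by blast
  qed
  then show ?thesis by (rule convergentI)
qed

text \<open>The two indicator functions are linearly independent, and the plane that they span meets the
  hyperplane orthogonal to \<open>\<phi>\<close>.\<close>

lemma exists_orthogonal_unit:
  fixes \<phi> :: "'m::reference_measure L2"
  assumes fin: "finite_measure (\<mu>\<^sub>0 :: 'm measure)" and AB: "A \<in> sets (\<mu>\<^sub>0 :: 'm measure)" "B \<in> sets \<mu>\<^sub>0" "A \<inter> B = {}"
    and pos: "0 < emeasure \<mu>\<^sub>0 A" "0 < emeasure \<mu>\<^sub>0 B"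
  shows "\<exists>e. e \<bullet> e = 1 \<and> \<phi> \<bullet> e = 0"
proof -
  interpret finite_measure "\<mu>\<^sub>0 :: 'm measure" by fact
  define u v where "u = abs_L2 (indicator A :: 'm \<Rightarrow> real)" and "v = abs_L2 (indicator B :: 'm \<Rightarrow> real)"
  have sq: "square_integrable (indicator A :: 'm \<Rightarrow> real)" "square_integrable (indicator B :: 'm \<Rightarrow> real)"
    using AB by (auto intro!: square_integrable_bounded[OF fin, where B = 1] simp: indicator_def)
  have "u \<bullet> u = measure \<mu>\<^sub>0 A" "v \<bullet> v = measure \<mu>\<^sub>0 B" "u \<bullet> v = 0"
    using AB(3) sets.sets_into_space[OF AB(1)] sets.sets_into_space[OF AB(2)]
    by (simp_all add: u_def v_def inner_abs_L2 sq Int_absorb2 flip: indicator_inter_arith)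
  then have uv: "u \<noteq> 0" "v \<noteq> 0" "u \<bullet> v = 0"
    using pos by (auto simp: emeasure_eq_measure)
  have "\<exists>e. e \<noteq> 0 \<and> \<phi> \<bullet> e = 0"
  proof (cases "\<phi> \<bullet> u = 0")
    case True
    then show ?thesis using uv by blast
  next
    case False
    define e where "e = (\<phi> \<bullet> u) *\<^sub>R v - (\<phi> \<bullet> v) *\<^sub>R u"
    have "e \<bullet> v = (\<phi> \<bullet> u) * (v \<bullet> v)" using uv by (simp add: e_def inner_diff_left)
    then have "e \<noteq> 0" using False uv by auto
    moreover have "\<phi> \<bullet> e = 0" by (simp add: e_def inner_diff_right)
    ultimately show ?thesis by blast
  qed
  then obtain e where e: "e \<noteq> 0" "\<phi> \<bullet> e = 0" by blast
  then show ?thesis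
    by (intro exI[of _ "(1 / norm e) *\<^sub>R e"]) (simp add: dot_square_norm power2_eq_square)
qed

lemma smooth_ext_of_smooth_on: "open Z \<Longrightarrow> X \<subseteq> Z \<Longrightarrow> smooth_on Z f \<Longrightarrow> smooth_ext X f"
  by (auto simp: smooth_ext_def)

text \<open>Local extensions are pulled back along \<open>g\<close>; for this \<open>g\<close> must be smooth on an open set, not just on \<open>X\<close>.\<close>

lemma smooth_ext_compose:
  fixes f :: "'b::euclidean_space \<Rightarrow> 'c::real_normed_vector" and g :: "'a::euclidean_space \<Rightarrow> 'b"
  assumes "smooth_ext Y f" "open Z" "smooth_on Z g" "X \<subseteq> Z" "g ` X \<subseteq> Y"
  shows "smooth_ext X (\<lambda>x. f (g x))"
  unfolding smooth_ext_def
proof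
  fix x assume x: "x \<in> X"
  then have "g x \<in> Y" using assms(5) by auto
  then obtain U h where U: "open U" "g x \<in> U" "smooth_on U h" "\<forall>y\<in>Y \<inter> U. h y = f y"
    using assms(1) unfolding smooth_ext_def by blast
  define T where "T = Z \<inter> g -` U"
  have T: "open T" unfolding T_def
    by (rule continuous_open_preimage[OF smooth_on_continuous[OF assms(3)] assms(2) U(1)])
  have "smooth_on T (\<lambda>x. h (g x))"
    by (rule smooth_on_compose[OF U(3) T U(1) _ smooth_on_subset[OF assms(3)]]) (auto simp: T_def)
  then show "\<exists>U k. open U \<and> x \<in> U \<and> smooth_on U k \<and> (\<forall>y\<in>X \<inter> U. k y = f (g y))"
  proof (intro exI conjI ballI)
    show "x \<in> T" using x U(2) assms(4) by (auto simp: T_def)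
    show "h (g y) = f (g y)" if "y \<in> X \<inter> T" for y
      using that U(4) assms(5) by (simp add: T_def image_subset_iff)
  qed (rule T)
qed

lemma smooth_ext_combine:
  fixes X :: "'a::euclidean_space set"
  assumes "smooth_ext X f" "smooth_ext X g"
    and "\<And>(U :: 'a set) f g. open U \<Longrightarrow> smooth_on U f \<Longrightarrow> smooth_on U g \<Longrightarrow> smooth_on U (\<lambda>x. c (f x) (g x))"
  shows "smooth_ext X (\<lambda>x. c (f x) (g x))"
  unfolding smooth_ext_def
proof
  fix x assume x: "x \<in> X"
  obtain U f' where U: "open U" "x \<in> U" "smooth_on U f'" "\<forall>y\<in>X \<inter> U. f' y = f y"
    using assms(1) x by (auto simp: smooth_ext_def)
  obtain V g' where V: "open V" "x \<in> V" "smooth_on V g'" "\<forall>y\<in>X \<inter> V. g' y = g y"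
    using assms(2) x by (auto simp: smooth_ext_def)
  have "smooth_on (U \<inter> V) (\<lambda>x. c (f' x) (g' x))"
    using U V by (intro assms(3)) (auto intro: smooth_on_subset)
  then show "\<exists>U k. open U \<and> x \<in> U \<and> smooth_on U k \<and> (\<forall>y\<in>X \<inter> U. k y = c (f y) (g y))"
    using U(1,2,4) V(1,2,4) by (intro exI[of _ "U \<inter> V"] exI[of _ "\<lambda>x. c (f' x) (g' x)"]) (simp add: open_Int)
qed

lemmas smooth_ext_add = smooth_ext_combine[where c = "(+)", OF _ _ smooth_on_add]
lemmas smooth_ext_mult = smooth_ext_combine[where c = "(*) :: real \<Rightarrow> real \<Rightarrow> real", OF _ _ smooth_on_mult]

lemma smooth_ext_continuous:
  assumes "smooth_ext X f" shows "continuous_on X f"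
  unfolding continuous_on_eq_continuous_within
proof
  fix x assume x: "x \<in> X"
  then obtain U g where U: "open U" "x \<in> U" "smooth_on U g" "\<forall>y\<in>X \<inter> U. g y = f y"
    using assms by (auto simp: smooth_ext_def)
  have "continuous (at x) g"
    using smooth_on_continuous[OF U(3)] U(1,2) by (simp add: continuous_on_eq_continuous_at)
  then have "(g \<longlongrightarrow> g x) (at x within X)"
    by (meson continuous_at_imp_continuous_within continuous_within)
  moreover have "\<forall>\<^sub>F y in at x within X. g y = f y"
    using U by (auto simp: eventually_at_topological)
  ultimately have "(f \<longlongrightarrow> g x) (at x within X)" by (rule Lim_transform_eventually)
  then show "continuous (at x within X) f" using U x by (simp add: continuous_within)
qed

subsection \<open>Smooth families of functions on a manifold\<close>

lemma smooth_familyI: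
  "(\<And>U x. (U, x) \<in> \<A> \<Longrightarrow> smooth_ext (D \<times> x ` U) (\<lambda>p. f (fst p) (inv_into U x (snd p)))) \<Longrightarrow> smooth_family \<A> D f"
  by (auto simp: smooth_family_def split_beta')

lemma smooth_familyD:
  "smooth_family \<A> D f \<Longrightarrow> (U, x) \<in> \<A> \<Longrightarrow> smooth_ext (D \<times> x ` U) (\<lambda>p. f (fst p) (inv_into U x (snd p)))"
  by (auto simp: smooth_family_def split_beta')

lemma smooth_functionD:
  "smooth_function \<A> f \<Longrightarrow> (U, x) \<in> \<A> \<Longrightarrow> smooth_ext (x ` U) (\<lambda>v. f (inv_into U x v))"
  by (auto simp: smooth_function_def o_def)

lemma smooth_family_add:
  "smooth_family \<A> D f \<Longrightarrow> smooth_family \<A> D g \<Longrightarrow> smooth_family \<A> D (\<lambda>p x. f p x + g p x)"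
  by (rule smooth_familyI, rule smooth_ext_add[OF smooth_familyD smooth_familyD])

lemma smooth_family_scale:
  fixes \<A> :: "('m, 'n::finite) chart set"
  assumes "open D" "smooth_on D k" "smooth_family \<A> D f"
  shows "smooth_family \<A> D (\<lambda>p x. k p * f p x)"
proof (rule smooth_familyI, rule smooth_ext_mult[OF _ smooth_familyD[OF assms(3)]])
  fix U x assume "(U, x) \<in> \<A>"
  have D: "open (D \<times> (UNIV :: (real ^ 'n) set))" by (intro open_Times assms open_UNIV)
  show "smooth_ext (D \<times> x ` U) (\<lambda>p. k (fst p))"
    by (rule smooth_ext_of_smooth_on[OF D _ smooth_on_compose[OF assms(2) D assms(1) _ smooth_on_fst[OF D smooth_on_ident[OF D]]]]) auto
qed

lemma smooth_family_const:
  fixes \<A> :: "('m, 'n::finite) chart set"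
  assumes "smooth_function \<A> h" shows "smooth_family \<A> D (\<lambda>_. h)"
  by (rule smooth_familyI, rule smooth_ext_compose[OF smooth_functionD[OF assms] open_UNIV smooth_on_snd[OF open_UNIV smooth_on_ident[OF open_UNIV]]])
    auto

lemma smooth_family_pullback:
  fixes \<A> :: "('m, 'n::finite) chart set" and g :: "'p::euclidean_space \<Rightarrow> 'q::euclidean_space"
  assumes "smooth_family \<A> D f" "open D'" "smooth_on D' g" "g ` D' \<subseteq> D"
  shows "smooth_family \<A> D' (\<lambda>p. f (g p))"
proof (rule smooth_familyI)
  fix U x assume Ux: "(U, x) \<in> \<A>"
  have D: "open (D' \<times> (UNIV :: (real ^ 'n) set))" by (intro open_Times assms open_UNIV)
  have "smooth_on (D' \<times> UNIV) (\<lambda>p :: 'p \<times> (real ^ 'n). (g (fst p), snd p))"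
    by (intro smooth_on_Pair D smooth_on_snd smooth_on_ident
        smooth_on_compose[OF assms(3) D assms(2) _ smooth_on_fst[OF D smooth_on_ident[OF D]]]) auto
  moreover have "(\<lambda>p. (g (fst p), snd p)) ` (D' \<times> x ` U) \<subseteq> D \<times> x ` U" using assms(4) by auto
  moreover have "D' \<times> x ` U \<subseteq> D' \<times> UNIV" by auto
  ultimately show "smooth_ext (D' \<times> x ` U) (\<lambda>p. f (g (fst p)) (inv_into U x (snd p)))"
    using smooth_ext_compose[OF smooth_familyD[OF assms(1) Ux] D] by fastforce
qed

lemma smooth_family_slice:
  fixes \<A> :: "('m, 'n::finite) chart set"
  assumes "smooth_family \<A> D f" "p \<in> D" shows "smooth_function \<A> (f p)"
  unfolding smooth_function_def
proof (intro ballI, clarify)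
  fix U x assume Ux: "(U, x) \<in> \<A>"
  have "smooth_on UNIV (\<lambda>v :: real ^ 'n. (p, v))"
    by (intro smooth_on_Pair smooth_on_const smooth_on_ident open_UNIV)
  from smooth_ext_compose[OF smooth_familyD[OF assms(1) Ux] open_UNIV this, of "x ` U"] assms(2)
  show "smooth_ext (x ` U) (f p \<circ> inv_into U x)" by (auto simp: o_def)
qed

subsection \<open>The reference density\<close>

locale density_manifold =
  fixes \<A> :: "('m::{t2_space, second_countable_topology, reference_measure}, 'n::finite) chart set"
  assumes compact_M: "compact (UNIV :: 'm set)"
    and atlas: "smooth_atlas \<A>"
    and density: "smooth_positive_density \<A> \<mu>\<^sub>0"
    and mass: "emeasure (\<mu>\<^sub>0 :: 'm measure) UNIV = 1"
begin

lemma sets_reference: "sets (\<mu>\<^sub>0 :: 'm measure) = sets borel"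
  using density by (simp add: smooth_positive_density_def)

lemma finite_reference: "finite_measure (\<mu>\<^sub>0 :: 'm measure)"
  using mass sets_eq_imp_space_eq[OF sets_reference] by (intro finite_measureI) simp

lemma chart:
  assumes "(U, x) \<in> \<A>"
  shows "open U" "openin (top_of_set quadrant) (x ` U)" "continuous_on U x" "inj_on x U"
proof -
  have "open U \<and> openin (top_of_set quadrant) (x ` U) \<and> (\<exists>y. homeomorphism U (x ` U) x y)"
    using atlas assms by (auto simp: smooth_atlas_def)
  then show "open U" "openin (top_of_set quadrant) (x ` U)" "continuous_on U x" "inj_on x U"
    by (auto simp: homeomorphism_def intro: inj_on_inverseI)
qed

lemma chart_exists: "\<exists>U x. (U, x) \<in> \<A> \<and> p \<in> U"
proof -
  have "p \<in> \<Union> (fst ` \<A>)" using atlas by (simp add: smooth_atlas_def)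
  then show ?thesis by force
qed

lemma smooth_function_continuous:
  assumes "smooth_function \<A> f" shows "continuous_on UNIV f"
proof (intro continuous_at_imp_continuous_on ballI)
  fix p
  obtain U x where Ux: "(U, x) \<in> \<A>" "p \<in> U" using chart_exists by blast
  note U = chart[OF Ux(1)]
  have "continuous_on U (\<lambda>q. f (inv_into U x (x q)))"
    by (rule continuous_on_compose2[OF smooth_ext_continuous[OF smooth_functionD[OF assms Ux(1)]] U(3)]) auto
  then have "continuous_on U f"
    by (rule continuous_on_eq) (simp add: inv_into_f_f[OF U(4)])
  then show "isCont f p" using U(1) Ux(2) by (simp add: continuous_on_eq_continuous_at)
qed

lemma smooth_function_square_integrable:
  assumes "smooth_function \<A> f" shows "square_integrable f"
proof -
  have f: "continuous_on UNIV f" by (rule smooth_function_continuous[OF assms])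
  then have "f \<in> borel_measurable \<mu>\<^sub>0"
    using borel_measurable_continuous_onI measurable_cong_sets[OF sets_reference refl] by blast
  moreover have "bounded (range f)"
    by (rule compact_imp_bounded[OF compact_continuous_image[OF f compact_M]])
  then obtain B where "\<And>x. \<bar>f x\<bar> \<le> B" by (auto simp: bounded_iff)
  ultimately show ?thesis by (rule square_integrable_bounded[OF finite_reference])
qed

text \<open>A positive function has a positive integral over a set of positive Lebesgue measure.\<close>

lemma emeasure_box_chart_pos:
  assumes Ux: "(U, x) \<in> \<A>" and lu: "box l u \<subseteq> x ` U" "\<And>i. i \<in> Basis \<Longrightarrow> l \<bullet> i < u \<bullet> i"
  shows "U \<inter> x -` box l u \<in> sets \<mu>\<^sub>0" "0 < emeasure \<mu>\<^sub>0 (U \<inter> x -` box l u)"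
proof -
  define A where "A = U \<inter> x -` box l u"
  have "open A"
    unfolding A_def by (rule continuous_open_preimage[OF chart(3,1)[OF Ux] open_box])
  then have A: "A \<in> sets borel" by simp
  then show "U \<inter> x -` box l u \<in> sets \<mu>\<^sub>0" unfolding A_def sets_reference .
  have xA: "x ` A = box l u" using lu(1) by (auto simp: A_def)
  obtain \<rho> where \<rho>: "smooth_ext (x ` U) \<rho>" "\<And>v. v \<in> x ` U \<Longrightarrow> 0 < \<rho> v"
      "\<And>B. B \<in> sets borel \<Longrightarrow> B \<subseteq> U \<Longrightarrow> emeasure \<mu>\<^sub>0 B = (\<integral>\<^sup>+ v. ennreal (\<rho> v) * indicator (x ` B) v \<partial>lborel)"
    using density Ux unfolding smooth_positive_density_def by fastforce
  have "emeasure \<mu>\<^sub>0 A \<noteq> 0"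
  proof
    assume "emeasure \<mu>\<^sub>0 A = 0"
    then have 0: "(\<integral>\<^sup>+ v. ennreal (\<rho> v) * indicator (box l u) v \<partial>lborel) = 0"
      using \<rho>(3)[OF A] by (simp add: A_def[symmetric] xA) (simp add: A_def)
    have "(\<lambda>v. indicator (box l u) v *\<^sub>R \<rho> v) \<in> borel_measurable borel"
      using continuous_on_subset[OF smooth_ext_continuous[OF \<rho>(1)] lu(1)]
      by (intro borel_measurable_continuous_on_indicator) auto
    then have "(\<lambda>v. ennreal (indicator (box l u) v *\<^sub>R \<rho> v)) \<in> borel_measurable lborel" by simp
    moreover have "ennreal (indicator (box l u) v *\<^sub>R \<rho> v) = ennreal (\<rho> v) * indicator (box l u) v" for v
      by (simp add: indicator_def)
    ultimately have "AE v in lborel. ennreal (\<rho> v) * indicator (box l u) v = 0"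
      using 0 by (subst (asm) nn_integral_0_iff_AE) simp_all
    then have "AE v in lborel. v \<notin> box l u"
    proof eventually_elim
      fix v assume "ennreal (\<rho> v) * indicator (box l u) v = 0"
      then show "v \<notin> box l u" using \<rho>(2)[of v] lu(1) by (auto simp: indicator_def ennreal_eq_0_iff split: if_splits)
    qed
    then have "emeasure lborel (box l u) = 0"
      by (subst (asm) AE_iff_measurable[of "box l u"]) auto
    moreover have "emeasure lborel (box l u) = ennreal (\<Prod>i\<in>Basis. (u - l) \<bullet> i)"
      using lu(2) by (intro emeasure_lborel_box) (simp add: less_imp_le)
    moreover have "0 < (\<Prod>i\<in>Basis. (u - l) \<bullet> i)"
      using lu(2) by (intro prod_pos) (simp add: inner_diff_left)
    ultimately show False by (metis ennreal_eq_0_iff linorder_not_less)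
  qed
  then show "0 < emeasure \<mu>\<^sub>0 (U \<inter> x -` box l u)" by (simp add: A_def zero_less_iff_neq_zero)
qed

text \<open>Charts contain two disjoint boxes, because the dimension is positive. Hence \<open>L\<^sup>2\<close> is at least
  two-dimensional, without which its unit sphere would not be connected.\<close>

lemma orthogonal_unit: "\<exists>e. e \<bullet> e = 1 \<and> (\<phi> :: 'm L2) \<bullet> e = 0"
proof -
  obtain U x where Ux: "(U, x) \<in> \<A>" "(undefined :: 'm) \<in> U" using chart_exists by blast
  obtain T where T: "open T" "x ` U = quadrant \<inter> T"
    using chart(2)[OF Ux(1)] unfolding openin_open by blast
  define v where "v = x undefined"
  have "v \<in> quadrant \<inter> T" using imageI[OF Ux(2), of x] unfolding T(2) v_def .
  then have v: "v \<in> quadrant" "v \<in> T" by auto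
  obtain b c where bc: "v \<in> box b c" "box b c \<subseteq> T"
    by (rule open_contains_box[OF T(1) v(2)]) (rule that)
  define m where "m = (1/2) *\<^sub>R (v + c)"
  have lt: "v \<bullet> i < m \<bullet> i" "m \<bullet> i < c \<bullet> i" if "i \<in> Basis" for i
    using bc(1) that by (auto simp: m_def mem_box inner_add_left)
  have "b \<bullet> i \<le> v \<bullet> i" if "i \<in> Basis" for i using bc(1) that by (auto simp: mem_box less_imp_le)
  then have sub: "box v c \<subseteq> box b c" by (auto simp: mem_box) (meson le_less_trans)
  have quad: "w \<in> quadrant" if "w \<in> box v c" for w
  proof -
    have "0 \<le> w $ i" for i
    proof -
      have "v \<bullet> axis i 1 < w \<bullet> axis i 1" using that by (auto simp: mem_box axis_in_Basis_iff)
      moreover have "0 \<le> v $ i" using v(1) by (simp add: quadrant_def)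
      ultimately show ?thesis by (simp add: inner_axis)
    qed
    then show ?thesis by (simp add: quadrant_def)
  qed
  have "box v m \<subseteq> box v c" "box m c \<subseteq> box v c"
    using lt by (auto simp: mem_box) (meson less_trans)+
  then have boxes: "box v m \<subseteq> x ` U" "box m c \<subseteq> x ` U"
    using sub bc(2) quad unfolding T(2) by blast+
  obtain i where "i \<in> (Basis :: (real ^ 'n) set)" using nonempty_Basis by blast
  then have "box v m \<inter> box m c = {}" by (force simp: mem_box)
  then have "(U \<inter> x -` box v m) \<inter> (U \<inter> x -` box m c) = {}" by auto
  from exists_orthogonal_unit[OF finite_reference emeasure_box_chart_pos(1)[OF Ux(1) boxes(1)]
      emeasure_box_chart_pos(1)[OF Ux(1) boxes(2)] this]
    emeasure_box_chart_pos(2)[OF Ux(1) boxes(1)] emeasure_box_chart_pos(2)[OF Ux(1) boxes(2)] lt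
  show ?thesis by blast
qed

subsection \<open>Smooth curves and variations in the space of smooth functions\<close>

lemma smooth_into_S_CinfI:
  assumes "smooth_on D \<Phi>" "\<And>p. p \<in> D \<Longrightarrow> snd (\<Phi> p) \<bullet> snd (\<Phi> p) = 1"
    and "smooth_family \<A> D f" "\<And>p. p \<in> D \<Longrightarrow> snd (\<Phi> p) = abs_L2 (f p)"
  shows "smooth_into_S_Cinf \<A> D \<Phi>"
proof -
  have "\<Phi> p \<in> UNIV \<times> (L2_sphere \<inter> smooth_L2 \<A>)" if "p \<in> D" for p
    using assms(2,4)[OF that] smooth_family_slice[OF assms(3) that]
    by (auto simp: mem_Times_iff L2_sphere_def smooth_L2_def)
  then show ?thesis
    using assms(1,3,4) unfolding smooth_into_S_Cinf_def by blast
qed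

lemma smooth_into_S_CinfD:
  assumes "smooth_into_S_Cinf \<A> D \<Phi>"
  shows "smooth_on D \<Phi>" "\<And>p. p \<in> D \<Longrightarrow> snd (\<Phi> p) \<bullet> snd (\<Phi> p) = 1" "\<And>p. p \<in> D \<Longrightarrow> snd (\<Phi> p) \<in> smooth_L2 \<A>"
  using assms by (auto simp: smooth_into_S_Cinf_def L2_sphere_def image_subset_iff mem_Times_iff)

lemma smooth_function_lincomb:
  assumes "smooth_function \<A> f" "smooth_function \<A> g"
  shows "smooth_function \<A> (\<lambda>x. b * f x + c * g x)"
proof -
  have "smooth_family \<A> (UNIV :: real set) (\<lambda>p x. b * f x + c * g x)"
    by (intro smooth_family_add smooth_family_scale smooth_on_const open_UNIV)
      (rule smooth_family_const, fact)+
  from smooth_family_slice[OF this UNIV_I] show ?thesis .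
qed

lemma subspace_smooth_L2: "subspace (smooth_L2 \<A>)"
proof (rule subspaceI)
  have lincomb: "b *\<^sub>R \<phi> + c *\<^sub>R \<psi> \<in> smooth_L2 \<A>" if "\<phi> \<in> smooth_L2 \<A>" "\<psi> \<in> smooth_L2 \<A>" for \<phi> \<psi> b c
  proof -
    obtain f g where fg: "smooth_function \<A> f" "\<phi> = abs_L2 f" "smooth_function \<A> g" "\<psi> = abs_L2 g"
      using \<open>\<phi> \<in> smooth_L2 \<A>\<close> \<open>\<psi> \<in> smooth_L2 \<A>\<close> by (auto simp: smooth_L2_def)
    have "b *\<^sub>R \<phi> + c *\<^sub>R \<psi> = abs_L2 (\<lambda>x. b * f x + c * g x)"
      using fg by (simp add: abs_L2_scale abs_L2_add square_integrable_scale smooth_function_square_integrable)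
    then show ?thesis
      using smooth_function_lincomb[OF fg(1,3)] by (auto simp: smooth_L2_def)
  qed
  have "smooth_function \<A> (\<lambda>_. 0)"
    unfolding smooth_function_def o_def
    by (auto intro: smooth_ext_of_smooth_on[OF open_UNIV subset_UNIV smooth_on_const[OF open_UNIV]])
  then show "0 \<in> smooth_L2 \<A>" by (auto simp: smooth_L2_def zero_L2_def)
  show "\<phi> + \<psi> \<in> smooth_L2 \<A>" if "\<phi> \<in> smooth_L2 \<A>" "\<psi> \<in> smooth_L2 \<A>" for \<phi> \<psi>
    using lincomb[OF that, of 1 1] by simp
  show "c *\<^sub>R \<phi> \<in> smooth_L2 \<A>" if "\<phi> \<in> smooth_L2 \<A>" for c \<phi>
    using lincomb[OF that that, of c 0] by simp
qed

lemma smooth_family_lincomb: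
  assumes "open D" "smooth_on D b" "smooth_on D c" "smooth_family \<A> D f" "smooth_family \<A> D g"
  shows "smooth_family \<A> D (\<lambda>p x. b p * f p x + c p * g p x)"
    and "p \<in> D \<Longrightarrow> b p *\<^sub>R abs_L2 (f p) + c p *\<^sub>R abs_L2 (g p) = abs_L2 (\<lambda>x. b p * f p x + c p * g p x)"
proof -
  show "smooth_family \<A> D (\<lambda>p x. b p * f p x + c p * g p x)"
    by (intro smooth_family_add smooth_family_scale assms)
  assume "p \<in> D"
  then have "square_integrable (f p)" "square_integrable (g p)"
    using smooth_family_slice[OF assms(4)] smooth_family_slice[OF assms(5)]
    by (auto intro: smooth_function_square_integrable)
  then show "b p *\<^sub>R abs_L2 (f p) + c p *\<^sub>R abs_L2 (g p) = abs_L2 (\<lambda>x. b p * f p x + c p * g p x)"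
    by (simp add: abs_L2_scale abs_L2_add square_integrable_scale)
qed

lemma smooth_into_S_Cinf_vary_radius:
  assumes "open I" "smooth_into_S_Cinf \<A> I \<gamma>"
  shows "smooth_into_S_Cinf \<A> (strip I) (vary_radius \<gamma> t\<^sub>0 t\<^sub>1)"
proof -
  obtain f where f: "smooth_family \<A> I f" "\<And>t. t \<in> I \<Longrightarrow> snd (\<gamma> t) = abs_L2 (f t)"
    using assms(2) by (auto simp: smooth_into_S_Cinf_def)
  show ?thesis
  proof (rule smooth_into_S_CinfI)
    show "smooth_on (strip I) (vary_radius \<gamma> t\<^sub>0 t\<^sub>1)"
      by (rule smooth_vary_radius[OF assms(1) smooth_into_S_CinfD(1)[OF assms(2)]])
    show "smooth_family \<A> (strip I) (\<lambda>p. f (snd p))"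
      by (rule smooth_family_pullback[OF f(1) open_strip[OF assms(1)]
            smooth_on_snd[OF open_strip[OF assms(1)] smooth_on_ident[OF open_strip[OF assms(1)]]]]) auto
  qed (use f smooth_into_S_CinfD(2)[OF assms(2)] in \<open>auto simp: vary_radius_def\<close>)
qed

lemma smooth_into_S_Cinf_vary_direction:
  assumes I: "open I" and \<gamma>: "smooth_into_S_Cinf \<A> I \<gamma>" and \<tau>: "\<tau> \<in> I"
  shows "smooth_into_S_Cinf \<A> (strip I) (vary_direction \<gamma> (snd (\<gamma> \<tau>)) t\<^sub>0 t\<^sub>1)"
proof -
  obtain f where f: "smooth_family \<A> I f" "\<And>t. t \<in> I \<Longrightarrow> snd (\<gamma> t) = abs_L2 (f t)"
    using \<gamma> by (auto simp: smooth_into_S_Cinf_def)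
  note unit = smooth_into_S_CinfD(2)[OF \<gamma>]
  define h where "h = snd (\<gamma> \<tau>)"
  have h: "h \<bullet> h = 1" "h = abs_L2 (f \<tau>)" using unit[OF \<tau>] f(2)[OF \<tau>] by (simp_all add: h_def)
  note open' = open_strip[OF I]
  define k where "k p = 1 / norm (push \<gamma> h t\<^sub>0 t\<^sub>1 p)" for p
  define b where "b p = k p * (fst p * bump t\<^sub>0 t\<^sub>1 (snd p))" for p
  have k: "smooth_on (strip I) k"
    unfolding k_def by (rule smooth_push_norm[OF I smooth_into_S_CinfD(1)[OF \<gamma>] unit h(1)])
  have b: "smooth_on (strip I) b"
    unfolding b_def by (intro smooth_on_mult k smooth_on_bump smooth_on_fst smooth_on_snd smooth_on_ident open')
  have fam: "smooth_family \<A> (strip I) (\<lambda>p. f (snd p))" "smooth_family \<A> (strip I) (\<lambda>p. f \<tau>)"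
    using smooth_family_pullback[OF f(1) open' smooth_on_snd[OF open' smooth_on_ident[OF open']]]
      smooth_family_const[OF smooth_family_slice[OF f(1) \<tau>]] by auto
  show ?thesis
    unfolding h_def[symmetric]
  proof (rule smooth_into_S_CinfI)
    show "smooth_on (strip I) (vary_direction \<gamma> h t\<^sub>0 t\<^sub>1)"
      by (rule smooth_vary_direction[OF I smooth_into_S_CinfD(1)[OF \<gamma>] unit h(1)])
    show "smooth_family \<A> (strip I) (\<lambda>p x. k p * f (snd p) x + b p * f \<tau> x)"
      by (rule smooth_family_lincomb(1)[OF open' k b fam])
    fix p assume p: "p \<in> strip I"
    show "snd (vary_direction \<gamma> h t\<^sub>0 t\<^sub>1 p) \<bullet> snd (vary_direction \<gamma> h t\<^sub>0 t\<^sub>1 p) = 1"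
      by (rule vary_direction_sphere[OF p unit h(1)])
    have "snd (vary_direction \<gamma> h t\<^sub>0 t\<^sub>1 p) = k p *\<^sub>R snd (\<gamma> (snd p)) + b p *\<^sub>R h"
      by (simp add: vary_direction_def k_def b_def push_def scaleR_add_right)
    also have "\<dots> = k p *\<^sub>R abs_L2 (f (snd p)) + b p *\<^sub>R abs_L2 (f \<tau>)"
      using f(2)[of "snd p"] p h(2) by auto
    also have "\<dots> = abs_L2 (\<lambda>x. k p * f (snd p) x + b p * f \<tau> x)"
      by (rule smooth_family_lincomb(2)[OF open' k b fam p])
    finally show "snd (vary_direction \<gamma> h t\<^sub>0 t\<^sub>1 p) = abs_L2 (\<lambda>x. k p * f (snd p) x + b p * f \<tau> x)" .
  qed
qed

lemma smooth_into_S_Cinf_circle: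
  assumes x: "smooth_on UNIV x" and \<theta>: "smooth_on UNIV \<theta>" and e: "e\<^sub>1 \<in> smooth_L2 \<A>" "e\<^sub>2 \<in> smooth_L2 \<A>"
    and unit: "\<And>t::real. (cos (\<theta> t) *\<^sub>R e\<^sub>1 + sin (\<theta> t) *\<^sub>R e\<^sub>2) \<bullet> (cos (\<theta> t) *\<^sub>R e\<^sub>1 + sin (\<theta> t) *\<^sub>R e\<^sub>2) = 1"
  shows "smooth_into_S_Cinf \<A> UNIV (\<lambda>t. (x t, cos (\<theta> t) *\<^sub>R e\<^sub>1 + sin (\<theta> t) *\<^sub>R e\<^sub>2))"
proof -
  obtain f g where fg: "smooth_function \<A> f" "e\<^sub>1 = abs_L2 f" "smooth_function \<A> g" "e\<^sub>2 = abs_L2 g"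
    using e by (auto simp: smooth_L2_def)
  note cs = smooth_on_cos[OF open_UNIV \<theta>] smooth_on_sin[OF open_UNIV \<theta>]
  note fam = smooth_family_lincomb[OF open_UNIV cs smooth_family_const[OF fg(1)] smooth_family_const[OF fg(3)]]
  show ?thesis
  proof (rule smooth_into_S_CinfI[OF _ _ fam(1)])
    show "smooth_on UNIV (\<lambda>t. (x t, cos (\<theta> t) *\<^sub>R e\<^sub>1 + sin (\<theta> t) *\<^sub>R e\<^sub>2))"
      by (intro smooth_on_Pair smooth_on_add smooth_on_scaleR smooth_on_const cs x open_UNIV)
    show "snd (x t, cos (\<theta> t) *\<^sub>R e\<^sub>1 + sin (\<theta> t) *\<^sub>R e\<^sub>2) = abs_L2 (\<lambda>x. cos (\<theta> t) * f x + sin (\<theta> t) * g x)" for t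
      using fam(2)[of t] fg by simp
  qed (simp add: unit)
qed

end

context warping
begin

lemma geodesically_complete_S:
  "geodesically_complete smooth_into_S smooth_into_S (warped_metric a :: (real \<times> 'm::reference_measure L2) metric_tensor)"
proof (rule geodesically_completeI)
  have iff: "smooth_into_S D \<Phi> \<longleftrightarrow> smooth_on D \<Phi> \<and> (\<forall>p\<in>D. snd (\<Phi> p) \<bullet> snd (\<Phi> p) = 1)"
    for D and \<Phi> :: "'p::euclidean_space \<Rightarrow> real \<times> 'm L2"
    by (auto simp: smooth_into_S_def L2_sphere_def image_subset_iff mem_Times_iff)
  fix I :: "real set" and \<gamma> :: "real \<Rightarrow> real \<times> 'm L2" and t\<^sub>0 t\<^sub>1 :: real
  show "smooth_on I \<gamma> \<and> (\<forall>t\<in>I. snd (\<gamma> t) \<bullet> snd (\<gamma> t) = 1)" if "smooth_into_S I \<gamma>"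
    using that by (simp add: iff)
  show "smooth_on D \<Gamma> \<and> (\<forall>p\<in>D. snd (\<Gamma> p) \<bullet> snd (\<Gamma> p) = 1)" if "smooth_into_S D \<Gamma>"
    for D and \<Gamma> :: "real \<times> real \<Rightarrow> real \<times> 'm L2"
    using that by (simp add: iff)
  assume I: "open I" "smooth_into_S I \<gamma>"
  then have \<gamma>: "smooth_on I \<gamma>" "\<And>t. t \<in> I \<Longrightarrow> snd (\<gamma> t) \<bullet> snd (\<gamma> t) = 1" by (simp_all add: iff)
  show "smooth_into_S (strip I) (vary_radius \<gamma> t\<^sub>0 t\<^sub>1)"
    using smooth_vary_radius[OF I(1) \<gamma>(1)] \<gamma>(2) by (auto simp: iff vary_radius_def)
  show "smooth_into_S (strip I) (vary_direction \<gamma> (snd (\<gamma> \<tau>)) t\<^sub>0 t\<^sub>1)" if "\<tau> \<in> I" for \<tau>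
    using smooth_vary_direction[OF I(1) \<gamma> \<gamma>(2)[OF that]] vary_direction_sphere[OF _ \<gamma>(2) \<gamma>(2)[OF that]]
    by (simp add: iff)
  fix x \<theta> :: "real \<Rightarrow> real" and e
  assume "smooth_on UNIV x" "smooth_on UNIV \<theta>"
    and "\<And>t. (cos (\<theta> t) *\<^sub>R snd (\<gamma> t\<^sub>0) + sin (\<theta> t) *\<^sub>R e) \<bullet> (cos (\<theta> t) *\<^sub>R snd (\<gamma> t\<^sub>0) + sin (\<theta> t) *\<^sub>R e) = 1"
  then show "smooth_into_S UNIV (\<lambda>t. (x t, cos (\<theta> t) *\<^sub>R snd (\<gamma> t\<^sub>0) + sin (\<theta> t) *\<^sub>R e))"
    by (auto simp: iff intro!: smooth_on_Pair smooth_on_add smooth_on_scaleR smooth_on_const smooth_on_cos smooth_on_sin)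
qed

lemma geodesically_complete_S_Cinf:
  fixes \<A> :: "('m::{t2_space, second_countable_topology, reference_measure}, 'n::finite) chart set"
  assumes "density_manifold \<A>"
  shows "geodesically_complete (smooth_into_S_Cinf \<A>) (smooth_into_S_Cinf \<A>) (warped_metric a)"
proof -
  interpret density_manifold \<A> by fact
  show ?thesis
  proof (rule geodesically_completeI)
    fix I :: "real set" and \<gamma> :: "real \<Rightarrow> real \<times> 'm L2" and t\<^sub>0 and x \<theta> :: "real \<Rightarrow> real" and e
    assume \<gamma>: "smooth_into_S_Cinf \<A> I \<gamma>" and t0: "t\<^sub>0 \<in> I" and smooth: "smooth_on UNIV x" "smooth_on UNIV \<theta>"
      and unit: "\<And>t. (cos (\<theta> t) *\<^sub>R snd (\<gamma> t\<^sub>0) + sin (\<theta> t) *\<^sub>R e) \<bullet> (cos (\<theta> t) *\<^sub>R snd (\<gamma> t\<^sub>0) + sin (\<theta> t) *\<^sub>R e) = 1"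
      and e: "e \<in> span ((\<lambda>t. snd (\<gamma> t)) ` I)"
    have sub: "(\<lambda>t. snd (\<gamma> t)) ` I \<subseteq> smooth_L2 \<A>" using smooth_into_S_CinfD(3)[OF \<gamma>] by auto
    then have "e \<in> smooth_L2 \<A>" using span_minimal[OF sub subspace_smooth_L2] e by blast
    then show "smooth_into_S_Cinf \<A> UNIV (\<lambda>t. (x t, cos (\<theta> t) *\<^sub>R snd (\<gamma> t\<^sub>0) + sin (\<theta> t) *\<^sub>R e))"
      using sub t0 by (intro smooth_into_S_Cinf_circle smooth unit) auto
  qed (auto dest: smooth_into_S_CinfD intro: smooth_into_S_Cinf_vary_radius smooth_into_S_Cinf_vary_direction)
qed

end

section \<open>The geodesic distance\<close>

context warping
begin

definition speed :: "(real \<Rightarrow> real \<times> 'b::real_inner) \<Rightarrow> real \<Rightarrow> real" where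
  "speed \<gamma> t = sqrt (warped_metric a (\<gamma> t) (vector_derivative \<gamma> (at t)) (vector_derivative \<gamma> (at t)))"

lemma warped_metric_scale: "sqrt (warped_metric a p (c *\<^sub>R v) (c *\<^sub>R v)) = \<bar>c\<bar> * sqrt (warped_metric a p v v)"
proof -
  have "warped_metric a p (c *\<^sub>R v) (c *\<^sub>R v) = c\<^sup>2 * warped_metric a p v v"
    by (simp add: warped_metric_def power2_eq_square algebra_simps)
  then show ?thesis by (simp add: real_sqrt_mult)
qed

lemma a_continuous: "continuous_on S a"
  using smooth_on_continuous[OF smooth_a] continuous_on_subset by blast

text \<open>Outside a finite set the speed of a piecewise \<open>C\<^sup>1\<close> path is continuous. Setting it to
  zero on that set makes it measurable without changing the length.\<close>

definition speed_density :: "(real \<Rightarrow> real \<times> 'b::real_inner) \<Rightarrow> real set \<Rightarrow> (real \<Rightarrow> ennreal) \<Rightarrow> bool" where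
  "speed_density \<gamma> K F \<longleftrightarrow> finite K \<and> F \<in> borel_measurable borel \<and>
     (\<forall>t. F t = (if t \<in> {0<..<1} - K then ennreal (speed \<gamma> t) else 0)) \<and>
     (\<forall>t\<in>{0<..<1} - K. (\<gamma> has_vector_derivative vector_derivative \<gamma> (at t)) (at t)) \<and>
     path_length (warped_metric a) \<gamma> = (\<integral>\<^sup>+ t. F t \<partial>lborel)"

lemma speed_density_exists:
  fixes \<gamma> :: "real \<Rightarrow> real \<times> 'b::real_inner"
  assumes "valid_path \<gamma>"
  shows "\<exists>K F. speed_density \<gamma> K F"
proof -
  obtain K where K: "finite K" "\<gamma> C1_differentiable_on ({0..1} - K)" and \<gamma>: "continuous_on {0..1} \<gamma>"
    using assms by (auto simp: valid_path_def piecewise_C1_differentiable_on_def)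
  obtain D where D: "\<And>t. t \<in> {0..1} - K \<Longrightarrow> (\<gamma> has_vector_derivative D t) (at t)" "continuous_on ({0..1} - K) D"
    using K(2) unfolding C1_differentiable_on_def by blast
  define A where "A = {0<..<1} - K"
  have sub: "A \<subseteq> {0..1} - K" by (auto simp: A_def)
  have A: "A \<in> sets borel" unfolding A_def using K(1) by (intro sets.Diff borel_open borel_closed finite_imp_closed) auto
  have D_eq: "vector_derivative \<gamma> (at t) = D t" if "t \<in> A" for t
    using D(1) that sub by (intro vector_derivative_at) auto
  have cont: "continuous_on A \<gamma>" "continuous_on A D"
    using continuous_on_subset[OF \<gamma>] continuous_on_subset[OF D(2) sub] sub by auto
  have "continuous_on A (\<lambda>t. sqrt (warped_metric a (\<gamma> t) (D t) (D t)))"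
    unfolding warped_metric_def
    by (intro continuous_intros continuous_on_compose2[OF a_continuous[of UNIV]] cont) auto
  then have "continuous_on A (speed \<gamma>)"
    by (rule continuous_on_eq) (simp add: speed_def D_eq)
  from borel_measurable_continuous_on_indicator[OF A this]
  have "(\<lambda>t. ennreal (indicator A t *\<^sub>R speed \<gamma> t)) \<in> borel_measurable borel" by measurable
  moreover have "(\<lambda>t. ennreal (indicator A t *\<^sub>R speed \<gamma> t)) = (\<lambda>t. if t \<in> A then ennreal (speed \<gamma> t) else 0)"
    by (auto simp: indicator_def)
  ultimately have meas: "(\<lambda>t. if t \<in> A then ennreal (speed \<gamma> t) else 0) \<in> borel_measurable borel" by simp
  have "AE t in lborel. t \<notin> K \<union> {0, 1}"
    using K(1) by (intro AE_not_in finite_imp_null_set_lborel) simp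
  then have "path_length (warped_metric a) \<gamma> = (\<integral>\<^sup>+ t. (if t \<in> A then ennreal (speed \<gamma> t) else 0) \<partial>lborel)"
    unfolding path_length_def speed_def[symmetric]
  proof (intro nn_integral_cong_AE, elim eventually_mono)
    fix t assume "t \<notin> K \<union> {0, 1}"
    then show "ennreal (speed \<gamma> t) * indicator {0..1} t = (if t \<in> A then ennreal (speed \<gamma> t) else 0)"
      by (auto simp: A_def indicator_def)
  qed
  then show ?thesis
    using K(1) meas D D_eq sub unfolding speed_density_def
    by (intro exI[of _ K] exI[of _ "\<lambda>t. if t \<in> A then ennreal (speed \<gamma> t) else 0"]) (auto simp: A_def)
qed

lemma speed_densityD:
  assumes "speed_density \<gamma> K F"
  shows "finite K" "F \<in> borel_measurable borel" "F t = (if t \<in> {0<..<1} - K then ennreal (speed \<gamma> t) else 0)"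
    "t \<in> {0<..<1} - K \<Longrightarrow> (\<gamma> has_vector_derivative vector_derivative \<gamma> (at t)) (at t)"
    "path_length (warped_metric a) \<gamma> = (\<integral>\<^sup>+ t. F t \<partial>lborel)"
  using assms unfolding speed_density_def by blast+

lemma path_length_reversepath:
  fixes \<gamma> :: "real \<Rightarrow> real \<times> 'b::real_inner"
  assumes "valid_path \<gamma>"
  shows "path_length (warped_metric a) (reversepath \<gamma>) = path_length (warped_metric a) \<gamma>"
proof -
  obtain K F where "speed_density \<gamma> K F"
    using speed_density_exists[OF assms] by blast
  note F = speed_densityD[OF this]
  have sp: "speed (reversepath \<gamma>) t = speed \<gamma> (1 - t)" if t: "1 - t \<in> {0<..<1} - K" for t
  proof -
    have "((\<lambda>t. 1 - t) has_vector_derivative - 1) (at t)"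
      by (auto intro!: derivative_eq_intros)
    from vector_diff_chain_at[OF this F(4)[OF t]]
    have "(reversepath \<gamma> has_vector_derivative - 1 *\<^sub>R vector_derivative \<gamma> (at (1 - t))) (at t)"
      by (simp add: o_def reversepath_def)
    then show ?thesis
      using warped_metric_scale[of "\<gamma> (1 - t)" "-1" "vector_derivative \<gamma> (at (1 - t))"]
      by (simp add: speed_def vector_derivative_at reversepath_def)
  qed
  have "AE t in lborel. t \<notin> (\<lambda>s. 1 - s) ` (K \<union> {0, 1})"
    using F(1) by (intro AE_not_in finite_imp_null_set_lborel) simp
  then have "path_length (warped_metric a) (reversepath \<gamma>) = (\<integral>\<^sup>+ t. F (1 + (-1) * t) \<partial>lborel)"
    unfolding path_length_def
  proof (intro nn_integral_cong_AE, elim eventually_mono)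
    fix t assume "t \<notin> (\<lambda>s. 1 - s) ` (K \<union> {0, 1})"
    then have "1 - t \<notin> K \<union> {0, 1}" by force
    then show "ennreal (sqrt (warped_metric a (reversepath \<gamma> t) (vector_derivative (reversepath \<gamma>) (at t))
        (vector_derivative (reversepath \<gamma>) (at t)))) * indicator {0..1} t = F (1 + (-1) * t)"
      using sp[of t] by (auto simp: F(3) speed_def indicator_def)
  qed
  also have "\<dots> = (\<integral>\<^sup>+ t. F t \<partial>lborel)"
    using nn_integral_real_affine[OF F(2), of "-1" 1] by simp
  finally show ?thesis using F(5) by simp
qed

lemma path_length_join:
  fixes \<gamma>\<^sub>1 \<gamma>\<^sub>2 :: "real \<Rightarrow> real \<times> 'b::real_inner"
  assumes "valid_path \<gamma>\<^sub>1" "valid_path \<gamma>\<^sub>2"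
  shows "path_length (warped_metric a) (\<gamma>\<^sub>1 +++ \<gamma>\<^sub>2) = path_length (warped_metric a) \<gamma>\<^sub>1 + path_length (warped_metric a) \<gamma>\<^sub>2"
proof -
  obtain K F where "speed_density \<gamma>\<^sub>1 K F"
    using speed_density_exists[OF assms(1)] by blast
  note F = speed_densityD[OF this]
  obtain L H where "speed_density \<gamma>\<^sub>2 L H"
    using speed_density_exists[OF assms(2)] by blast
  note H = speed_densityD[OF this]
  let ?\<gamma> = "\<gamma>\<^sub>1 +++ \<gamma>\<^sub>2"
  note [measurable] = F(2) H(2)
  have sp1: "speed ?\<gamma> t = 2 * speed \<gamma>\<^sub>1 (2 * t)" if t: "2 * t \<in> {0<..<1} - K" for t
  proof -
    have "((\<lambda>t. 2 * t) has_vector_derivative 2) (at t)"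
      by (auto intro!: derivative_eq_intros)
    from vector_diff_chain_at[OF this F(4)[OF t]]
    have "((\<lambda>t. \<gamma>\<^sub>1 (2 * t)) has_vector_derivative 2 *\<^sub>R vector_derivative \<gamma>\<^sub>1 (at (2 * t))) (at t)"
      by (simp add: o_def)
    then have "(?\<gamma> has_vector_derivative 2 *\<^sub>R vector_derivative \<gamma>\<^sub>1 (at (2 * t))) (at t)"
      by (rule has_vector_derivative_transform_within_open[where S = "{..<1/2}"]) (use t in \<open>auto simp: joinpaths_def\<close>)
    moreover have "?\<gamma> t = \<gamma>\<^sub>1 (2 * t)" using t by (simp add: joinpaths_def)
    ultimately show ?thesis
      using warped_metric_scale[of "\<gamma>\<^sub>1 (2 * t)" 2] by (simp add: speed_def vector_derivative_at)
  qed
  have sp2: "speed ?\<gamma> t = 2 * speed \<gamma>\<^sub>2 (2 * t - 1)" if t: "2 * t - 1 \<in> {0<..<1} - L" for t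
  proof -
    have "((\<lambda>t. 2 * t - 1) has_vector_derivative 2) (at t)"
      by (auto intro!: derivative_eq_intros)
    from vector_diff_chain_at[OF this H(4)[OF t]]
    have "((\<lambda>t. \<gamma>\<^sub>2 (2 * t - 1)) has_vector_derivative 2 *\<^sub>R vector_derivative \<gamma>\<^sub>2 (at (2 * t - 1))) (at t)"
      by (simp add: o_def)
    then have "(?\<gamma> has_vector_derivative 2 *\<^sub>R vector_derivative \<gamma>\<^sub>2 (at (2 * t - 1))) (at t)"
      by (rule has_vector_derivative_transform_within_open[where S = "{1/2<..}"]) (use t in \<open>auto simp: joinpaths_def\<close>)
    moreover have "?\<gamma> t = \<gamma>\<^sub>2 (2 * t - 1)" using t by (simp add: joinpaths_def)
    ultimately show ?thesis
      using warped_metric_scale[of "\<gamma>\<^sub>2 (2 * t - 1)" 2] by (simp add: speed_def vector_derivative_at)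
  qed
  have "AE t in lborel. t \<notin> (\<lambda>s. s / 2) ` (K \<union> {0, 1}) \<union> (\<lambda>s. (s + 1) / 2) ` (L \<union> {0, 1})"
    using F(1) H(1) by (intro AE_not_in finite_imp_null_set_lborel) simp
  then have "path_length (warped_metric a) ?\<gamma> = (\<integral>\<^sup>+ t. 2 * F (0 + 2 * t) + 2 * H (-1 + 2 * t) \<partial>lborel)"
    unfolding path_length_def
  proof (intro nn_integral_cong_AE, elim eventually_mono)
    fix t assume "t \<notin> (\<lambda>s. s / 2) ` (K \<union> {0, 1}) \<union> (\<lambda>s. (s + 1) / 2) ` (L \<union> {0, 1})"
    then have *: "2 * t \<notin> K \<union> {0, 1}" "2 * t - 1 \<notin> L \<union> {0, 1}"
      using imageI[of "2 * t" "K \<union> {0, 1}" "\<lambda>s. s / 2"] imageI[of "2 * t - 1" "L \<union> {0, 1}" "\<lambda>s. (s + 1) / 2"] by auto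
    have "ennreal (speed ?\<gamma> t) * indicator {0..1} t = 2 * F (2 * t) + 2 * H (2 * t - 1)"
    proof (cases "t \<in> {0<..<1/2}")
      case True
      then have "ennreal (speed ?\<gamma> t) = 2 * F (2 * t)" "H (2 * t - 1) = 0"
        using sp1[of t] * by (auto simp: F(3) H(3) ennreal_mult')
      then show ?thesis using True by simp
    next
      case False
      show ?thesis
      proof (cases "t \<in> {1/2<..<1}")
        case True
        then have "ennreal (speed ?\<gamma> t) = 2 * H (2 * t - 1)" "F (2 * t) = 0"
          using sp2[of t] * by (auto simp: F(3) H(3) ennreal_mult')
        then show ?thesis using True by simp
      next
        case False
        with \<open>t \<notin> {0<..<1/2}\<close> * have "t < 0 \<or> 1 < t" by auto
        then show ?thesis by (auto simp: F(3) H(3))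
      qed
    qed
    then show "ennreal (sqrt (warped_metric a (?\<gamma> t) (vector_derivative ?\<gamma> (at t)) (vector_derivative ?\<gamma> (at t))))
        * indicator {0..1} t = 2 * F (0 + 2 * t) + 2 * H (-1 + 2 * t)"
      by (simp add: speed_def)
  qed
  also have "(\<integral>\<^sup>+ t. 2 * F (0 + 2 * t) + 2 * H (-1 + 2 * t) \<partial>lborel) = (\<integral>\<^sup>+ t. 2 * F (0 + 2 * t) \<partial>lborel) + (\<integral>\<^sup>+ t. 2 * H (-1 + 2 * t) \<partial>lborel)"
    by (intro nn_integral_add) measurable
  also have "(\<integral>\<^sup>+ t. 2 * F (0 + 2 * t) \<partial>lborel) = 2 * (\<integral>\<^sup>+ t. F (0 + 2 * t) \<partial>lborel)"
    by (intro nn_integral_cmult) measurable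
  also have "(\<integral>\<^sup>+ t. 2 * H (-1 + 2 * t) \<partial>lborel) = 2 * (\<integral>\<^sup>+ t. H (-1 + 2 * t) \<partial>lborel)"
    by (intro nn_integral_cmult) measurable
  finally show ?thesis
    using nn_integral_real_affine[OF F(2), of 2 0] nn_integral_real_affine[OF H(2), of 2 "-1"] F(5) H(5) by simp
qed

text \<open>The derivative of a piecewise \<open>C\<^sup>1\<close> path may be unbounded near the exceptional points. It always has
  a gauge integral, equal to the displacement, and if the length is finite this integral is dominated
  by that of the Lebesgue integrable speed.\<close>

lemma displacement_bound:
  fixes g g' h :: "real \<Rightarrow> real"
  assumes g: "continuous_on {0..1} g" and K: "finite K"
    and g': "\<And>s. s \<in> {0<..<1} - K \<Longrightarrow> (g has_real_derivative g' s) (at s)" "\<And>s. s \<in> {0<..<1} - K \<Longrightarrow> \<bar>g' s\<bar> \<le> h s"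
    and F: "F \<in> borel_measurable borel" "\<And>s. F s = (if s \<in> {0<..<1} - K then ennreal (h s) else 0)"
    and l: "(\<integral>\<^sup>+ s. F s \<partial>lborel) \<le> ennreal l" "0 \<le> l" and t: "t \<in> {0..1}"
  shows "\<bar>g t - g 0\<bar> \<le> l"
proof -
  define H where "H s = enn2real (F s)" for s
  have H: "H s = (if s \<in> {0<..<1} - K then h s else 0)" for s
    using g'(2)[of s] by (auto simp: H_def F(2) intro: order_trans[OF abs_ge_zero])
  have F_H: "F s = ennreal (H s)" for s by (simp add: H F(2))
  have H_meas: "H \<in> borel_measurable lborel" unfolding H_def using F(1) by measurable
  have H_nonneg: "0 \<le> H s" for s by (simp add: H_def)
  have fin: "(\<integral>\<^sup>+ s. ennreal (H s) \<partial>lborel) \<le> ennreal l" using l(1) by (simp add: F_H)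
  have H_int: "integrable lborel H"
    using fin by (intro integrableI_nonneg H_meas) (auto simp: H_nonneg intro: le_less_trans)
  have HU: "(H has_integral integral\<^sup>L lborel H) UNIV" by (rule has_integral_integral_lborel[OF H_int])
  have "integral\<^sup>L lborel H \<le> l"
    using fin nn_integral_eq_integral[OF H_int] H_nonneg l(2) by (simp add: ennreal_le_iff)
  moreover have H_t: "H integrable_on {0..t}" by (rule integrable_on_subcbox[OF has_integral_integrable[OF HU], of 0 t, simplified])
  then have "integral {0..t} H \<le> integral UNIV H"
    using HU H_nonneg by (intro integral_subset_le) auto
  ultimately have le: "integral {0..t} H \<le> l" using HU by (simp add: integral_unique)
  define G where "G s = (if s \<in> {0<..<1} - K then g' s else 0)" for s
  have "(G has_integral (g t - g 0)) {0..t}"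
  proof (rule fundamental_theorem_of_calculus_interior_strong[OF K])
    show "(g has_vector_derivative G s) (at s)" if "s \<in> {0<..<t} - K" for s
      using g'(1)[of s] that t by (auto simp: G_def has_real_derivative_iff_has_vector_derivative)
    show "continuous_on {0..t} g" using g t by (auto elim: continuous_on_subset)
  qed (use t in auto)
  moreover have "norm (G s) \<le> H s" for s using g'(2)[of s] by (auto simp: G_def H)
  ultimately have "norm (g t - g 0) \<le> integral {0..t} H"
    using integral_norm_bound_integral[of G "{0..t}" H] H_t by (auto simp: integral_unique has_integral_integrable)
  with le show ?thesis by simp
qed

lemma path_length_ge_radial:
  fixes \<gamma> :: "real \<Rightarrow> real \<times> 'b::real_inner"
  assumes \<gamma>: "valid_path \<gamma>" and l: "path_length (warped_metric a) \<gamma> \<le> ennreal l" "0 \<le> l" and t: "t \<in> {0..1}"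
  shows "\<bar>fst (\<gamma> t) - fst (\<gamma> 0)\<bar> \<le> l"
proof -
  obtain K F where "speed_density \<gamma> K F"
    using speed_density_exists[OF \<gamma>] by blast
  note F = speed_densityD[OF this]
  have cont: "continuous_on {0..1} \<gamma>" using valid_path_imp_path[OF \<gamma>] by (simp add: path_def)
  show ?thesis
  proof (rule displacement_bound[OF _ F(1) _ _ F(2,3) _ l(2) t])
    show "continuous_on {0..1} (\<lambda>t. fst (\<gamma> t))" by (intro continuous_intros cont)
    show "((\<lambda>t. fst (\<gamma> t)) has_real_derivative fst (vector_derivative \<gamma> (at s))) (at s)" if "s \<in> {0<..<1} - K" for s
      using fst_has_derivative[OF F(4)[OF that]] .
    show "\<bar>fst (vector_derivative \<gamma> (at s))\<bar> \<le> speed \<gamma> s" for s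
      unfolding speed_def warped_metric_def using a_pos[of "fst (\<gamma> s)"]
      by (intro real_le_rsqrt) (simp add: power2_eq_square)
  qed (use l(1) F(5) in simp)
qed

text \<open>The path stays within radial distance \<open>l\<close> of its starting point, where \<open>a\<close> is at least \<open>m\<^sup>2\<close>.\<close>

lemma path_length_ge_angular:
  fixes \<gamma> :: "real \<Rightarrow> real \<times> 'b::real_inner"
  assumes \<gamma>: "valid_path \<gamma>" and l: "path_length (warped_metric a) \<gamma> \<le> ennreal l" "0 \<le> l"
    and m: "0 < m" "\<And>s. \<bar>s - fst (\<gamma> 0)\<bar> \<le> l \<Longrightarrow> m\<^sup>2 \<le> a s"
  shows "m * norm (snd (\<gamma> 1) - snd (\<gamma> 0)) \<le> l"
proof -
  obtain K F where "speed_density \<gamma> K F"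
    using speed_density_exists[OF \<gamma>] by blast
  note F = speed_densityD[OF this]
  have cont: "continuous_on {0..1} \<gamma>" using valid_path_imp_path[OF \<gamma>] by (simp add: path_def)
  \<comment> \<open>The displacement is measured along its own direction, which reduces it to a real function.\<close>
  define w where "w = sgn (snd (\<gamma> 1) - snd (\<gamma> 0))"
  have w: "norm w \<le> 1" "w \<bullet> (snd (\<gamma> 1) - snd (\<gamma> 0)) = norm (snd (\<gamma> 1) - snd (\<gamma> 0))"
    by (simp add: w_def norm_sgn,
        cases "snd (\<gamma> 1) - snd (\<gamma> 0) = 0") (simp_all add: w_def sgn_div_norm dot_square_norm power2_eq_square)
  have "\<bar>m * (w \<bullet> snd (\<gamma> 1)) - m * (w \<bullet> snd (\<gamma> 0))\<bar> \<le> l"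
  proof (rule displacement_bound[OF _ F(1) _ _ F(2,3) _ l(2), where t = 1])
    show "continuous_on {0..1} (\<lambda>t. m * (w \<bullet> snd (\<gamma> t)))" by (intro continuous_intros cont)
    fix s assume s: "s \<in> {0<..<1} - K"
    define v where "v = vector_derivative \<gamma> (at s)"
    show "((\<lambda>t. m * (w \<bullet> snd (\<gamma> t))) has_real_derivative m * (w \<bullet> snd (vector_derivative \<gamma> (at s)))) (at s)"
      using DERIV_cmult[OF inner_has_derivative[OF has_vector_derivative_const
          snd_has_derivative[OF F(4)[OF s]]], of m w] by simp
    have "\<bar>w \<bullet> snd v\<bar> \<le> norm w * norm (snd v)" by (rule Cauchy_Schwarz_ineq2)
    also have "\<dots> \<le> 1 * norm (snd v)" by (intro mult_right_mono w) simp
    finally have "\<bar>m * (w \<bullet> snd v)\<bar> \<le> m * norm (snd v)" using m(1) by (simp add: abs_mult)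
    also have "\<dots> \<le> speed \<gamma> s"
      unfolding speed_def warped_metric_def v_def[symmetric]
    proof (rule real_le_rsqrt)
      have "m\<^sup>2 \<le> a (fst (\<gamma> s))"
        using s path_length_ge_radial[OF \<gamma> l] by (intro m(2)) auto
      then have "m\<^sup>2 * (snd v \<bullet> snd v) \<le> a (fst (\<gamma> s)) * (snd v \<bullet> snd v)" by (intro mult_right_mono) auto
      then show "(m * norm (snd v))\<^sup>2 \<le> a (fst (\<gamma> s)) * (snd v \<bullet> snd v) + fst v * fst v"
        by (simp add: power_mult_distrib power2_norm_eq_inner add_increasing2)
    qed
    finally show "\<bar>m * (w \<bullet> snd (vector_derivative \<gamma> (at s)))\<bar> \<le> speed \<gamma> s" by (simp add: v_def)
  qed (use l(1) F(5) in simp_all)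
  also have "m * (w \<bullet> snd (\<gamma> 1)) - m * (w \<bullet> snd (\<gamma> 0)) = m * norm (snd (\<gamma> 1) - snd (\<gamma> 0))"
    using w(2) by (simp add: inner_diff_right flip: right_diff_distrib)
  finally show ?thesis by simp
qed

text \<open>If \<open>\<psi>\<close> is \<open>\<phi>\<close> or \<open>-\<phi>\<close>, the two points do not determine a plane, and the vector provided by \<open>orth\<close>
  spans one with \<open>\<phi>\<close>.\<close>

lemma great_circle:
  fixes \<phi> \<psi> :: "'b::real_inner"
  assumes unit: "\<phi> \<bullet> \<phi> = 1" "\<psi> \<bullet> \<psi> = 1" and orth: "\<exists>e. e \<bullet> e = 1 \<and> \<phi> \<bullet> e = 0"
  defines "\<alpha> \<equiv> arccos (\<phi> \<bullet> \<psi>)"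
  shows "\<exists>e. e \<bullet> e = 1 \<and> \<phi> \<bullet> e = 0 \<and> cos \<alpha> *\<^sub>R \<phi> + sin \<alpha> *\<^sub>R e = \<psi>"
proof -
  have "\<bar>\<phi> \<bullet> \<psi>\<bar> \<le> norm \<phi> * norm \<psi>" by (rule Cauchy_Schwarz_ineq2)
  then have c: "cos \<alpha> = \<phi> \<bullet> \<psi>"
    unfolding \<alpha>_def using unit by (intro cos_arccos_abs) (simp add: norm_eq_sqrt_inner)
  define u where "u = \<psi> - cos \<alpha> *\<^sub>R \<phi>"
  have "u \<bullet> u = 1 - (cos \<alpha>)\<^sup>2"
    using unit by (simp add: u_def inner_diff_left inner_diff_right inner_commute[of \<psi> \<phi>] power2_eq_square flip: c)
  then have uu: "u \<bullet> u = (sin \<alpha>)\<^sup>2" by (simp add: sin_squared_eq)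
  have \<phi>u: "\<phi> \<bullet> u = 0" using unit by (simp add: u_def inner_diff_right flip: c)
  show ?thesis
  proof (cases "sin \<alpha> = 0")
    case True
    then have "u = 0" using uu by simp
    then show ?thesis using orth True by (auto simp: u_def)
  next
    case False
    then show ?thesis
      using uu \<phi>u by (intro exI[of _ "(1 / sin \<alpha>) *\<^sub>R u"]) (simp add: power2_eq_square, simp add: u_def)
  qed
qed

abbreviation sphere_product :: "(real \<times> 'b::real_inner) set" where
  "sphere_product \<equiv> UNIV \<times> {\<phi>. \<phi> \<bullet> \<phi> = 1}"

definition paths :: "real \<times> 'b::real_inner \<Rightarrow> real \<times> 'b \<Rightarrow> (real \<Rightarrow> real \<times> 'b) set" where
  "paths p q = {\<gamma>. valid_path \<gamma> \<and> path_image \<gamma> \<subseteq> sphere_product \<and> pathstart \<gamma> = p \<and> pathfinish \<gamma> = q}"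

abbreviation distance :: "real \<times> 'b::real_inner \<Rightarrow> real \<times> 'b \<Rightarrow> real" where
  "distance \<equiv> geodesic_dist sphere_product (warped_metric a)"

lemma distance_eq: "distance p q = enn2real (INF \<gamma>\<in>paths p q. path_length (warped_metric a) \<gamma>)"
  by (simp add: geodesic_dist_def paths_def)

text \<open>The great circle is traversed at constant angular speed while the radial coordinate moves linearly.\<close>

lemma short_path:
  fixes p q :: "real \<times> 'b::real_inner"
  assumes p: "p \<in> sphere_product" and q: "q \<in> sphere_product"
    and orth: "\<exists>e. e \<bullet> e = 1 \<and> snd p \<bullet> e = 0"
    and A: "0 \<le> A" "\<And>s. s \<in> closed_segment (fst p) (fst q) \<Longrightarrow> a s \<le> A\<^sup>2"
  shows "\<exists>\<gamma>\<in>paths p q. path_length (warped_metric a) \<gamma> \<le> ennreal (A * arccos (snd p \<bullet> snd q) + \<bar>fst q - fst p\<bar>)"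
proof -
  define \<alpha> where "\<alpha> = arccos (snd p \<bullet> snd q)"
  have unit: "snd p \<bullet> snd p = 1" "snd q \<bullet> snd q = 1" using p q by auto
  obtain e where e: "e \<bullet> e = 1" "snd p \<bullet> e = 0" "cos \<alpha> *\<^sub>R snd p + sin \<alpha> *\<^sub>R e = snd q"
    using great_circle[OF unit orth] unfolding \<alpha>_def by blast
  have "\<bar>snd p \<bullet> snd q\<bar> \<le> norm (snd p) * norm (snd q)" by (rule Cauchy_Schwarz_ineq2)
  then have "\<bar>snd p \<bullet> snd q\<bar> \<le> 1" using unit by (simp add: norm_eq_sqrt_inner)
  then have \<alpha>0: "0 \<le> \<alpha>" unfolding \<alpha>_def by (intro arccos_lbound) auto
  define c where "c t = cos (\<alpha> * t) *\<^sub>R snd p + sin (\<alpha> * t) *\<^sub>R e" for t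
  define d where "d t = cos (\<alpha> * t) *\<^sub>R e - sin (\<alpha> * t) *\<^sub>R snd p" for t
  have dd: "d t \<bullet> d t = 1" and cc: "c t \<bullet> c t = 1" for t
  proof -
    have "d t \<bullet> d t = cos (\<alpha> * t) * cos (\<alpha> * t) + sin (\<alpha> * t) * sin (\<alpha> * t)"
      "c t \<bullet> c t = cos (\<alpha> * t) * cos (\<alpha> * t) + sin (\<alpha> * t) * sin (\<alpha> * t)"
      using e unit by (simp_all add: c_def d_def inner_add_left inner_add_right inner_diff_left inner_diff_right inner_commute)
    then show "d t \<bullet> d t = 1" "c t \<bullet> c t = 1" using sin_cos_squared_add3[of "\<alpha> * t"] by simp_all
  qed
  define \<gamma> where "\<gamma> t = (fst p + t * (fst q - fst p), c t)" for t
  define D where "D t = (fst q - fst p, \<alpha> *\<^sub>R d t)" for t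
  have "((\<lambda>t. \<alpha> * t) has_real_derivative \<alpha>) (at t)" for t by (auto intro!: derivative_eq_intros)
  then have "(c has_vector_derivative \<alpha> *\<^sub>R d t) (at t)" for t
    unfolding c_def d_def by (rule rotating_frame(1))
  then have \<gamma>': "(\<gamma> has_vector_derivative D t) (at t)" for t
    unfolding \<gamma>_def D_def
    by (intro has_vector_derivative_Pair) (auto intro!: derivative_eq_intros simp flip: has_real_derivative_iff_has_vector_derivative)
  have "continuous_on {0..1} D"
    unfolding D_def d_def by (intro continuous_intros)
  then have "\<gamma> C1_differentiable_on {0..1}"
    unfolding C1_differentiable_on_def using \<gamma>' by blast
  then have "valid_path \<gamma>" by (simp add: valid_path_def C1_differentiable_imp_piecewise)
  moreover have "path_image \<gamma> \<subseteq> sphere_product" by (auto simp: path_image_def \<gamma>_def cc)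
  moreover have "pathstart \<gamma> = p" "pathfinish \<gamma> = q"
    using e(3) by (simp_all add: pathstart_def pathfinish_def \<gamma>_def c_def)
  ultimately have "\<gamma> \<in> paths p q" by (simp add: paths_def)
  moreover have "path_length (warped_metric a) \<gamma> \<le> ennreal (A * \<alpha> + \<bar>fst q - fst p\<bar>)"
  proof -
    let ?C = "A * \<alpha> + \<bar>fst q - fst p\<bar>"
    have C: "0 \<le> ?C" using A \<alpha>0 by simp
    have speed: "speed \<gamma> t \<le> ?C" if t: "t \<in> {0..1}" for t
    proof -
      have "fst (\<gamma> t) \<in> closed_segment (fst p) (fst q)"
        using t by (auto simp: closed_segment_def \<gamma>_def algebra_simps intro!: exI[of _ t])
      then have "a (fst (\<gamma> t)) * \<alpha>\<^sup>2 \<le> A\<^sup>2 * \<alpha>\<^sup>2" by (intro mult_right_mono A) auto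
      then have "warped_metric a (\<gamma> t) (D t) (D t) \<le> A\<^sup>2 * \<alpha>\<^sup>2 + \<bar>fst q - fst p\<bar>\<^sup>2"
        by (simp add: warped_metric_def D_def dd power2_eq_square)
      also have "\<dots> \<le> ?C\<^sup>2"
        using A \<alpha>0 by (simp add: power2_sum power_mult_distrib)
      finally show ?thesis
        unfolding speed_def vector_derivative_at[OF \<gamma>'] by (rule real_le_lsqrt[OF C])
    qed
    have "path_length (warped_metric a) \<gamma> \<le> (\<integral>\<^sup>+ t. ennreal ?C * indicator {0..1::real} t \<partial>lborel)"
      unfolding path_length_def speed_def[symmetric]
      by (rule nn_integral_mono) (auto simp: indicator_def intro!: ennreal_leI speed)
    also have "\<dots> = ennreal ?C" by (simp add: nn_integral_cmult_indicator)
    finally show ?thesis .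
  qed
  ultimately show ?thesis unfolding \<alpha>_def by blast
qed

end

text \<open>The second parameter only selects the Hilbert space to which the two hypotheses refer.\<close>

locale warped_sphere = warping a for a :: "real \<Rightarrow> real" +
  fixes hilbert :: "'b::real_inner itself"
  assumes orth: "\<And>\<phi> :: 'b. \<exists>e. e \<bullet> e = 1 \<and> \<phi> \<bullet> e = 0"
    and complete: "\<And>X :: nat \<Rightarrow> 'b. Cauchy X \<Longrightarrow> convergent X"
begin

lemma a_upper:
  assumes "compact T" shows "\<exists>A\<ge>0. \<forall>s\<in>T. a s \<le> A\<^sup>2"
proof -
  have "bounded (a ` T)" by (intro compact_imp_bounded compact_continuous_image a_continuous assms)
  then obtain B where B: "\<And>s. s \<in> T \<Longrightarrow> \<bar>a s\<bar> \<le> B" by (auto simp: bounded_iff)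
  then have "a s \<le> (sqrt \<bar>B\<bar>)\<^sup>2" if "s \<in> T" for s using B[OF that] by simp
  then show ?thesis by (intro exI[of _ "sqrt \<bar>B\<bar>"]) simp
qed

lemma a_lower:
  assumes "compact T" "T \<noteq> {}" shows "\<exists>m>0. \<forall>s\<in>T. m\<^sup>2 \<le> a s"
proof -
  obtain s0 where "s0 \<in> T" "\<And>s. s \<in> T \<Longrightarrow> a s0 \<le> a s"
    using continuous_attains_inf[OF assms a_continuous] by blast
  then show ?thesis using a_pos[of s0] by (intro exI[of _ "sqrt (a s0)"]) (simp add: less_imp_le)
qed

lemma distance_le_path:
  fixes p q :: "real \<times> 'b"
  assumes "\<gamma> \<in> paths p q" "path_length (warped_metric a) \<gamma> \<le> ennreal l" "0 \<le> l"
  shows "distance p q \<le> l"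
proof -
  have "(INF \<gamma>\<in>paths p q. path_length (warped_metric a) \<gamma>) \<le> ennreal l"
    using assms(1,2) by (intro INF_lower2)
  then show ?thesis unfolding distance_eq by (rule enn2real_leI[OF assms(3)])
qed

text \<open>The infimum of the lengths is finite because a connecting path of finite length exists. Otherwise
  \<open>enn2real\<close> would return the value \<open>0\<close> by convention, and the distance would carry no information.\<close>

lemma near_optimal_path:
  fixes p q :: "real \<times> 'b"
  assumes p: "p \<in> sphere_product" and q: "q \<in> sphere_product" and "0 < \<epsilon>"
  shows "\<exists>\<gamma>\<in>paths p q. path_length (warped_metric a) \<gamma> \<le> ennreal (distance p q + \<epsilon>)"
proof -
  let ?I = "INF \<gamma>\<in>paths p q. path_length (warped_metric a) \<gamma>"
  obtain A where "0 \<le> A" "\<forall>s\<in>closed_segment (fst p) (fst q). a s \<le> A\<^sup>2"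
    using a_upper[OF compact_segment] by blast
  then obtain \<gamma> where \<gamma>: "\<gamma> \<in> paths p q"
      "path_length (warped_metric a) \<gamma> \<le> ennreal (A * arccos (snd p \<bullet> snd q) + \<bar>fst q - fst p\<bar>)"
    using short_path[OF p q orth] by blast
  have "?I \<le> path_length (warped_metric a) \<gamma>" by (rule INF_lower[OF \<gamma>(1)])
  also have "\<dots> < \<infinity>" using \<gamma>(2) by (auto intro: le_less_trans)
  finally have "?I = ennreal (distance p q)" unfolding distance_eq by simp
  also have "\<dots> < ennreal (distance p q + \<epsilon>)"
    using \<open>0 < \<epsilon>\<close> by (simp add: distance_eq ennreal_less_iff)
  finally show ?thesis by (auto simp: INF_less_iff intro: less_imp_le)
qed

lemma distance_nonneg: "0 \<le> distance p q"
  by (simp add: distance_eq)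

lemma distance_upper:
  fixes p q :: "real \<times> 'b"
  assumes p: "p \<in> sphere_product" and q: "q \<in> sphere_product"
    and A: "0 \<le> A" "\<And>s. s \<in> closed_segment (fst p) (fst q) \<Longrightarrow> a s \<le> A\<^sup>2"
  shows "distance p q \<le> A * arccos (snd p \<bullet> snd q) + \<bar>fst q - fst p\<bar>"
proof -
  have "\<bar>snd p \<bullet> snd q\<bar> \<le> norm (snd p) * norm (snd q)" by (rule Cauchy_Schwarz_ineq2)
  then have "\<bar>snd p \<bullet> snd q\<bar> \<le> 1" using p q by (auto simp: norm_eq_sqrt_inner)
  then have "0 \<le> arccos (snd p \<bullet> snd q)" by (intro arccos_lbound) auto
  then show ?thesis
    using short_path[OF p q orth A] A(1) by (auto intro: distance_le_path)
qed

lemma radial_le_distance: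
  fixes p q :: "real \<times> 'b"
  assumes p: "p \<in> sphere_product" and q: "q \<in> sphere_product"
  shows "\<bar>fst q - fst p\<bar> \<le> distance p q"
proof (rule field_le_epsilon)
  fix \<epsilon> :: real assume "0 < \<epsilon>"
  then obtain \<gamma> where "\<gamma> \<in> paths p q" "path_length (warped_metric a) \<gamma> \<le> ennreal (distance p q + \<epsilon>)"
    using near_optimal_path[OF p q] by blast
  then show "\<bar>fst q - fst p\<bar> \<le> distance p q + \<epsilon>"
    using path_length_ge_radial[of \<gamma> "distance p q + \<epsilon>" 1] distance_nonneg[of p q] \<open>0 < \<epsilon>\<close>
    by (auto simp: paths_def pathstart_def pathfinish_def)
qed

lemma angular_le_distance:
  fixes p q :: "real \<times> 'b"
  assumes p: "p \<in> sphere_product" and q: "q \<in> sphere_product"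
    and m: "0 < m" "\<And>s. \<bar>s - fst p\<bar> \<le> l \<Longrightarrow> m\<^sup>2 \<le> a s" and l: "distance p q < l"
  shows "m * norm (snd q - snd p) \<le> distance p q"
proof (rule dense_ge_bounded[OF l])
  fix e assume e: "distance p q < e" "e < l"
  then obtain \<gamma> where "\<gamma> \<in> paths p q" "path_length (warped_metric a) \<gamma> \<le> ennreal e"
    using near_optimal_path[OF p q, of "e - distance p q"] by auto
  then show "m * norm (snd q - snd p) \<le> e"
    using path_length_ge_angular[of \<gamma> e m] distance_nonneg[of p q] e m
    by (auto simp: paths_def pathstart_def pathfinish_def)
qed

lemma distance_commute:
  fixes p q :: "real \<times> 'b"
  shows "distance p q = distance q p"
proof -
  have "(INF \<gamma>\<in>paths q p. path_length (warped_metric a) \<gamma>) \<le> (INF \<gamma>\<in>paths p q. path_length (warped_metric a) \<gamma>)"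
    for p q :: "real \<times> 'b"
  proof (rule INF_greatest)
    fix \<gamma> assume "\<gamma> \<in> paths p q"
    then have "reversepath \<gamma> \<in> paths q p" "valid_path \<gamma>"
      by (auto simp: paths_def valid_path_reversepath)
    then show "(INF \<gamma>\<in>paths q p. path_length (warped_metric a) \<gamma>) \<le> path_length (warped_metric a) \<gamma>"
      using INF_lower[of "reversepath \<gamma>" "paths q p" "path_length (warped_metric a)"] by (simp add: path_length_reversepath)
  qed
  then show ?thesis unfolding distance_eq by (metis order_antisym)
qed

lemma distance_triangle:
  fixes p q r :: "real \<times> 'b"
  assumes p: "p \<in> sphere_product" and q: "q \<in> sphere_product" and r: "r \<in> sphere_product"
  shows "distance p r \<le> distance p q + distance q r"
proof (rule field_le_epsilon)
  fix \<epsilon> :: real assume \<epsilon>: "0 < \<epsilon>"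
  obtain \<gamma>\<^sub>1 where 1: "\<gamma>\<^sub>1 \<in> paths p q" "path_length (warped_metric a) \<gamma>\<^sub>1 \<le> ennreal (distance p q + \<epsilon> / 2)"
    using near_optimal_path[OF p q, of "\<epsilon> / 2"] \<epsilon> by auto
  obtain \<gamma>\<^sub>2 where 2: "\<gamma>\<^sub>2 \<in> paths q r" "path_length (warped_metric a) \<gamma>\<^sub>2 \<le> ennreal (distance q r + \<epsilon> / 2)"
    using near_optimal_path[OF q r, of "\<epsilon> / 2"] \<epsilon> by auto
  have join: "\<gamma>\<^sub>1 +++ \<gamma>\<^sub>2 \<in> paths p r"
    using 1(1) 2(1) by (auto simp: paths_def valid_path_join path_image_join)
  have "path_length (warped_metric a) (\<gamma>\<^sub>1 +++ \<gamma>\<^sub>2) \<le> ennreal (distance p q + \<epsilon> / 2) + ennreal (distance q r + \<epsilon> / 2)"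
    using 1 2 by (subst path_length_join) (auto simp: paths_def intro: add_mono)
  also have "\<dots> = ennreal (distance p q + distance q r + \<epsilon>)"
    using distance_nonneg[of p q] distance_nonneg[of q r] \<epsilon> by (simp flip: ennreal_plus)
  finally show "distance p r \<le> distance p q + distance q r + \<epsilon>"
    using distance_nonneg[of p q] distance_nonneg[of q r] \<epsilon> by (intro distance_le_path[OF join]) auto
qed

lemma distance_zero:
  fixes p q :: "real \<times> 'b"
  assumes p: "p \<in> sphere_product" and q: "q \<in> sphere_product"
  shows "distance p q = 0 \<longleftrightarrow> p = q"
proof
  assume 0: "distance p q = 0"
  obtain m where m: "0 < m" "\<forall>s\<in>cball (fst p) 1. m\<^sup>2 \<le> a s"
    using a_lower[of "cball (fst p) 1"] by auto
  have "m * norm (snd q - snd p) \<le> 0"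
    using angular_le_distance[OF p q m(1), of 1] m(2) 0 by (auto simp: dist_real_def abs_minus_commute)
  moreover have "0 \<le> m * norm (snd q - snd p)" using m by simp
  ultimately have "m * norm (snd q - snd p) = 0" by linarith
  then have "snd q = snd p" using m by simp
  moreover have "fst q = fst p" using radial_le_distance[OF p q] 0 by simp
  ultimately show "p = q" by (simp add: prod_eq_iff)
next
  assume eq: "p = q"
  obtain A where "0 \<le> A" "\<forall>s\<in>closed_segment (fst p) (fst q). a s \<le> A\<^sup>2"
    using a_upper[OF compact_segment] by blast
  then have "distance p q \<le> A * arccos (snd p \<bullet> snd q) + \<bar>fst q - fst p\<bar>"
    using distance_upper[OF p q] by blast
  then show "distance p q = 0" using p eq distance_nonneg[of p q] by auto
qed

lemma Metric_space_distance: "Metric_space (sphere_product :: (real \<times> 'b) set) distance"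
  by unfold_locales (auto simp: distance_nonneg distance_zero intro: distance_triangle distance_commute)

text \<open>The radial coordinate of a Cauchy sequence stays in a compact interval. There \<open>a\<close> is bounded
  from both sides, so that the geodesic distance is equivalent to that of \<open>\<real> \<times> L\<^sup>2\<close>.\<close>

lemma mcomplete_distance: "Metric_space.mcomplete (sphere_product :: (real \<times> 'b) set) distance"
proof -
  interpret Metric_space "sphere_product :: (real \<times> 'b) set" distance by (rule Metric_space_distance)
  show ?thesis
    unfolding mcomplete_def
  proof (intro allI impI)
    fix \<sigma> :: "nat \<Rightarrow> real \<times> 'b" assume "MCauchy \<sigma>"
    then have \<sigma>: "\<And>n. \<sigma> n \<in> sphere_product"
      and Cauchy: "\<And>\<epsilon>. 0 < \<epsilon> \<Longrightarrow> \<exists>N. \<forall>n n'. N \<le> n \<longrightarrow> N \<le> n' \<longrightarrow> distance (\<sigma> n) (\<sigma> n') < \<epsilon>"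
      unfolding MCauchy_def by blast+
    define s \<phi> where "s n = fst (\<sigma> n)" and "\<phi> n = snd (\<sigma> n)" for n
    obtain N where N: "\<And>n n'. N \<le> n \<Longrightarrow> N \<le> n' \<Longrightarrow> distance (\<sigma> n) (\<sigma> n') < 1" using Cauchy[of 1] by auto
    define T where "T = {s N - 2..s N + 2}"
    have sN: "\<bar>s n - s N\<bar> < 1" if "N \<le> n" for n
      using radial_le_distance[OF \<sigma> \<sigma>, of n N] N[OF le_refl that] by (simp add: s_def)
    obtain m where m: "0 < m" "\<And>r. r \<in> T \<Longrightarrow> m\<^sup>2 \<le> a r"
      using a_lower[of T] by (auto simp: T_def)
    obtain A where A: "0 \<le> A" "\<And>r. r \<in> T \<Longrightarrow> a r \<le> A\<^sup>2"
      using a_upper[of T] by (auto simp: T_def)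
    have ang: "m * norm (\<phi> n' - \<phi> n) \<le> distance (\<sigma> n) (\<sigma> n')" if "N \<le> n" "N \<le> n'" for n n'
      unfolding \<phi>_def
    proof (rule angular_le_distance[OF \<sigma> \<sigma> m(1) _ N[OF that]])
      show "m\<^sup>2 \<le> a r" if "\<bar>r - fst (\<sigma> n)\<bar> \<le> 1" for r
        using that sN[OF \<open>N \<le> n\<close>] unfolding s_def T_def by (intro m(2)) (auto simp: T_def s_def abs_le_iff abs_less_iff)
    qed
    have "Cauchy s"
    proof (rule metric_CauchyI)
      fix e :: real assume "0 < e"
      then obtain M where "\<forall>n n'. M \<le> n \<longrightarrow> M \<le> n' \<longrightarrow> distance (\<sigma> n) (\<sigma> n') < e" using Cauchy by blast
      then show "\<exists>M. \<forall>n\<ge>M. \<forall>n'\<ge>M. dist (s n) (s n') < e"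
        using radial_le_distance[OF \<sigma> \<sigma>] unfolding s_def dist_real_def by (meson le_less_trans abs_minus_commute dist_commute distance_commute)
    qed
    then obtain s' where s': "s \<longlonglongrightarrow> s'" using Cauchy_convergent_iff convergent_def by metis
    have "Cauchy \<phi>"
    proof (rule metric_CauchyI)
      fix e :: real assume e: "0 < e"
      then obtain M where M: "\<And>n n'. M \<le> n \<Longrightarrow> M \<le> n' \<Longrightarrow> distance (\<sigma> n) (\<sigma> n') < m * e"
        using Cauchy[of "m * e"] m(1) by auto
      have "dist (\<phi> n) (\<phi> n') < e" if "max M N \<le> n" "max M N \<le> n'" for n n'
      proof -
        have "m * norm (\<phi> n - \<phi> n') < m * e"
          using ang[of n' n] M[of n' n] that by simp
        then show ?thesis using m(1) by (simp add: dist_norm)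
      qed
      then show "\<exists>M. \<forall>n\<ge>M. \<forall>n'\<ge>M. dist (\<phi> n) (\<phi> n') < e" by blast
    qed
    then obtain \<phi>' where \<phi>': "\<phi> \<longlonglongrightarrow> \<phi>'" using complete convergent_def by blast
    have unit: "\<phi> n \<bullet> \<phi> n = 1" for n using \<sigma>[of n] by (auto simp: \<phi>_def)
    have "(\<lambda>n. \<phi> n \<bullet> \<phi> n) \<longlonglongrightarrow> \<phi>' \<bullet> \<phi>'" by (intro tendsto_intros \<phi>')
    then have "(\<lambda>n. 1) \<longlonglongrightarrow> \<phi>' \<bullet> \<phi>'" by (simp only: unit)
    from LIMSEQ_unique[OF tendsto_const this] have unit': "\<phi>' \<bullet> \<phi>' = 1" by simp
    have s'T: "s' \<in> T"
    proof (rule closed_sequentially[of T "\<lambda>n. s (n + N)"])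
      show "s (n + N) \<in> T" for n using sN[of "n + N"] by (simp add: T_def abs_less_iff)
      show "(\<lambda>n. s (n + N)) \<longlonglongrightarrow> s'" using s' by (rule LIMSEQ_ignore_initial_segment)
    qed (simp add: T_def)
    define l where "l = (s', \<phi>')"
    have l: "l \<in> sphere_product" using unit' by (simp add: l_def)
    have "(\<lambda>n. arccos (\<phi> n \<bullet> \<phi>')) \<longlonglongrightarrow> arccos 1"
    proof (rule continuous_on_tendsto_compose[OF continuous_on_arccos'])
      show "(\<lambda>n. \<phi> n \<bullet> \<phi>') \<longlonglongrightarrow> 1" using tendsto_inner[OF \<phi>' tendsto_const, of \<phi>'] unit' by simp
      have "\<bar>\<phi> n \<bullet> \<phi>'\<bar> \<le> norm (\<phi> n) * norm \<phi>'" for n by (rule Cauchy_Schwarz_ineq2)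
      then have "\<phi> n \<bullet> \<phi>' \<in> {-1..1}" for n using unit unit' by (simp add: norm_eq_sqrt_inner abs_le_iff)
      then show "\<forall>\<^sub>F n in sequentially. \<phi> n \<bullet> \<phi>' \<in> {-1..1}" by simp
    qed simp
    then have "(\<lambda>n. A * arccos (\<phi> n \<bullet> \<phi>') + \<bar>s' - s n\<bar>) \<longlonglongrightarrow> A * arccos 1 + \<bar>s' - s'\<bar>"
      by (intro tendsto_intros s')
    then have lim: "(\<lambda>n. A * arccos (\<phi> n \<bullet> \<phi>') + \<bar>s' - s n\<bar>) \<longlonglongrightarrow> 0" by simp
    have "distance (\<sigma> n) l \<le> A * arccos (\<phi> n \<bullet> \<phi>') + \<bar>s' - s n\<bar>" if "N \<le> n" for n
    proof -
      have "closed_segment (s n) s' \<subseteq> T"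
        using sN[OF that] s'T unfolding T_def
        by (intro closed_segment_subset) (auto simp: abs_less_iff)
      then show ?thesis
        using distance_upper[OF \<sigma>[of n] l A(1)] A(2) by (auto simp: s_def \<phi>_def l_def)
    qed
    then have "limitin mtopology \<sigma> l sequentially"
      using order_tendstoD(2)[OF lim] l \<sigma>
      unfolding limit_metric_sequentially eventually_sequentially
      by (smt (verit, best) nle_le order_trans)
    then show "\<exists>x. limitin mtopology \<sigma> x sequentially" by blast
  qed
qed

end

section \<open>Completeness\<close>

theorem mainTheorem3:
  fixes \<A> :: "('m::{t2_space, second_countable_topology, reference_measure}, 'n::finite) chart set"
    and C\<^sub>1 C\<^sub>2 :: "real \<Rightarrow> real"
  assumes "compact (UNIV :: 'm set)"
    and "smooth_atlas \<A>"
    and "smooth_positive_density \<A> \<mu>\<^sub>0"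
    and "emeasure (\<mu>\<^sub>0 :: 'm measure) UNIV = 1"
    and "smooth_on {0<..} C\<^sub>1" and "smooth_on {0<..} C\<^sub>2"
    and "\<And>m. 0 < m \<Longrightarrow> 0 < C\<^sub>1 m"
    and "\<And>m. 0 < m \<Longrightarrow> - (1 / m) * C\<^sub>1 m < C\<^sub>2 m"
    and "W_minus C\<^sub>1 C\<^sub>2 = - \<infinity>" and "W_plus C\<^sub>1 C\<^sub>2 = \<infinity>"
  shows "Metric_space (UNIV \<times> L2_sphere)
             (geodesic_dist (UNIV \<times> (L2_sphere :: 'm L2 set)) (Gbar C\<^sub>1 C\<^sub>2)) \<and>
           Metric_space.mcomplete (UNIV \<times> L2_sphere)
             (geodesic_dist (UNIV \<times> (L2_sphere :: 'm L2 set)) (Gbar C\<^sub>1 C\<^sub>2)) \<and>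
           geodesically_complete smooth_into_S smooth_into_S
             (Gbar C\<^sub>1 C\<^sub>2 :: (real \<times> 'm L2) metric_tensor) \<and>
           geodesically_complete (smooth_into_S_Cinf \<A>) (smooth_into_S_Cinf \<A>)
             (Gbar C\<^sub>1 C\<^sub>2 :: (real \<times> 'm L2) metric_tensor)"
proof -
  have manifold: "density_manifold \<A>"
    by unfold_locales (use assms(1-4) in auto)
  interpret density_manifold \<A> by fact
  interpret complete_radial_metric C\<^sub>1 C\<^sub>2
    by unfold_locales (use assms(5-10) in auto)
  interpret warped_sphere "warp C\<^sub>1 C\<^sub>2" "TYPE('m L2)"
    by unfold_locales (auto intro: smooth_warp warp_pos orthogonal_unit L2_complete[OF finite_reference])
  have metric: "Gbar C\<^sub>1 C\<^sub>2 = (warped_metric (warp C\<^sub>1 C\<^sub>2) :: (real \<times> 'm L2) metric_tensor)"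
    by (intro ext) (simp add: Gbar_def warped_metric_def)
  show ?thesis
    unfolding metric L2_sphere_def
    by (intro conjI Metric_space_distance mcomplete_distance geodesically_complete_S
        geodesically_complete_S_Cinf manifold)
qed

end
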